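(* Let $n,s$ be positive integers with $n\ge 3$, and let $V_n\subset \mathbb{P}^N$, $N=2^n-1$, be the Segre embedding of $\mathbb{P}^1\times\cdots\times\mathbb{P}^1$ ($n$ times). If $(n,s)\neq(4,3)$, then the $s$-th higher secant variety has the expected dimension: $$\dim \sigma_s(V_n)=\min\{N,\ s(n+1)-1\}.$$ Moreover, $\dim\sigma_3(V_4)=13$ (rather than $14$, the expected value).
   Context: The base field $\kappa$ is algebraically closed of characteristic $0$. The Segre embedding of $\mathbb{P}^1\times\cdots\times\mathbb{P}^1$ is the one given by the line bundle $\mathcal{O}(1,\dots,1)$. For a closed irreducible non-degenerate variety $V\subseteq\mathbb{P}^N$, the $s$-th higher secant variety $\sigma_s(V)$ is the (Zariski) closure of the union of all linear subspaces of $\mathbb{P}^N$ spanned by $s$ points of $V$. *)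

theory Defs
  imports
    "HOL-Analysis.Analysis"
    "HOL-Library.Poly_Mapping"
    "HOL-Library.Function_Algebras"
    "HOL-Library.Extended_Nat"
    "HOL-Computational_Algebra.Polynomial"
begin

section \<open>Projective space\<close>

text \<open>
  The coordinate space with coordinates \<open>x\<^sub>0, \<dots>, x\<^sub>N\<close> is the space of functions on \<open>nat\<close> that
  vanish beyond \<open>N\<close>.  A point of projective space is a one-dimensional subspace (as a set of
  vectors, so it contains the zero vector).
\<close>

type_synonym 'k point = "(nat \<Rightarrow> 'k) set"

definition vscale :: "'k::field \<Rightarrow> (nat \<Rightarrow> 'k) \<Rightarrow> nat \<Rightarrow> 'k" where
  "vscale c v = (\<lambda>i. c * v i)"

global_interpretation vec: vector_space vscale
  defines vspan = vec.span
  by unfold_locales (auto simp: vscale_def fun_eq_iff algebra_simps)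

definition coord_space :: "nat \<Rightarrow> (nat \<Rightarrow> 'k::field) set" where
  "coord_space N = {v. \<forall>i>N. v i = 0}"

definition proj_space :: "nat \<Rightarrow> 'k::field point set" where
  "proj_space N = {vspan {v} |v. v \<in> coord_space N \<and> v \<noteq> 0}"

definition proj_span :: "nat \<Rightarrow> 'k::field point set \<Rightarrow> 'k point set" where
  "proj_span N A = {P \<in> proj_space N. P \<subseteq> vspan (\<Union>A)}"


section \<open>Polynomials and the Zariski topology\<close>

text \<open>
  A polynomial is a finitely supported function from exponent vectors to coefficients; the
  multiplication of \<^theory>\<open>HOL-Library.Poly_Mapping\<close> is then that of polynomials.
\<close>

type_synonym 'k mpoly = "(nat \<Rightarrow>\<^sub>0 nat) \<Rightarrow>\<^sub>0 'k"

definition mono_degree :: "(nat \<Rightarrow>\<^sub>0 nat) \<Rightarrow> nat" where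
  "mono_degree m = (\<Sum>i\<in>Poly_Mapping.keys m. Poly_Mapping.lookup m i)"

definition mono_eval :: "(nat \<Rightarrow>\<^sub>0 nat) \<Rightarrow> (nat \<Rightarrow> 'k::field) \<Rightarrow> 'k" where
  "mono_eval m v = (\<Prod>i\<in>Poly_Mapping.keys m. v i ^ Poly_Mapping.lookup m i)"

definition poly_eval :: "'k::field mpoly \<Rightarrow> (nat \<Rightarrow> 'k) \<Rightarrow> 'k" where
  "poly_eval f v = (\<Sum>m\<in>Poly_Mapping.keys f. Poly_Mapping.lookup f m * mono_eval m v)"

definition homogeneous :: "nat \<Rightarrow> 'k::field mpoly \<Rightarrow> bool" where
  "homogeneous N f \<longleftrightarrow>
     (\<exists>d. \<forall>m\<in>Poly_Mapping.keys f. Poly_Mapping.keys m \<subseteq> {..N} \<and> mono_degree m = d)"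

definition zero_locus :: "nat \<Rightarrow> 'k::field mpoly set \<Rightarrow> 'k point set" where
  "zero_locus N T = {P \<in> proj_space N. \<forall>f\<in>T. \<forall>v\<in>P - {0}. poly_eval f v = 0}"

definition zariski :: "nat \<Rightarrow> 'k::field point topology" where
  "zariski N = topology (\<lambda>U. \<exists>T. (\<forall>f\<in>T. homogeneous N f) \<and> U = proj_space N - zero_locus N T)"

lemma mono_eval_superset:
  assumes "finite A" "Poly_Mapping.keys m \<subseteq> A"
  shows "mono_eval m v = (\<Prod>i\<in>A. v i ^ Poly_Mapping.lookup m i)"
  unfolding mono_eval_def using assms
  by (intro prod.mono_neutral_left) (auto simp: in_keys_iff)

lemma mono_degree_superset:
  assumes "finite A" "Poly_Mapping.keys m \<subseteq> A"
  shows "mono_degree m = (\<Sum>i\<in>A. Poly_Mapping.lookup m i)"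
  unfolding mono_degree_def using assms
  by (intro sum.mono_neutral_left) (auto simp: in_keys_iff)

lemma poly_eval_superset:
  assumes "finite A" "Poly_Mapping.keys f \<subseteq> A"
  shows "poly_eval f v = (\<Sum>m\<in>A. Poly_Mapping.lookup f m * mono_eval m v)"
  unfolding poly_eval_def using assms
  by (intro sum.mono_neutral_left) (auto simp: in_keys_iff)

lemma mono_eval_add: "mono_eval (m + n) v = mono_eval m v * mono_eval n v"
proof -
  let ?A = "Poly_Mapping.keys m \<union> Poly_Mapping.keys n"
  have "finite ?A" "Poly_Mapping.keys (m + n) \<subseteq> ?A"
    using keys_add[of m n] by auto
  then show ?thesis
    by (simp add: mono_eval_superset[of ?A] lookup_add power_add prod.distrib)
qed

lemma mono_degree_add: "mono_degree (m + n) = mono_degree m + mono_degree n"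
proof -
  let ?A = "Poly_Mapping.keys m \<union> Poly_Mapping.keys n"
  have "finite ?A" "Poly_Mapping.keys (m + n) \<subseteq> ?A"
    using keys_add[of m n] by auto
  then show ?thesis
    by (simp add: mono_degree_superset[of ?A] lookup_add sum.distrib)
qed

lemma poly_eval_zero [simp]: "poly_eval 0 v = 0"
  by (simp add: poly_eval_def)

lemma poly_eval_one [simp]: "poly_eval 1 v = 1"
  by (simp add: poly_eval_def mono_eval_def flip: single_one)

lemma poly_eval_add: "poly_eval (f + g) v = poly_eval f v + poly_eval g v"
proof -
  let ?A = "Poly_Mapping.keys f \<union> Poly_Mapping.keys g"
  have "finite ?A" "Poly_Mapping.keys (f + g) \<subseteq> ?A"
    using keys_add[of f g] by auto
  then show ?thesis
    by (simp add: poly_eval_superset[of ?A] lookup_add sum.distrib distrib_right)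
qed

lemma poly_eval_sum: "poly_eval (sum f A) v = (\<Sum>x\<in>A. poly_eval (f x) v)"
  by (induction A rule: infinite_finite_induct) (simp_all add: poly_eval_add)

lemma poly_eval_single: "poly_eval (Poly_Mapping.single m c) v = c * mono_eval m v"
  by (simp add: poly_eval_def)

lemma mpoly_sum_single:
  "f = (\<Sum>m\<in>Poly_Mapping.keys f. Poly_Mapping.single m (Poly_Mapping.lookup f m))"
  by (rule poly_mapping_eqI)
     (auto simp: lookup_sum lookup_single when_def in_keys_iff)

lemma poly_eval_mult: "poly_eval (f * g) v = poly_eval f v * poly_eval g v"
proof -
  have "f * g = (\<Sum>m\<in>Poly_Mapping.keys f. \<Sum>n\<in>Poly_Mapping.keys g.
      Poly_Mapping.single (m + n) (Poly_Mapping.lookup f m * Poly_Mapping.lookup g n))"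
    unfolding mult_single[symmetric] sum_product[symmetric] mpoly_sum_single[symmetric] ..
  then have "poly_eval (f * g) v = (\<Sum>m\<in>Poly_Mapping.keys f. \<Sum>n\<in>Poly_Mapping.keys g.
      Poly_Mapping.lookup f m * mono_eval m v * (Poly_Mapping.lookup g n * mono_eval n v))"
    by (simp only: poly_eval_sum poly_eval_single mono_eval_add mult_ac)
  then show ?thesis
    by (simp add: poly_eval_def sum_product)
qed

lemma homogeneous_mult:
  assumes "homogeneous N f" "homogeneous N g"
  shows "homogeneous N (f * g)"
proof -
  obtain d e where
    d: "\<And>m. m \<in> Poly_Mapping.keys f \<Longrightarrow> Poly_Mapping.keys m \<subseteq> {..N} \<and> mono_degree m = d" and
    e: "\<And>m. m \<in> Poly_Mapping.keys g \<Longrightarrow> Poly_Mapping.keys m \<subseteq> {..N} \<and> mono_degree m = e"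
    using assms unfolding homogeneous_def by metis
  have "Poly_Mapping.keys m \<subseteq> {..N} \<and> mono_degree m = d + e"
    if m: "m \<in> Poly_Mapping.keys (f * g)" for m
  proof -
    obtain a b where ab: "m = a + b" "a \<in> Poly_Mapping.keys f" "b \<in> Poly_Mapping.keys g"
      using m keys_mult[of f g] by blast
    then show ?thesis
      using d[OF ab(2)] e[OF ab(3)] keys_add[of a b] by (auto simp: mono_degree_add)
  qed
  then show ?thesis
    unfolding homogeneous_def by blast
qed

lemma homogeneous_zero [simp]: "homogeneous N 0"
  by (simp add: homogeneous_def)

lemma homogeneous_single:
  "Poly_Mapping.keys m \<subseteq> {..N} \<Longrightarrow> homogeneous N (Poly_Mapping.single m c)"
  by (auto simp: homogeneous_def)

lemma poly_eval_vscale: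
  assumes "\<And>m. m \<in> Poly_Mapping.keys f \<Longrightarrow> mono_degree m = d"
  shows "poly_eval f (vscale c v) = c ^ d * poly_eval f v"
proof -
  have "mono_eval m (vscale c v) = c ^ d * mono_eval m v" if "m \<in> Poly_Mapping.keys f" for m
    using assms[OF that]
    by (auto simp: mono_eval_def vscale_def mono_degree_def power_mult_distrib prod.distrib
          power_sum)
  then show ?thesis
    by (simp add: poly_eval_def sum_distrib_left mult_ac)
qed

lemma vspan_singleton: "vspan {v} = range (\<lambda>c. vscale c v)"
  by (rule vec.span_singleton)

text \<open>The vanishing of a homogeneous polynomial at a point may be tested on any representative.\<close>

lemma vanishing_representative:
  assumes "homogeneous N f" "v \<noteq> 0"
  shows "(\<forall>w\<in>vspan {v} - {0}. poly_eval f w = 0) \<longleftrightarrow> poly_eval f v = 0"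
proof
  assume "\<forall>w\<in>vspan {v} - {0}. poly_eval f w = 0"
  moreover have "v \<in> vspan {v}" by (simp add: vec.span_base)
  ultimately show "poly_eval f v = 0" using assms(2) by blast
next
  assume 0: "poly_eval f v = 0"
  obtain d where "\<And>m. m \<in> Poly_Mapping.keys f \<Longrightarrow> mono_degree m = d"
    using assms(1) unfolding homogeneous_def by blast
  then show "\<forall>w\<in>vspan {v} - {0}. poly_eval f w = 0"
    using 0 by (auto simp: vspan_singleton poly_eval_vscale)
qed

lemma zero_locus_mult:
  assumes "\<forall>f\<in>S. homogeneous N f" "\<forall>g\<in>T. homogeneous N g"
  shows "zero_locus N {f * g |f g. f \<in> S \<and> g \<in> T} = zero_locus N S \<union> zero_locus N T"
proof -
  have "(\<forall>h\<in>{f * g |f g. f \<in> S \<and> g \<in> T}. \<forall>w\<in>P - {0}. poly_eval h w = 0) \<longleftrightarrow>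
        (\<forall>f\<in>S. \<forall>w\<in>P - {0}. poly_eval f w = 0) \<or> (\<forall>g\<in>T. \<forall>w\<in>P - {0}. poly_eval g w = 0)"
    if P: "P \<in> proj_space N" for P
  proof -
    obtain v where v: "v \<noteq> 0" "P = vspan {v}"
      using P by (auto simp: proj_space_def)
    have S: "(\<forall>w\<in>P - {0}. poly_eval f w = 0) \<longleftrightarrow> poly_eval f v = 0" if "f \<in> S" for f
      using vanishing_representative assms(1) v that by blast
    have T: "(\<forall>w\<in>P - {0}. poly_eval g w = 0) \<longleftrightarrow> poly_eval g v = 0" if "g \<in> T" for g
      using vanishing_representative assms(2) v that by blast
    have ST: "(\<forall>w\<in>P - {0}. poly_eval (f * g) w = 0) \<longleftrightarrow> poly_eval f v = 0 \<or> poly_eval g v = 0"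
      if "f \<in> S" "g \<in> T" for f g
    proof -
      have "homogeneous N (f * g)"
        using homogeneous_mult assms that by blast
      then show ?thesis
        using vanishing_representative v by (metis poly_eval_mult mult_eq_0_iff)
    qed
    have "(\<forall>h\<in>{f * g |f g. f \<in> S \<and> g \<in> T}. \<forall>w\<in>P - {0}. poly_eval h w = 0) \<longleftrightarrow>
          (\<forall>f\<in>S. \<forall>g\<in>T. \<forall>w\<in>P - {0}. poly_eval (f * g) w = 0)"
      by blast
    also have "\<dots> \<longleftrightarrow> (\<forall>f\<in>S. \<forall>g\<in>T. poly_eval f v = 0 \<or> poly_eval g v = 0)"
      by (intro ball_cong refl ST)
    also have "\<dots> \<longleftrightarrow> (\<forall>f\<in>S. poly_eval f v = 0) \<or> (\<forall>g\<in>T. poly_eval g v = 0)"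
      by blast
    also have "(\<forall>f\<in>S. poly_eval f v = 0) \<longleftrightarrow> (\<forall>f\<in>S. \<forall>w\<in>P - {0}. poly_eval f w = 0)"
      by (intro ball_cong refl S[symmetric])
    also have "(\<forall>g\<in>T. poly_eval g v = 0) \<longleftrightarrow> (\<forall>g\<in>T. \<forall>w\<in>P - {0}. poly_eval g w = 0)"
      by (intro ball_cong refl T[symmetric])
    finally show ?thesis .
  qed
  then have "P \<in> zero_locus N {f * g |f g. f \<in> S \<and> g \<in> T} \<longleftrightarrow>
      P \<in> zero_locus N S \<or> P \<in> zero_locus N T" for P
    unfolding zero_locus_def mem_Collect_eq by meson
  then show ?thesis
    by (intro set_eqI) (simp only: Un_iff)
qed

lemma istopology_zariski:
  "istopology (\<lambda>U :: 'k::field point set. \<exists>T. (\<forall>f\<in>T. homogeneous N f) \<and> U = proj_space N - zero_locus N T)"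
  (is "istopology ?open")
  unfolding istopology_def
proof (intro conjI allI impI)
  fix U V :: "'k point set" assume "?open U" "?open V"
  then obtain S T where
    S: "\<forall>f\<in>S. homogeneous N f" "U = proj_space N - zero_locus N S" and
    T: "\<forall>f\<in>T. homogeneous N f" "V = proj_space N - zero_locus N T"
    by blast
  have "U \<inter> V = proj_space N - zero_locus N {f * g |f g. f \<in> S \<and> g \<in> T}"
    unfolding zero_locus_mult[OF S(1) T(1)] S(2) T(2) by blast
  moreover have "\<forall>h\<in>{f * g |f g. f \<in> S \<and> g \<in> T}. homogeneous N h"
    using S T homogeneous_mult by blast
  ultimately show "?open (U \<inter> V)" by blast
next
  fix \<U> :: "'k point set set" assume "\<forall>U\<in>\<U>. ?open U"
  then obtain T where T: "\<And>U. U \<in> \<U> \<Longrightarrow>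
      (\<forall>f\<in>T U. homogeneous N f) \<and> U = proj_space N - zero_locus N (T U)"
    by metis
  have "zero_locus N (\<Union>U\<in>\<U>. T U) = {P \<in> proj_space N. \<forall>U\<in>\<U>. P \<in> zero_locus N (T U)}"
    unfolding zero_locus_def by auto
  moreover have "P \<in> U \<longleftrightarrow> P \<in> proj_space N \<and> P \<notin> zero_locus N (T U)" if "U \<in> \<U>" for U P
    using T[OF that] by (metis Diff_iff)
  ultimately have "\<Union>\<U> = proj_space N - zero_locus N (\<Union>U\<in>\<U>. T U)"
    by (intro set_eqI) (simp only: Union_iff Diff_iff mem_Collect_eq, metis)
  moreover have "\<forall>f\<in>(\<Union>U\<in>\<U>. T U). homogeneous N f" using T by blast
  ultimately show "?open (\<Union>\<U>)" by blast
qed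

lemma openin_zariski:
  "openin (zariski N) U \<longleftrightarrow>
     (\<exists>T. (\<forall>f\<in>T. homogeneous N f) \<and> U = proj_space N - zero_locus N T)"
  unfolding zariski_def by (simp add: istopology_zariski)

lemma topspace_zariski [simp]: "topspace (zariski N) = (proj_space N :: 'k::field point set)"
proof
  show "topspace (zariski N) \<subseteq> (proj_space N :: 'k point set)"
    unfolding topspace_def by (auto simp: openin_zariski)
  have "zero_locus N {1} = ({} :: 'k point set)"
  proof -
    have "\<exists>w\<in>P - {0}. True" if "P \<in> proj_space N" for P :: "'k point"
      using that vec.span_base by (fastforce simp: proj_space_def)
    then show ?thesis by (fastforce simp: zero_locus_def)
  qed
  moreover have "homogeneous N (1 :: 'k mpoly)"
    using homogeneous_single[of 0 N 1] by simp
  ultimately have "openin (zariski N) (proj_space N :: 'k point set)"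
    unfolding openin_zariski by (intro exI[of _ "{1}"]) simp
  then show "proj_space N \<subseteq> (topspace (zariski N) :: 'k point set)"
    by (rule openin_subset)
qed

lemma closedin_zariski:
  "closedin (zariski N) Z \<longleftrightarrow> (\<exists>T. (\<forall>f\<in>T. homogeneous N f) \<and> Z = zero_locus N T)"
proof -
  have sub: "zero_locus N T \<subseteq> proj_space N" for T :: "'k::field mpoly set"
    by (auto simp: zero_locus_def)
  have "Z \<subseteq> proj_space N \<and> proj_space N - Z = proj_space N - zero_locus N T \<longleftrightarrow>
      Z = zero_locus N T" for T
    using sub[of T] by blast
  then show ?thesis
    unfolding closedin_def openin_zariski topspace_zariski by blast
qed


section \<open>Dimension\<close>

definition irreducible_space :: "'a topology \<Rightarrow> bool" where
  "irreducible_space X \<longleftrightarrow> topspace X \<noteq> {} \<and>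
     (\<forall>A B. closedin X A \<and> closedin X B \<and> A \<union> B = topspace X \<longrightarrow>
        A = topspace X \<or> B = topspace X)"

text \<open>
  The Krull dimension of a topological space.  The empty space gets dimension \<open>0\<close>, the supremum
  of the empty set.
\<close>

definition krull_dim :: "'a topology \<Rightarrow> enat" where
  "krull_dim X = Sup {enat d |d. \<exists>Z :: nat \<Rightarrow> 'a set.
     (\<forall>i\<le>d. closedin X (Z i) \<and> irreducible_space (subtopology X (Z i))) \<and>
     (\<forall>i<d. Z i \<subset> Z (Suc i))}"

definition proj_dim :: "nat \<Rightarrow> 'k::field point set \<Rightarrow> enat" where
  "proj_dim N Y = krull_dim (subtopology (zariski N) Y)"


section \<open>Secant and Segre varieties\<close>

definition secant_variety :: "nat \<Rightarrow> nat \<Rightarrow> 'k::field point set \<Rightarrow> 'k point set" where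
  "secant_variety N s V =
     zariski N closure_of (\<Union>A\<in>{A. A \<subseteq> V \<and> finite A \<and> card A = s}. proj_span N A)"

text \<open>
  The coordinates \<open>x\<^sub>j\<close>, \<open>j < 2 ^ n\<close>, of the target of the Segre embedding correspond to the
  multilinear monomials spanning the sections of \<open>\<O>(1,\<dots>,1)\<close>: in \<open>x\<^sub>j\<close> the \<open>i\<close>-th factor
  contributes its coordinate of index \<open>0\<close> or \<open>1\<close>, namely the \<open>i\<close>-th binary digit of \<open>j\<close>.
\<close>

definition segre_vector :: "nat \<Rightarrow> (nat \<Rightarrow> nat \<Rightarrow> 'k::field) \<Rightarrow> nat \<Rightarrow> 'k" where
  "segre_vector n a = (\<lambda>j. if j < 2 ^ n then \<Prod>i<n. a i (of_bool (bit j i)) else 0)"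

text \<open>
  The image of a tuple \<open>p\<close> of points of the projective line: changing the representatives of
  \<open>p i\<close> only rescales the vector, so the span below is a point.
\<close>

definition segre_map :: "nat \<Rightarrow> (nat \<Rightarrow> 'k::field point) \<Rightarrow> 'k point" where
  "segre_map n p = vspan {segre_vector n a |a. \<forall>i<n. a i \<in> p i}"

definition segre_variety :: "nat \<Rightarrow> 'k::field point set" where
  "segre_variety n = segre_map n ` ({..<n} \<rightarrow>\<^sub>E proj_space 1)"

lemma segre_vector_vscale:
  "segre_vector n (\<lambda>i. vscale (c i) (a i)) = vscale (\<Prod>i<n. c i) (segre_vector n a)"
  by (auto simp: segre_vector_def vscale_def prod.distrib)

lemma segre_map_eq:
  assumes "\<And>i. i < n \<Longrightarrow> p i = vspan {a i}"
  shows "segre_map n p = vspan {segre_vector n a}"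
proof -
  have "segre_vector n b \<in> vspan {segre_vector n a}" if b: "\<forall>i<n. b i \<in> p i" for b
  proof -
    have "\<forall>i<n. \<exists>c. b i = vscale c (a i)"
      using b assms by (auto simp: vspan_singleton)
    then obtain c where c: "\<And>i. i < n \<Longrightarrow> b i = vscale (c i) (a i)" by metis
    have "segre_vector n b = segre_vector n (\<lambda>i. vscale (c i) (a i))"
      unfolding segre_vector_def by (intro ext if_cong refl prod.cong) (simp add: c)
    then show ?thesis
      unfolding segre_vector_vscale vspan_singleton by blast
  qed
  moreover have "segre_vector n a \<in> {segre_vector n a |a. \<forall>i<n. a i \<in> p i}"
    using assms vec.span_base by blast
  ultimately show ?thesis
    unfolding segre_map_def
    by (intro subset_antisym vec.span_minimal vec.subspace_span vec.span_mono) auto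
qed

lemma segre_vector_nonzero:
  assumes "\<And>i. i < n \<Longrightarrow> a i \<in> coord_space 1 \<and> a i \<noteq> 0"
  shows "segre_vector n a \<noteq> 0"
proof -
  have "\<exists>b. a i (of_bool b) \<noteq> 0" if i: "i < n" for i
  proof -
    obtain k where k: "a i k \<noteq> 0" using assms[OF i] by (auto simp: fun_eq_iff)
    then have "k \<le> 1" using assms[OF i] by (auto simp: coord_space_def not_less[symmetric])
    then have "k = of_bool (k = 1)" by auto
    then show ?thesis using k by metis
  qed
  then obtain b where b: "\<And>i. i < n \<Longrightarrow> a i (of_bool (b i)) \<noteq> 0" by metis
  define j :: nat where "j = horner_sum of_bool 2 (map b [0..<n])"
  have "j < 2 ^ n"
    using horner_sum_of_bool_2_less[of "map b [0..<n]"]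
    unfolding j_def by simp
  moreover have "bit j i = b i" if "i < n" for i
    using that by (simp add: j_def bit_horner_sum_bit_iff)
  ultimately have "segre_vector n a j \<noteq> 0"
    using b by (simp add: segre_vector_def)
  then show ?thesis by (auto simp: fun_eq_iff)
qed

lemma segre_variety_subset: "segre_variety n \<subseteq> proj_space (2 ^ n - 1)"
proof
  fix P :: "'k::field point" assume "P \<in> segre_variety n"
  then obtain p where p: "P = segre_map n p" "\<And>i. i < n \<Longrightarrow> p i \<in> proj_space 1"
    by (auto simp: segre_variety_def PiE_def Pi_def)
  then have "\<forall>i<n. \<exists>v. p i = vspan {v} \<and> v \<in> coord_space 1 \<and> v \<noteq> 0"
    by (auto simp: proj_space_def)
  then obtain a where
    a: "\<And>i. i < n \<Longrightarrow> p i = vspan {a i}" "\<And>i. i < n \<Longrightarrow> a i \<in> coord_space 1 \<and> a i \<noteq> 0"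
    by metis
  have "P = vspan {segre_vector n a}" "segre_vector n a \<noteq> 0"
    using p(1) segre_map_eq a segre_vector_nonzero by metis+
  moreover have "segre_vector n a \<in> coord_space (2 ^ n - 1)"
    by (auto simp: coord_space_def segre_vector_def)
  ultimately show "P \<in> proj_space (2 ^ n - 1)"
    unfolding proj_space_def by blast
qed

end

theory Submission
  imports Defs
begin

text \<open>
  By Terracini's lemma the dimension of \<open>\<sigma>\<^sub>s(V\<^sub>n)\<close> is governed by the multilinear forms with double zeros
  at \<open>s\<close> general points: there should be none if \<open>t\<close> further general zeros are imposed and
  \<open>2^n \<le> s (n + 1) + t\<close>, apart from \<open>(n, s) = (4, 3)\<close>.  This is proved by induction on \<open>n\<close>.  If \<open>s\<close>
  splits evenly enough, the last factor of each point is specialised to one of the two coordinate points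
  of the projective line.  Otherwise the last two factors degenerate to the four torus-fixed points of \<open>\<P>\<^sup>1 \<times> \<P>\<^sup>1\<close>, in such a way that the limit
  conditions can be distributed unevenly over the four resulting forms in \<open>n - 2\<close> factors.  The case
  \<open>n = 6\<close> comes from a covering code.

  Dimensions are compared through Hilbert functions.  A chain of irreducible closed sets of length \<open>l\<close>
  forces the number of independent forms of degree \<open>d\<close> to grow like \<open>d^l\<close>, whereas a parametrisation bounds
  it from above.  In the other direction, Terracini's tangent vectors give a flag of affine spaces of
  configurations whose images have independent differentials, and the closures of these images form a
  strict chain.  For \<open>(n, s) = (4, 3)\<close> two flattening determinants with coprime leading monomials
  vanish on the secant variety, and they lower the growth to \<open>d^13\<close>.
\<close>

text \<open>The simple zeros enter because specialising the last factor to a coordinate point cuts a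
  form into two: a double zero survives in one of them and leaves a simple zero in the other. The
  obstacle is parity. For \<open>s = 2 * h + 1\<close> the halves get \<open>n * (h + 1) + h\<close>
  and \<open>n * h + h + 1\<close> conditions, and the gap \<open>n - 1\<close> can be filled only
  if that many simple zeros are available. Four blocks alone do not help, as one double point is
  worth \<open>b + 1\<close> conditions in its own block. Approaching a fixed point along a curve
  moves single conditions between blocks and so allows a fine adjustment. The exceptional pair
  \<open>(4, 3)\<close> obstructs the recursion to four factors, which is why \<open>n = 6\<close>
  needs a construction of its own.

  The dimension is a Krull dimension, hence both bounds concern chains of closed sets. Counting
  forms serves as a substitute for transcendence degrees. General position is always argued on a
  line of configurations, where a nonzero polynomial in one variable has finitely many
  roots.\<close>

type_synonym 'k config = "nat \<Rightarrow> nat \<Rightarrow> nat \<Rightarrow> 'k"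

section \<open>Polynomial functions of one parameter and the rank of polynomial linear
  systems\<close>

definition polyfun :: "('k::field \<Rightarrow> 'k) \<Rightarrow> bool" where
  "polyfun g \<longleftrightarrow> (\<exists>p. \<forall>x. g x = poly p x)"

lemma polyfun_const [intro, simp]: "polyfun (\<lambda>x. c)"
  unfolding polyfun_def by (intro exI[of _ "[:c:]"]) simp

lemma polyfun_id [intro, simp]: "polyfun (\<lambda>x. x)"
  unfolding polyfun_def by (intro exI[of _ "[:0, 1:]"]) simp

lemma polyfun_add [intro]: "polyfun f \<Longrightarrow> polyfun g \<Longrightarrow> polyfun (\<lambda>x. f x + g x)"
  unfolding polyfun_def by (metis poly_add)

lemma polyfun_diff [intro]: "polyfun f \<Longrightarrow> polyfun g \<Longrightarrow> polyfun (\<lambda>x. f x - g x)"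
  unfolding polyfun_def by (metis poly_diff)

lemma polyfun_mult [intro]: "polyfun f \<Longrightarrow> polyfun g \<Longrightarrow> polyfun (\<lambda>x. f x * g x)"
  unfolding polyfun_def by (metis poly_mult)

lemma polyfun_power [intro]: "polyfun f \<Longrightarrow> polyfun (\<lambda>x. f x ^ n)"
  unfolding polyfun_def by (metis poly_power)

lemma polyfun_sum [intro]: "(\<And>i. i \<in> A \<Longrightarrow> polyfun (f i)) \<Longrightarrow> polyfun (\<lambda>x. \<Sum>i\<in>A. f i x)"
  by (induction A rule: infinite_finite_induct) (auto intro: polyfun_add)

lemma polyfun_prod [intro]: "(\<And>i. i \<in> A \<Longrightarrow> polyfun (f i)) \<Longrightarrow> polyfun (\<lambda>x. \<Prod>i\<in>A. f i x)"
  by (induction A rule: infinite_finite_induct) (auto intro: polyfun_mult)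

lemma polyfun_finite_zeros:
  assumes "polyfun g" "g x \<noteq> 0"
  shows "finite {\<tau>. g \<tau> = 0}"
proof -
  obtain p where p: "\<And>x. g x = poly p x" using assms(1) unfolding polyfun_def by blast
  then have "p \<noteq> 0" using assms(2) by auto
  then show ?thesis using poly_roots_finite p by simp
qed

text \<open>Full column rank at the single parameter \<open>x\<close> persists outside a finite set.
  Gaussian elimination shows this without minors: a bad parameter either kills the pivot entry or is
  bad for the eliminated system, which has one unknown less. The set of rows may be
  infinite.\<close>

lemma finite_bad_kernels:
  fixes R :: "(nat \<Rightarrow> 'k::field \<Rightarrow> 'k) set"
  assumes "\<And>r k. r \<in> R \<Longrightarrow> k < m \<Longrightarrow> polyfun (r k)"
    and "\<And>g. (\<And>r. r \<in> R \<Longrightarrow> (\<Sum>k<m. r k x * g k) = 0) \<Longrightarrow> \<forall>k<m. g k = 0"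
  shows "finite {\<tau>. \<exists>g. (\<exists>k<m. g k \<noteq> 0) \<and> (\<forall>r\<in>R. (\<Sum>k<m. r k \<tau> * g k) = 0)}"
  using assms
proof (induction m arbitrary: R)
  case 0
  then show ?case by simp
next
  case (Suc m)
  have "\<exists>r\<in>R. r m x \<noteq> 0"
  proof (rule ccontr)
    assume "\<not> ?thesis"
    then have "(\<Sum>k<Suc m. r k x * of_bool (k = m)) = 0" if "r \<in> R" for r
      using that by (auto intro!: sum.neutral)
    then have "\<forall>k<Suc m. (of_bool (k = m) :: 'k) = 0" by (intro Suc.prems(2))
    then show False by auto
  qed
  then obtain r0 where r0: "r0 \<in> R" "r0 m x \<noteq> 0" by blast
  \<comment> \<open>Cross-multiplication in place of division by the pivot keeps the new entries
    polynomial.\<close>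
  define E where "E r = (\<lambda>k \<tau>. r0 m \<tau> * r k \<tau> - r m \<tau> * r0 k \<tau>)" for r :: "nat \<Rightarrow> 'k \<Rightarrow> 'k"
  have E_sum: "(\<Sum>k<m. E r k \<tau> * g k) =
      r0 m \<tau> * (\<Sum>k<m. r k \<tau> * g k) - r m \<tau> * (\<Sum>k<m. r0 k \<tau> * g k)" for r \<tau> g
    by (simp add: E_def left_diff_distrib sum_subtractf sum_distrib_left mult.assoc)
  have IH: "finite {\<tau>. \<exists>g. (\<exists>k<m. g k \<noteq> 0) \<and> (\<forall>r\<in>E ` R. (\<Sum>k<m. r k \<tau> * g k) = 0)}"
  proof (rule Suc.IH)
    show "polyfun (r k)" if "r \<in> E ` R" "k < m" for r k
      using that Suc.prems(1) r0 by (auto simp: E_def intro!: polyfun_diff polyfun_mult)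
    show "\<forall>k<m. g k = 0" if g: "\<And>r. r \<in> E ` R \<Longrightarrow> (\<Sum>k<m. r k x * g k) = 0" for g
    proof -
      \<comment> \<open>The last unknown is chosen so that the pivot row vanishes; then the
        vanishing of the eliminated rows gives that of all rows.\<close>
      define h where "h = g(m := - (\<Sum>k<m. r0 k x * g k) / r0 m x)"
      have "(\<Sum>k<Suc m. r k x * h k) = 0" if "r \<in> R" for r
      proof -
        have "r0 m x * (\<Sum>k<m. r k x * g k) = r m x * (\<Sum>k<m. r0 k x * g k)"
          using g[of "E r"] that E_sum[of r x g] by simp
        moreover have "(\<Sum>k<m. r k x * h k) = (\<Sum>k<m. r k x * g k)"
          by (intro sum.cong) (auto simp: h_def)
        ultimately show ?thesis using r0 by (simp add: h_def field_simps)
      qed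
      then have "\<forall>k<Suc m. h k = 0" by (rule Suc.prems(2))
      then show ?thesis by (auto simp: h_def less_Suc_eq split: if_splits)
    qed
  qed
  have "{\<tau>. \<exists>g. (\<exists>k<Suc m. g k \<noteq> 0) \<and> (\<forall>r\<in>R. (\<Sum>k<Suc m. r k \<tau> * g k) = 0)} \<subseteq>
      {\<tau>. r0 m \<tau> = 0} \<union>
      {\<tau>. \<exists>g. (\<exists>k<m. g k \<noteq> 0) \<and> (\<forall>r\<in>E ` R. (\<Sum>k<m. r k \<tau> * g k) = 0)}"
  proof safe
    fix \<tau> g k
    assume gk: "k < Suc m" "g k \<noteq> 0" and g: "\<forall>r\<in>R. (\<Sum>k<Suc m. r k \<tau> * g k) = 0"
      and no: "\<nexists>g. (\<exists>k<m. g k \<noteq> 0) \<and> (\<forall>r\<in>E ` R. (\<Sum>k<m. r k \<tau> * g k) = 0)"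
    have s: "(\<Sum>k<m. r k \<tau> * g k) = - r m \<tau> * g m" if "r \<in> R" for r
      using g that by (simp add: eq_neg_iff_add_eq_0)
    have "\<forall>r\<in>E ` R. (\<Sum>k<m. r k \<tau> * g k) = 0"
      using s r0(1) by (auto simp: E_sum)
    then have z: "\<forall>k<m. g k = 0" using no by blast
    then have "g m \<noteq> 0" using gk by (auto simp: less_Suc_eq)
    moreover have "r0 m \<tau> * g m = 0" using s[OF r0(1)] z by simp
    ultimately show "r0 m \<tau> = 0" by simp
  qed
  moreover have "finite {\<tau>. r0 m \<tau> = 0}"
    using polyfun_finite_zeros Suc.prems(1) r0 by blast
  ultimately show ?case using IH finite_subset by blast
qed

section \<open>Multilinear forms\<close>

definition tform :: "nat \<Rightarrow> (nat \<Rightarrow> 'k::field) \<Rightarrow> (nat \<Rightarrow> nat \<Rightarrow> 'k) \<Rightarrow> 'k" where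
  "tform n f a = (\<Sum>k<2^n. segre_vector n a k * f k)"

definition unit_vec :: "nat \<Rightarrow> nat \<Rightarrow> 'k::field" where
  "unit_vec c = (\<lambda>k. of_bool (k = c))"

lemma unit_vec_simps [simp]: "unit_vec c c = 1" "k \<noteq> c \<Longrightarrow> unit_vec c k = 0"
  "unit_vec 0 (Suc 0) = 0" "unit_vec (Suc 0) 0 = 0"
  by (auto simp: unit_vec_def)

text \<open>The affine cone over the projective tangent space at \<open>a\<close> is spanned by these vectors.\<close>

definition tangent_points :: "nat \<Rightarrow> (nat \<Rightarrow> nat \<Rightarrow> 'k::field) \<Rightarrow> (nat \<Rightarrow> nat \<Rightarrow> 'k) set" where
  "tangent_points n a = insert a {a(i := unit_vec c) |i c. i < n \<and> c < 2}"

definition double_zero :: "nat \<Rightarrow> (nat \<Rightarrow> 'k::field) \<Rightarrow> (nat \<Rightarrow> nat \<Rightarrow> 'k) \<Rightarrow> bool" where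
  "double_zero n f a \<longleftrightarrow> (\<forall>b\<in>tangent_points n a. tform n f b = 0)"

definition determines ::
    "nat \<Rightarrow> 'k::field config \<Rightarrow> nat set \<Rightarrow> nat set \<Rightarrow> bool" where
  "determines n P S T \<longleftrightarrow>
     (\<forall>f. (\<forall>j\<in>S. double_zero n f (P j)) \<and> (\<forall>j\<in>T. tform n f (P j) = 0) \<longrightarrow> (\<forall>k<2^n. f k = 0))"

text \<open>The argument of type \<open>'k itself\<close> fixes the field, which no other argument
  mentions. One good configuration suffices: by \<open>generic_determines\<close> the property is
  then generic.\<close>

definition solvable :: "'k::field itself \<Rightarrow> nat \<Rightarrow> nat \<Rightarrow> nat \<Rightarrow> bool" where
  "solvable _ n s t \<longleftrightarrow>
     (\<exists>P :: nat \<Rightarrow> nat \<Rightarrow> nat \<Rightarrow> 'k. determines n P {..<s} {s..<s + t})"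

lemma bit_add_high: "i < n \<Longrightarrow> bit (2 ^ n + k) i = bit k i" for k :: nat
proof -
  assume "i < n"
  then have "(2 ^ n :: nat) = 2 ^ i * (2 * 2 ^ (n - Suc i))"
    by (simp flip: power_Suc power_add)
  then show ?thesis by (simp add: bit_iff_odd)
qed

lemma segre_vector_low:
  "k < 2 ^ n \<Longrightarrow> segre_vector (Suc n) a k = a n 0 * segre_vector n a k"
  by (simp add: segre_vector_def bit_iff_odd)

lemma segre_vector_high:
  "k < 2 ^ n \<Longrightarrow> segre_vector (Suc n) a (2 ^ n + k) = a n 1 * segre_vector n a k"
  by (simp add: segre_vector_def bit_add_high) (simp add: bit_iff_odd)

lemma sum_lessThan_double: "(\<Sum>k<2 ^ Suc n. g k) = (\<Sum>k<2 ^ n. g k) + (\<Sum>k<2 ^ n. g (2 ^ n + k))"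
  for g :: "nat \<Rightarrow> 'a::comm_monoid_add"
proof -
  have "(\<Sum>k<2 ^ Suc n. g k) = sum g {..<2^n} + sum g {2^n..<2^n + 2^n}"
    by (simp flip: sum.atLeastLessThan_concat[of 0 "2^n" "2^n + 2^n"] add: mult_2 lessThan_atLeast0)
  also have "sum g {2^n..<2^n + 2^n} = (\<Sum>k<2 ^ n. g (2 ^ n + k))"
    using sum.shift_bounds_nat_ivl[of g 0 "2^n" "2^n"] by (simp add: lessThan_atLeast0 add.commute)
  finally show ?thesis .
qed

text \<open>The last factor is the top binary digit of the index, so the two halves of the
  coefficient vector are the forms multiplying its two coordinates.\<close>

lemma tform_Suc:
  "tform (Suc n) f a = a n 0 * tform n f a + a n 1 * tform n (\<lambda>k. f (2 ^ n + k)) a"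
  unfolding tform_def sum_lessThan_double
  by (simp add: segre_vector_low segre_vector_high sum_distrib_left mult.assoc)

lemma segre_vector_cong:
  "(\<And>i c. i < n \<Longrightarrow> c < 2 \<Longrightarrow> a i c = b i c) \<Longrightarrow> segre_vector n a = segre_vector n b"
  unfolding segre_vector_def by (intro ext if_cong refl prod.cong) auto

lemma tform_cong:
  "(\<And>i c. i < n \<Longrightarrow> c < 2 \<Longrightarrow> a i c = b i c) \<Longrightarrow> tform n f a = tform n f b"
  unfolding tform_def using segre_vector_cong by metis

lemma tform_fun_upd_ge [simp]: "n \<le> m \<Longrightarrow> tform n f (a(m := w)) = tform n f a"
  by (rule tform_cong) auto

lemma tform_cmult: "tform n (\<lambda>k. c * f k) a = c * tform n f a"
  by (simp add: tform_def sum_distrib_left mult_ac)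

lemma double_zeroD:
  "double_zero n f a \<Longrightarrow> b \<in> tangent_points n a \<Longrightarrow> tform n f b = 0"
  by (simp add: double_zero_def)

lemma double_zero_unit:
  "double_zero n f a \<Longrightarrow> i < n \<Longrightarrow> c < 2 \<Longrightarrow> tform n f (a(i := unit_vec c)) = 0"
  by (rule double_zeroD) (auto simp: tangent_points_def)

lemma double_zero_tform: "double_zero n f a \<Longrightarrow> tform n f a = 0"
  by (rule double_zeroD) (auto simp: tangent_points_def)

section \<open>Generic configurations\<close>

definition line :: "'k::field config \<Rightarrow> 'k config \<Rightarrow> 'k \<Rightarrow>
    'k config" where
  "line P Q \<tau> = (\<lambda>j i c. P j i c + \<tau> * (Q j i c - P j i c))"

lemma line_0 [simp]: "line P Q 0 = P" and line_1 [simp]: "line P Q 1 = Q"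
  by (simp_all add: line_def)

lemma line_commute: "line P Q \<tau> = line Q P (1 - \<tau>)"
  by (simp add: line_def algebra_simps)

text \<open>A stand-in for dense Zariski-open conditions on configurations, tested on lines only:
  every line through a good configuration has finitely many bad parameters.\<close>

definition generic :: "('k::field config \<Rightarrow> bool) \<Rightarrow> bool" where
  "generic A \<longleftrightarrow> (\<exists>P. A P) \<and> (\<forall>P Q. A P \<longrightarrow> finite {\<tau>. \<not> A (line P Q \<tau>)})"

lemma generic_ex: "generic A \<Longrightarrow> \<exists>P. A P"
  by (simp add: generic_def)

text \<open>The line joining a configuration good for \<open>A\<close> to one good for
  \<open>B\<close> has only finitely many parameters bad for either, and the field is
  infinite.\<close>

lemma generic_conj:
  fixes A B :: "'k::field_char_0 config \<Rightarrow> bool"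
  assumes "generic A" "generic B"
  shows "generic (\<lambda>P. A P \<and> B P)"
proof -
  obtain P Q where P: "A P" and Q: "B Q"
    using assms generic_ex by blast
  \<comment> \<open>Genericity speaks of lines that start at a good configuration, so for
    \<open>B\<close> the line is traversed from \<open>Q\<close>.\<close>
  have "{\<tau>. \<not> B (line P Q \<tau>)} \<subseteq> (\<lambda>\<tau>. 1 - \<tau>) ` {\<tau>. \<not> B (line Q P \<tau>)}"
  proof
    fix \<tau> assume "\<tau> \<in> {\<tau>. \<not> B (line P Q \<tau>)}"
    then have "1 - \<tau> \<in> {\<tau>. \<not> B (line Q P \<tau>)}" by (simp add: line_commute[of P Q \<tau>])
    then show "\<tau> \<in> (\<lambda>\<tau>. 1 - \<tau>) ` {\<tau>. \<not> B (line Q P \<tau>)}"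
      by (intro image_eqI[of _ _ "1 - \<tau>"]) auto
  qed
  then have "finite {\<tau>. \<not> B (line P Q \<tau>)}"
    using assms(2) Q finite_subset unfolding generic_def by blast
  moreover have "finite {\<tau>. \<not> A (line P Q \<tau>)}"
    using assms(1) P unfolding generic_def by blast
  ultimately have "finite ({\<tau>. \<not> A (line P Q \<tau>)} \<union> {\<tau>. \<not> B (line P Q \<tau>)})" by simp
  then obtain \<tau> where "\<tau> \<notin> {\<tau>. \<not> A (line P Q \<tau>)} \<union> {\<tau>. \<not> B (line P Q \<tau>)}"
    using infinite_UNIV_char_0[where 'a='k] by (metis ex_new_if_finite)
  then have "\<exists>P. A P \<and> B P" by blast
  moreover have "finite {\<tau>. \<not> (A (line P Q \<tau>) \<and> B (line P Q \<tau>))}" if "A P" "B P" for P Q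
  proof -
    have "finite ({\<tau>. \<not> A (line P Q \<tau>)} \<union> {\<tau>. \<not> B (line P Q \<tau>)})"
      using assms that unfolding generic_def by blast
    then show ?thesis by (rule rev_finite_subset) auto
  qed
  ultimately show ?thesis unfolding generic_def by blast
qed

lemma polyfun_segre_vector:
  assumes "\<And>i c. i < n \<Longrightarrow> polyfun (\<lambda>\<tau>. a \<tau> i c)"
  shows "polyfun (\<lambda>\<tau>. segre_vector n (a \<tau>) k)"
  unfolding segre_vector_def using assms by (cases "k < 2 ^ n") auto

lemma generic_determines:
  fixes P0 :: "'k::field config"
  assumes "determines n P0 S T"
  shows "generic (\<lambda>P :: nat \<Rightarrow> nat \<Rightarrow> nat \<Rightarrow> 'k. determines n P S T)"
  unfolding generic_def
proof (intro conjI allI impI)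
  show "\<exists>P :: nat \<Rightarrow> nat \<Rightarrow> nat \<Rightarrow> 'k. determines n P S T" using assms by blast
next
  fix P Q :: "'k config" assume P: "determines n P S T"
  define R where "R = (\<lambda>j k \<tau>. segre_vector n (line P Q \<tau> j) k) ` (S \<union> T) \<union>
    (\<lambda>(j, i, c) k \<tau>. segre_vector n ((line P Q \<tau> j)(i := unit_vec c)) k) ` (S \<times> {..<n} \<times> {..<2})"
  have conds: "(\<forall>r\<in>R. (\<Sum>k<2^n. r k \<tau> * f k) = 0) \<longleftrightarrow>
      (\<forall>j\<in>S. double_zero n f (line P Q \<tau> j)) \<and> (\<forall>j\<in>T. tform n f (line P Q \<tau> j) = 0)" for \<tau> f
    unfolding R_def double_zero_def tangent_points_def ball_Un ball_simps
    by (auto simp: tform_def)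
  have "finite {\<tau>. \<exists>g. (\<exists>k<2^n. g k \<noteq> 0) \<and> (\<forall>r\<in>R. (\<Sum>k<2^n. r k \<tau> * g k) = 0)}"
  proof (rule finite_bad_kernels)
    show "polyfun (r k)" if "r \<in> R" for r k
    proof -
      have *: "polyfun (\<lambda>\<tau>. line P Q \<tau> j i c)" for j i c
        by (auto simp: line_def intro!: polyfun_add polyfun_mult)
      then have "polyfun (\<lambda>\<tau>. ((line P Q \<tau> j)(i' := w)) i c)" for j i c i' and w :: "nat \<Rightarrow> 'k"
        by (cases "i = i'") auto
      with * show ?thesis using that unfolding R_def by (auto intro!: polyfun_segre_vector)
    qed
    show "\<forall>k<2^n. g k = 0" if "\<And>r. r \<in> R \<Longrightarrow> (\<Sum>k<2^n. r k 0 * g k) = 0" for g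
      using P conds[of 0 g] that by (auto simp: determines_def)
  qed
  moreover have "{\<tau>. \<not> determines n (line P Q \<tau>) S T} =
      {\<tau>. \<exists>g. (\<exists>k<2^n. g k \<noteq> 0) \<and> (\<forall>r\<in>R. (\<Sum>k<2^n. r k \<tau> * g k) = 0)}"
    unfolding conds determines_def by blast
  ultimately show "finite {\<tau>. \<not> determines n (line P Q \<tau>) S T}" by simp
qed

lemma determines_mono:
  "determines n P S T \<Longrightarrow> S \<subseteq> S' \<Longrightarrow> T \<subseteq> T' \<Longrightarrow> determines n P S' T'"
  unfolding determines_def by blast

text \<open>Relabels the standard points by arbitrary disjoint index sets, possibly larger ones, as
  further zeros do no harm. Thus one configuration can be asked to be good for several assignments
  of roles at once.\<close>

lemma generic_solvable:
  assumes "solvable TYPE('k::field) n s t" "finite S" "finite T" "S \<inter> T = {}" "s \<le> card S" "t \<le> card T"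
  shows "generic (\<lambda>P :: nat \<Rightarrow> nat \<Rightarrow> nat \<Rightarrow> 'k. determines n P S T)"
proof -
  obtain P :: "'k config" where P: "determines n P {..<s} {s..<s + t}"
    using assms(1) unfolding solvable_def by blast
  obtain g where g: "inj_on g {..<s}" "g ` {..<s} \<subseteq> S"
    using card_le_inj[of "{..<s}" S] assms by auto
  obtain h where h: "inj_on h {s..<s+t}" "h ` {s..<s+t} \<subseteq> T"
    using card_le_inj[of "{s..<s+t}" T] assms by auto
  define \<phi> where "\<phi> x = (if x < s then g x else h x)" for x
  have inj: "inj_on \<phi> {..<s+t}"
    unfolding inj_on_def
  proof (intro ballI impI)
    fix x y assume xy: "x \<in> {..<s+t}" "y \<in> {..<s+t}" "\<phi> x = \<phi> y"
    have in_S: "\<phi> z \<in> S" if "z < s" for z using that g by (auto simp: \<phi>_def)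
    have in_T: "\<phi> z \<in> T" if "s \<le> z" "z < s + t" for z using that h by (auto simp: \<phi>_def)
    have "x < s \<longleftrightarrow> y < s"
      using xy in_S in_T assms(4) by (metis IntI empty_iff lessThan_iff not_le)
    then show "x = y"
      using xy g(1) h(1) by (cases "x < s") (auto simp: \<phi>_def inj_on_def)
  qed
  define P' where "P' = (\<lambda>j. P (the_inv_into {..<s+t} \<phi> j))"
  have P': "P' (\<phi> x) = P x" if "x < s + t" for x
    using inj that by (simp add: P'_def the_inv_into_f_f)
  have S: "\<phi> ` {..<s} \<subseteq> S" using g by (auto simp: \<phi>_def)
  have T: "\<phi> ` {s..<s+t} \<subseteq> T" using h by (auto simp: \<phi>_def)
  have "determines n P' (\<phi> ` {..<s}) (\<phi> ` {s..<s+t})"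
    using P P' by (simp add: determines_def)
  then show ?thesis
    using determines_mono[OF _ S T] generic_determines by blast
qed

lemma solvableI:
  fixes P :: "'k::field config"
  assumes "determines n P S T" "finite S" "finite T" "S \<inter> T = {}" "card S \<le> s" "card T \<le> t"
  shows "solvable TYPE('k) n s t"
proof -
  obtain g where g: "inj_on g S" "g ` S \<subseteq> {..<s}"
    using card_le_inj[of S "{..<s}"] assms by auto
  obtain h where h: "inj_on h T" "h ` T \<subseteq> {s..<s+t}"
    using card_le_inj[of T "{s..<s+t}"] assms by auto
  define \<phi> where "\<phi> x = (if x \<in> S then g x else h x)" for x
  have inj: "inj_on \<phi> (S \<union> T)"
    unfolding inj_on_def
  proof (intro ballI impI)
    fix x y assume xy: "x \<in> S \<union> T" "y \<in> S \<union> T" "\<phi> x = \<phi> y"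
    have in_S: "\<phi> z < s" if "z \<in> S" for z using that g by (auto simp: \<phi>_def)
    have in_T: "s \<le> \<phi> z" if "z \<in> T" for z using that h assms(4) by (auto simp: \<phi>_def)
    have "x \<in> S \<longleftrightarrow> y \<in> S"
      using xy in_S in_T by (metis Un_iff not_le)
    then show "x = y"
      using xy g(1) h(1) by (cases "x \<in> S") (auto simp: \<phi>_def inj_on_def)
  qed
  define P' where "P' = (\<lambda>j. P (the_inv_into (S \<union> T) \<phi> j))"
  have P': "P' (\<phi> x) = P x" if "x \<in> S \<union> T" for x
    using inj that by (simp add: P'_def the_inv_into_f_f)
  have S: "\<phi> ` S \<subseteq> {..<s}" using g by (auto simp: \<phi>_def)
  have T: "\<phi> ` T \<subseteq> {s..<s+t}" using h assms(4) by (auto simp: \<phi>_def)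
  have "determines n P' (\<phi> ` S) (\<phi> ` T)"
    using assms(1) P' by (simp add: determines_def)
  then show ?thesis
    using determines_mono[OF _ S T] unfolding solvable_def by blast
qed

lemma solvable_mono:
  assumes "solvable TYPE('k::field) n s t" "s \<le> s'" "t \<le> t'"
  shows "solvable TYPE('k) n s' t'"
proof -
  obtain P :: "'k config" where "determines n P {..<s} {s..<s + t}"
    using assms(1) unfolding solvable_def by blast
  then show ?thesis by (rule solvableI) (use assms in auto)
qed

text \<open>At a point specialised to a coordinate point of the last factor only one half of the
  form is seen. The double zero is a double zero of that half, and the two derivatives in the last
  factor give a simple zero of both halves. So each half counts the double points of the other one
  as simple.\<close>

lemma solvable_split:
  assumes "solvable TYPE('k::field_char_0) n s0 (s1 + t0)" "solvable TYPE('k) n s1 (s0 + t1)"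
  shows "solvable TYPE('k) (Suc n) (s0 + s1) (t0 + t1)"
proof -
  define S0 where "S0 = {..<s0}"
  define S1 where "S1 = {s0..<s0 + s1}"
  define T0 where "T0 = {s0 + s1..<s0 + s1 + t0}"
  define T1 where "T1 = {s0 + s1 + t0..<s0 + s1 + t0 + t1}"
  note defs = S0_def S1_def T0_def T1_def
  have "card (S1 \<union> T0) = s1 + t0" "card (S0 \<union> T1) = s0 + t1"
    by (subst card_Un_disjoint; auto simp: defs)+
  then have "generic (\<lambda>P :: nat \<Rightarrow> nat \<Rightarrow> nat \<Rightarrow> 'k. determines n P S0 (S1 \<union> T0))"
    "generic (\<lambda>P :: nat \<Rightarrow> nat \<Rightarrow> nat \<Rightarrow> 'k. determines n P S1 (S0 \<union> T1))"
    by (intro generic_solvable[OF assms(1)] generic_solvable[OF assms(2)]; auto simp: defs)+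
  from generic_ex[OF generic_conj[OF this]] obtain P :: "'k config" where
    P: "determines n P S0 (S1 \<union> T0)" "determines n P S1 (S0 \<union> T1)" by blast
  define Q where "Q j = (P j)(n := unit_vec (if j \<in> S0 \<union> T0 then 0 else 1))" for j
  have "determines (Suc n) Q (S0 \<union> S1) (T0 \<union> T1)"
    unfolding determines_def
  proof (intro allI impI; elim conjE)
    fix f :: "nat \<Rightarrow> 'k" and k :: nat
    assume S: "\<forall>j\<in>S0 \<union> S1. double_zero (Suc n) f (Q j)"
      and T: "\<forall>j\<in>T0 \<union> T1. tform (Suc n) f (Q j) = 0" and k: "k < 2 ^ Suc n"
    define g where "g = (\<lambda>k. f (2 ^ n + k))"
    have top: "tform n f (P j) = 0" "tform n g (P j) = 0" if "j \<in> S0 \<union> S1" for j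
      using double_zero_unit[of "Suc n" f "Q j" n 0] double_zero_unit[of "Suc n" f "Q j" n 1] S that
      by (auto simp: tform_Suc Q_def g_def)
    have step: "tform (Suc n) f ((Q j)(i := unit_vec c)) =
        (if j \<in> S0 \<union> T0 then tform n f ((P j)(i := unit_vec c)) else tform n g ((P j)(i := unit_vec c)))"
      if "i < n" for i j c
    proof -
      have "(Q j)(i := unit_vec c) =
          ((P j)(i := unit_vec c))(n := unit_vec (if j \<in> S0 \<union> T0 then 0 else 1))"
        unfolding Q_def using that by (intro fun_upd_twist) auto
      then show ?thesis by (simp add: tform_Suc g_def)
    qed
    have "double_zero n (if j \<in> S0 then f else g) (P j)" if "j \<in> S0 \<union> S1" for j
      unfolding double_zero_def
    proof
      fix b assume "b \<in> tangent_points n (P j)"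
      moreover have "j \<in> S0 \<longleftrightarrow> j \<in> S0 \<union> T0" using that by (auto simp: defs)
      moreover have "double_zero (Suc n) f (Q j)" using S that by blast
      ultimately show "tform n (if j \<in> S0 then f else g) b = 0"
        using top[OF that] step[of _ j] double_zero_unit[of "Suc n" f "Q j"]
        unfolding tangent_points_def by (smt (verit, best) insert_iff less_SucI mem_Collect_eq)
    qed
    then have "double_zero n f (P j)" if "j \<in> S0" for j
      using that by fastforce
    moreover have "double_zero n g (P j)" if "j \<in> S1" for j
    proof -
      have "j \<notin> S0" using that by (auto simp: defs)
      then show ?thesis using \<open>\<And>j. j \<in> S0 \<union> S1 \<Longrightarrow> double_zero n (if j \<in> S0 then f else g) (P j)\<close>[of j] that
        by simp
    qed
    moreover have "tform n f (P j) = 0" if "j \<in> T0" for j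
      using bspec[OF T, of j] that by (simp add: tform_Suc Q_def)
    moreover have "tform n g (P j) = 0" if "j \<in> T1" for j
    proof -
      have "j \<notin> S0 \<union> T0" using that by (auto simp: defs)
      then show ?thesis using bspec[OF T, of j] that by (simp add: tform_Suc Q_def g_def)
    qed
    ultimately have f: "\<forall>k<2^n. f k = 0" and g: "\<forall>k<2^n. g k = 0"
      using P top unfolding determines_def by blast+
    show "f k = 0"
    proof (cases "k < 2 ^ n")
      case False
      then show ?thesis using k g[rule_format, of "k - 2 ^ n"] by (simp add: g_def)
    qed (use f in blast)
  qed
  then show ?thesis
    by (rule solvableI) (auto simp: defs intro!: order_trans[OF card_Un_le])
qed

section \<open>Degeneration of the last two factors to the torus-fixed points\<close>

definition block :: "nat \<Rightarrow> (nat \<Rightarrow> 'k) \<Rightarrow> nat \<Rightarrow> nat \<Rightarrow> 'k" where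
  "block b f u = (\<lambda>k. f (u * 2 ^ b + k))"

text \<open>Blocks 0, 1, 2, 3 belong to the coordinate choices 00, 10, 01, 11 in the factors
  \<open>b\<close> and \<open>Suc b\<close>; the names of the index sets below follow these
  digits.\<close>

lemma tform_Suc_Suc:
  "tform (Suc (Suc b)) f a =
     a b 0 * a (Suc b) 0 * tform b (block b f 0) a + a b 1 * a (Suc b) 0 * tform b (block b f 1) a +
     a b 0 * a (Suc b) 1 * tform b (block b f 2) a + a b 1 * a (Suc b) 1 * tform b (block b f 3) a"
  by (simp add: tform_Suc block_def algebra_simps)

definition weights ::
    "('k \<Rightarrow> 'k) \<Rightarrow> ('k \<Rightarrow> 'k) \<Rightarrow> ('k \<Rightarrow> 'k) \<Rightarrow> ('k \<Rightarrow> 'k) \<Rightarrow> nat \<Rightarrow> 'k \<Rightarrow> 'k" where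
  "weights p q r s u = (if u = 0 then p else if u = 1 then q else if u = 2 then r else s)"

text \<open>A row of the parametrised linear system: a combination, with weights
  \<open>w u \<tau>\<close>, of the values of the four blocks at \<open>a\<close>, written out in
  the coefficients so that \<open>finite_bad_kernels\<close> applies.\<close>

definition block_row :: "nat \<Rightarrow> (nat \<Rightarrow> 'k \<Rightarrow> 'k::field) \<Rightarrow> (nat \<Rightarrow> nat \<Rightarrow> 'k) \<Rightarrow> nat \<Rightarrow> 'k \<Rightarrow> 'k" where
  "block_row b w a k \<tau> = w (k div 2 ^ b) \<tau> * segre_vector b a (k mod 2 ^ b)"

definition block_sum ::
    "nat \<Rightarrow> (nat \<Rightarrow> 'k \<Rightarrow> 'k::field) \<Rightarrow> (nat \<Rightarrow> nat \<Rightarrow> 'k) \<Rightarrow> 'k \<Rightarrow> (nat \<Rightarrow> 'k) \<Rightarrow> 'k" where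
  "block_sum b w a \<tau> g = (\<Sum>k<2 ^ Suc (Suc b). block_row b w a k \<tau> * g k)"

lemma block_sum_weights:
  "block_sum b (weights p q r s) a \<tau> g =
     p \<tau> * tform b (block b g 0) a + q \<tau> * tform b (block b g 1) a +
     r \<tau> * tform b (block b g 2) a + s \<tau> * tform b (block b g 3) a"
proof -
  have 1: "(2 * 2 ^ b + (2 ^ b + k)) div 2 ^ b = 3" if "k < 2 ^ b" for k :: nat
  proof -
    have "2 * 2 ^ b + (2 ^ b + k) = k + 3 * 2 ^ b" by simp
    then show ?thesis using that by (simp only: div_mult_self1) simp
  qed
  have 2: "(2 * 2 ^ b + (2 ^ b + k)) mod 2 ^ b = k" if "k < 2 ^ b" for k :: nat
  proof -
    have "2 * 2 ^ b + (2 ^ b + k) = k + 3 * 2 ^ b" by simp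
    then show ?thesis using that by (simp only: mod_mult_self1) simp
  qed
  have 3: "(2 * 2 ^ b + k) div 2 ^ b = 2" "(2 * 2 ^ b + k) mod 2 ^ b = k" if "k < 2 ^ b" for k :: nat
    using that by simp_all
  show ?thesis
    unfolding block_sum_def sum_lessThan_double
    by (simp add: block_row_def weights_def tform_def block_def sum_distrib_left mult.assoc 1 2 3)
qed

lemma polyfun_block_row:
  assumes "polyfun p" "polyfun q" "polyfun r" "polyfun s"
  shows "polyfun (block_row b (weights p q r s) a k)"
  using assms unfolding block_row_def weights_def by (auto intro!: polyfun_mult)

text \<open>
  The equations of the points \<open>Q\<close> at the parameter \<open>\<kappa>\<close> are rescaled, and the last block of \<open>f\<close> is multiplied by
  \<open>\<kappa>\<^sup>3\<close>, so that they make sense at \<open>\<tau> = 0\<close>, too; there they decouple into the four blocks.  A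
  double point near a torus-fixed point contributes a double zero to one block and simple zeros to
  the two adjacent blocks.  A point in one of the sets \<open>L0\<close>, \<open>R0\<close>, \<open>L1\<close>, \<open>R1\<close> approaches the
  torus-fixed point along one of the axes, which moves one of the simple zeros to the opposite block.
  Full rank at \<open>\<tau> = 0\<close> persists for almost all \<open>\<tau>\<close>.
\<close>

lemma solvable_twisted_sets:
  fixes P :: "'k::field_char_0 config"
  assumes fin: "finite S00" "finite S10" "finite S01" "finite S11"
      "finite T00" "finite T10" "finite T01" "finite T11"
    and disj: "S00 \<inter> S10 = {}" "S00 \<inter> S01 = {}" "S00 \<inter> S11 = {}" "S10 \<inter> S01 = {}" "S10 \<inter> S11 = {}"
      "S01 \<inter> S11 = {}" "T00 \<inter> T10 = {}" "T00 \<inter> T01 = {}" "T00 \<inter> T11 = {}" "T10 \<inter> T01 = {}"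
      "T10 \<inter> T11 = {}" "T01 \<inter> T11 = {}" "(S00 \<union> S10 \<union> S01 \<union> S11) \<inter> (T00 \<union> T10 \<union> T01 \<union> T11) = {}"
    and flags: "L0 \<subseteq> S00" "R0 \<subseteq> S00" "L0 \<inter> R0 = {}" "L1 \<subseteq> S11" "R1 \<subseteq> S11" "L1 \<inter> R1 = {}"
    and P: "determines b P S00 (S10 \<union> S01 \<union> L1 \<union> R1 \<union> T00)"
      "determines b P S11 (S10 \<union> S01 \<union> L0 \<union> R0 \<union> T11)"
      "determines b P S10 ((S00 - R0) \<union> (S11 - L1) \<union> T10)"
      "determines b P S01 ((S00 - L0) \<union> (S11 - R1) \<union> T01)"
  shows "\<exists>Q :: nat \<Rightarrow> nat \<Rightarrow> nat \<Rightarrow> 'k. determines (Suc (Suc b)) Q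
           (S00 \<union> S10 \<union> S01 \<union> S11) (T00 \<union> T10 \<union> T01 \<union> T11)"
proof -
  let ?S = "S00 \<union> S10 \<union> S01 \<union> S11" and ?T = "T00 \<union> T10 \<union> T01 \<union> T11"
  define N I X X2 :: "'k \<Rightarrow> 'k" where "N = (\<lambda>\<tau>. 0)" and "I = (\<lambda>\<tau>. 1)" and "X = (\<lambda>\<tau>. \<tau>)" and "X2 = (\<lambda>\<tau>. \<tau>^2)"
  \<comment> \<open>\<open>dw\<close> carries the tangent directions of the first \<open>b\<close>
    factors, \<open>yw\<close> and \<open>zw\<close> two derivatives in the last two factors,
    selected according to the class of the point, and \<open>tw\<close> the simple zeros. Where
    \<open>X\<close> or \<open>X2\<close> stands beside \<open>I\<close>, only the block with
    \<open>I\<close> survives at the parameter 0.\<close>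
  define dw where "dw j = (if j \<in> S00 then weights I (if j \<in> L0 then X2 else N) (if j \<in> R0 then X2 else N) N
    else if j \<in> S10 then weights N I N N else if j \<in> S01 then weights N N I N
    else weights N (if j \<in> R1 then X2 else N) (if j \<in> L1 then X2 else N) I)" for j
  define yw where "yw j = (if j \<in> S00 then if j \<in> R0 then weights N X N I else weights N I N N
    else if j \<in> S10 \<union> S01 then weights I N N N
    else if j \<in> L1 then weights I X N N else weights N I N N)" for j
  define zw where "zw j = (if j \<in> S00 then if j \<in> L0 then weights N N X I else weights N N I N
    else if j \<in> S10 \<union> S01 then weights N N N I
    else if j \<in> R1 then weights I N X N else weights N N I N)" for j
  define tw where "tw j = (if j \<in> T00 then weights I N N N else if j \<in> T10 then weights N I N N
    else if j \<in> T01 then weights N N I N else weights N N N I)" for j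
  define C where "C = {(dw j, a) |j a. j \<in> ?S \<and> a \<in> tangent_points b (P j)} \<union> {(yw j, P j) |j. j \<in> ?S} \<union>
    {(zw j, P j) |j. j \<in> ?S} \<union> {(tw j, P j) |j. j \<in> ?T}"
  define R where "R = (\<lambda>(w, a). block_row b w a) ` C"
  note wdefs = N_def I_def X_def X2_def
  have poly: "polyfun (r k)" if r: "r \<in> R" for r k
  proof -
    have base: "polyfun N" "polyfun I" "polyfun X" "polyfun X2"
      unfolding wdefs by (intro polyfun_const polyfun_id polyfun_power)+
    have pif: "polyfun (if c then p else q)" if "polyfun p" "polyfun q" for c and p q :: "'k \<Rightarrow> 'k"
      using that by simp
    define ok where "ok w \<longleftrightarrow> (\<forall>a k. polyfun (block_row b w a k))" for w :: "nat \<Rightarrow> 'k \<Rightarrow> 'k"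
    have oif: "ok (if c then w else w')" if "ok w" "ok w'" for c w w'
      using that by simp
    have ow: "ok (weights p q r s)" if "polyfun p" "polyfun q" "polyfun r" "polyfun s" for p q r s
      using that polyfun_block_row unfolding ok_def by blast
    have oks: "ok (dw j)" "ok (yw j)" "ok (zw j)" "ok (tw j)" for j
      unfolding dw_def yw_def zw_def tw_def by (intro oif ow pif base)+
    obtain w a where wa: "r = block_row b w a" "(w, a) \<in> C"
      using r unfolding R_def by auto
    from wa(2) have "\<exists>j. w \<in> {dw j, yw j, zw j, tw j}"
      unfolding C_def by fast
    then have "ok w" using oks by fast
    then show ?thesis unfolding ok_def wa(1) by simp
  qed
  have at_0: "\<forall>k<2 ^ Suc (Suc b). g k = 0"
    if g: "\<And>r. r \<in> R \<Longrightarrow> (\<Sum>k<2 ^ Suc (Suc b). r k 0 * g k) = 0" for g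
  proof -
    have gC: "block_sum b w a 0 g = 0" if "(w, a) \<in> C" for w a
      unfolding block_sum_def
    proof (rule g)
      show "block_row b w a \<in> R"
        unfolding R_def by (rule image_eqI[OF _ that]) simp
    qed
    have gd: "block_sum b (dw j) a 0 g = 0"
      if "j \<in> ?S" "a \<in> tangent_points b (P j)" for j a
      by (rule gC) (use that in \<open>auto simp: C_def\<close>)
    have gy: "block_sum b (yw j) (P j) 0 g = 0"
      and gz: "block_sum b (zw j) (P j) 0 g = 0" if "j \<in> ?S" for j
      by (rule gC; use that in \<open>auto simp: C_def\<close>)+
    have gt: "block_sum b (tw j) (P j) 0 g = 0" if "j \<in> ?T" for j
      by (rule gC) (use that in \<open>auto simp: C_def\<close>)
    have S00: "double_zero b (block b g 0) (P j)" "j \<notin> R0 \<Longrightarrow> tform b (block b g 1) (P j) = 0"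
      "j \<notin> L0 \<Longrightarrow> tform b (block b g 2) (P j) = 0"
      "j \<in> L0 \<union> R0 \<Longrightarrow> tform b (block b g 3) (P j) = 0" if "j \<in> S00" for j
      using gd[of j] gy[of j] gz[of j] that
      by (auto simp: dw_def yw_def zw_def block_sum_weights wdefs double_zero_def split: if_splits)
    have S11: "double_zero b (block b g 3) (P j)" "j \<notin> L1 \<Longrightarrow> tform b (block b g 1) (P j) = 0"
      "j \<notin> R1 \<Longrightarrow> tform b (block b g 2) (P j) = 0"
      "j \<in> L1 \<union> R1 \<Longrightarrow> tform b (block b g 0) (P j) = 0" if "j \<in> S11" for j
    proof -
      have "j \<notin> S00" "j \<notin> S10" "j \<notin> S01" using that disj by auto
      then show "double_zero b (block b g 3) (P j)" "j \<notin> L1 \<Longrightarrow> tform b (block b g 1) (P j) = 0"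
        "j \<notin> R1 \<Longrightarrow> tform b (block b g 2) (P j) = 0"
        "j \<in> L1 \<union> R1 \<Longrightarrow> tform b (block b g 0) (P j) = 0"
        using gd[of j] gy[of j] gz[of j] that
        by (auto simp: dw_def yw_def zw_def block_sum_weights wdefs double_zero_def split: if_splits)
    qed
    have S10: "double_zero b (block b g 1) (P j)" "tform b (block b g 0) (P j) = 0"
      "tform b (block b g 3) (P j) = 0" if "j \<in> S10" for j
    proof -
      have "j \<notin> S00" using that disj by auto
      then show "double_zero b (block b g 1) (P j)" "tform b (block b g 0) (P j) = 0"
        "tform b (block b g 3) (P j) = 0"
        using gd[of j] gy[of j] gz[of j] that
        by (auto simp: dw_def yw_def zw_def block_sum_weights wdefs double_zero_def)
    qed
    have S01: "double_zero b (block b g 2) (P j)" "tform b (block b g 0) (P j) = 0"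
      "tform b (block b g 3) (P j) = 0" if "j \<in> S01" for j
    proof -
      have "j \<notin> S00" "j \<notin> S10" using that disj by auto
      then show "double_zero b (block b g 2) (P j)" "tform b (block b g 0) (P j) = 0"
        "tform b (block b g 3) (P j) = 0"
        using gd[of j] gy[of j] gz[of j] that
        by (auto simp: dw_def yw_def zw_def block_sum_weights wdefs double_zero_def)
    qed
    have T: "j \<in> T00 \<Longrightarrow> tform b (block b g 0) (P j) = 0" "j \<in> T10 \<Longrightarrow> tform b (block b g 1) (P j) = 0"
      "j \<in> T01 \<Longrightarrow> tform b (block b g 2) (P j) = 0" "j \<in> T11 \<Longrightarrow> tform b (block b g 3) (P j) = 0" for j
      using gt[of j] disj by (auto simp: tw_def block_sum_weights wdefs split: if_splits)
    have "tform b (block b g 0) (P j) = 0" if "j \<in> S10 \<union> S01 \<union> L1 \<union> R1 \<union> T00" for j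
      using that flags(1,2,4,5) S10(2)[of j] S01(2)[of j] S11(4)[of j] T(1)[of j] by fast
    then have b0: "\<forall>k<2^b. block b g 0 k = 0"
      using P(1) S00(1) unfolding determines_def by blast
    have "tform b (block b g 3) (P j) = 0" if "j \<in> S10 \<union> S01 \<union> L0 \<union> R0 \<union> T11" for j
      using that flags(1,2,4,5) S10(3)[of j] S01(3)[of j] S00(4)[of j] T(4)[of j] by fast
    then have b3: "\<forall>k<2^b. block b g 3 k = 0"
      using P(2) S11(1) unfolding determines_def by blast
    have "tform b (block b g 1) (P j) = 0" if "j \<in> (S00 - R0) \<union> (S11 - L1) \<union> T10" for j
      using that flags(1,2,4,5) S00(2)[of j] S11(2)[of j] T(2)[of j] by fast
    then have b1: "\<forall>k<2^b. block b g 1 k = 0"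
      using P(3) S10(1) unfolding determines_def by blast
    have "tform b (block b g 2) (P j) = 0" if "j \<in> (S00 - L0) \<union> (S11 - R1) \<union> T01" for j
      using that flags(1,2,4,5) S00(3)[of j] S11(3)[of j] T(3)[of j] by fast
    then have b2: "\<forall>k<2^b. block b g 2 k = 0"
      using P(4) S01(1) unfolding determines_def by blast
    have all: "block b g u k = 0" if "u < 4" "k < 2 ^ b" for u k
      using that b0 b1 b2 b3 by (auto simp: eval_nat_numeral less_Suc_eq)
    show ?thesis
    proof (intro allI impI)
      fix k :: nat assume "k < 2 ^ Suc (Suc b)"
      then have "k div 2 ^ b < 4" by (simp add: less_mult_imp_div_less)
      then show "g k = 0"
        using all[of "k div 2^b" "k mod 2^b"] unfolding block_def div_mult_mod_eq by simp
    qed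
  qed
  define bad where
    "bad = {\<tau>. \<exists>g. (\<exists>k<2 ^ Suc (Suc b). g k \<noteq> 0) \<and> (\<forall>r\<in>R. (\<Sum>k<2 ^ Suc (Suc b). r k \<tau> * g k) = 0)}"
  have "finite bad"
    unfolding bad_def using poly at_0 by (rule finite_bad_kernels)
  then obtain \<kappa> where \<kappa>: "\<kappa> \<noteq> 0" and nb: "\<kappa> \<notin> bad"
    using ex_new_if_finite[OF infinite_UNIV_char_0, of "insert 0 bad"] by auto
  have good: "g k = 0"
    if "\<And>r. r \<in> R \<Longrightarrow> (\<Sum>k<2 ^ Suc (Suc b). r k \<kappa> * g k) = 0" "k < 2 ^ Suc (Suc b)" for g k
  proof (rule ccontr)
    assume "g k \<noteq> 0"
    then have "\<exists>k<2 ^ Suc (Suc b). g k \<noteq> 0" using that(2) by blast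
    moreover have "\<forall>r\<in>R. (\<Sum>k<2 ^ Suc (Suc b). r k \<kappa> * g k) = 0" using that(1) by (rule ballI)
    ultimately have "\<kappa> \<in> bad" unfolding bad_def by blast
    with nb show False ..
  qed
  \<comment> \<open>Flagged points lie off the fixed points by \<open>\<kappa>^2\<close> at 00 and
    by \<open>\<kappa>\<close> at 11. What matters is that the exponents 2 and 1 lie strictly
    between 0 and the exponent 3 of the scaling: for instance
    \<open>F 1 + \<kappa>^2 * F 3 = 0\<close> becomes, in scaled blocks \<open>G u\<close>, the
    equation \<open>\<kappa> * G 1 + G 3 = 0\<close>, whose limit is a zero of block 3 instead of
    block 1.\<close>
  define Y where "Y j = (\<lambda>c::nat. if j \<in> S00 then if c = 0 then 1 else of_bool (j \<in> L0) * \<kappa>^2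
    else if j \<in> S10 \<union> T10 \<union> T11 then of_bool (c = 1) else if j \<in> S01 \<union> T00 \<union> T01 then of_bool (c = 0)
    else if j \<in> L1 then if c = 0 then 1 else \<kappa> else of_bool (c = 1))" for j
  define Z where "Z j = (\<lambda>c::nat. if j \<in> S00 then if c = 0 then 1 else of_bool (j \<in> R0) * \<kappa>^2
    else if j \<in> S01 \<union> T01 \<union> T11 then of_bool (c = 1) else if j \<in> S10 \<union> T00 \<union> T10 then of_bool (c = 0)
    else if j \<in> R1 then if c = 0 then 1 else \<kappa> else of_bool (c = 1))" for j
  define Q where "Q j = (P j)(b := Y j, Suc b := Z j)" for j
  have "determines (Suc (Suc b)) Q ?S ?T"
    unfolding determines_def
  proof (intro allI impI; elim conjE)
    fix f :: "nat \<Rightarrow> 'k" and k :: nat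
    assume S: "\<forall>j\<in>?S. double_zero (Suc (Suc b)) f (Q j)"
      and T: "\<forall>j\<in>?T. tform (Suc (Suc b)) f (Q j) = 0" and k: "k < 2 ^ Suc (Suc b)"
    define g where "g k = (if k < 3 * 2 ^ b then f k else \<kappa> ^ 3 * f k)" for k
    have bg: "tform b (block b g u) a = tform b (block b f u) a" if "u < 3" for u a
      unfolding tform_def
    proof (intro sum.cong refl)
      fix k assume "k \<in> {..<(2::nat)^b}"
      then have "u * 2 ^ b + k < Suc u * 2 ^ b" by simp
      also have "\<dots> \<le> 3 * 2 ^ b" using that by (intro mult_right_mono) auto
      finally show "segre_vector b a k * block b g u k = segre_vector b a k * block b f u k"
        by (simp add: block_def g_def)
    qed
    have bg3: "tform b (block b g 3) a = \<kappa> ^ 3 * tform b (block b f 3) a" for a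
      unfolding tform_cmult[symmetric] by (simp add: block_def g_def)
    have bgs: "tform b (block b g 0) a = tform b (block b f 0) a"
      "tform b (block b g (Suc 0)) a = tform b (block b f (Suc 0)) a"
      "tform b (block b g 2) a = tform b (block b f 2) a" for a
      by (simp_all add: bg)
    define F where "F u a = tform b (block b f u) a" for u a
    have dz: "Y j 0 * Z j 0 * F 0 a + Y j 1 * Z j 0 * F 1 a + Y j 0 * Z j 1 * F 2 a + Y j 1 * Z j 1 * F 3 a = 0"
      if "j \<in> ?S" and a: "a \<in> tangent_points b (P j)" for j a
    proof -
      have "tform (Suc (Suc b)) f (a(b := Y j, Suc b := Z j)) = 0"
      proof (cases "a = P j")
        case True
        then show ?thesis using S that double_zero_tform unfolding Q_def by blast
      next
        case False
        then obtain i c where ic: "i < b" "c < 2" "a = (P j)(i := unit_vec c)"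
          using a by (auto simp: tangent_points_def)
        have "a(b := Y j, Suc b := Z j) = (Q j)(i := unit_vec c)"
          using ic(1) unfolding ic(3) Q_def by (auto simp: fun_eq_iff)
        then show ?thesis
          using S that(1) ic double_zero_unit[of "Suc (Suc b)" f "Q j" i c] by auto
      qed
      then show ?thesis by (simp add: tform_Suc_Suc F_def)
    qed
    have dy: "Z j 0 * F 0 (P j) + Z j 1 * F 2 (P j) = 0" "Z j 0 * F 1 (P j) + Z j 1 * F 3 (P j) = 0"
      if "j \<in> ?S" for j
    proof -
      have "double_zero (Suc (Suc b)) f (Q j)" using S that by blast
      from double_zero_unit[OF this, of b 0] double_zero_unit[OF this, of b 1]
      show "Z j 0 * F 0 (P j) + Z j 1 * F 2 (P j) = 0" "Z j 0 * F 1 (P j) + Z j 1 * F 3 (P j) = 0"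
        by (simp_all add: tform_Suc_Suc F_def Q_def fun_upd_twist[of "Suc b" b])
    qed
    have dz': "Y j 0 * F 0 (P j) + Y j 1 * F 1 (P j) = 0" "Y j 0 * F 2 (P j) + Y j 1 * F 3 (P j) = 0"
      if "j \<in> ?S" for j
    proof -
      have "double_zero (Suc (Suc b)) f (Q j)" using S that by blast
      from double_zero_unit[OF this, of "Suc b" 0] double_zero_unit[OF this, of "Suc b" 1]
      show "Y j 0 * F 0 (P j) + Y j 1 * F 1 (P j) = 0" "Y j 0 * F 2 (P j) + Y j 1 * F 3 (P j) = 0"
        by (simp_all add: tform_Suc_Suc F_def Q_def)
    qed
    have "(\<Sum>k<2 ^ Suc (Suc b). r k \<kappa> * g k) = 0" if "r \<in> R" for r
    proof -
      have e10: "j \<notin> S00" "j \<notin> S01" if "j \<in> S10" for j using that disj(1,4) by blast+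
      have e01: "j \<notin> S00" "j \<notin> S10" if "j \<in> S01" for j using that disj(2,4) by blast+
      have e11: "j \<notin> S00" "j \<notin> S10" "j \<notin> S01" if "j \<in> S11" for j
        using that disj(3,5,6) by blast+
      have ST: "j \<notin> ?T" if "j \<in> ?S" for j using that disj(13) by blast
      have eT: "j \<notin> T00" "j \<notin> T10" "j \<notin> T01" "j \<notin> T11" if "j \<in> ?S" for j
        using ST[OF that] by blast+
      have LR: "\<not> (j \<in> L0 \<and> j \<in> R0)" "\<not> (j \<in> L1 \<and> j \<in> R1)" for j
        using flags(3,6) by blast+
      note unf = block_sum_weights wdefs bgs bg3 Y_def Z_def F_def
      have d: "block_sum b (dw j) a \<kappa> g = 0"
        if jS: "j \<in> ?S" and a: "a \<in> tangent_points b (P j)" for j a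
      proof -
        \<comment> \<open>For the class 11 the equation is multiplied by the power of
          \<open>\<kappa>\<close> that makes the scaled last block appear with coefficient
          1.\<close>
        have "block_sum b (dw j) a \<kappa> g =
            (if j \<in> S11 then if j \<in> L1 \<union> R1 then \<kappa>^2 else \<kappa>^3 else 1) *
            (Y j 0 * Z j 0 * F 0 a + Y j 1 * Z j 0 * F 1 a + Y j 0 * Z j 1 * F 2 a + Y j 1 * Z j 1 * F 3 a)"
          using jS
        proof (elim UnE)
          assume j: "j \<in> S00"
          then have "j \<notin> S11" using disj(3) by blast
          then show ?thesis using j LR(1)[of j] by (auto simp: dw_def unf)
        next
          assume j: "j \<in> S10"
          then have "j \<notin> S11" using disj(5) by blast
          then show ?thesis using j e10[OF j] eT[OF jS] by (simp add: dw_def unf)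
        next
          assume j: "j \<in> S01"
          then have "j \<notin> S11" using disj(6) by blast
          then show ?thesis using j e01[OF j] eT[OF jS] by (simp add: dw_def unf)
        next
          assume j: "j \<in> S11"
          show ?thesis
            using j e11[OF j] eT[OF jS] LR(2)[of j]
            by (cases "j \<in> L1"; cases "j \<in> R1")
               (simp_all add: dw_def unf algebra_simps power2_eq_square power3_eq_cube)
        qed
        then show ?thesis using dz[OF jS a] by simp
      qed
      have y: "block_sum b (yw j) (P j) \<kappa> g = 0" if jS: "j \<in> ?S" for j
        using jS
      proof (elim UnE)
        assume j: "j \<in> S00"
        have "block_sum b (yw j) (P j) \<kappa> g = (if j \<in> R0 then \<kappa> else 1) * (Z j 0 * F 1 (P j) + Z j 1 * F 3 (P j))"
          using j by (simp add: yw_def unf algebra_simps power2_eq_square power3_eq_cube)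
        then show ?thesis using dy(2)[OF jS] by simp
      next
        assume j: "j \<in> S10"
        show ?thesis using j e10[OF j] eT[OF jS] dy(1)[OF jS]
          by (simp add: yw_def unf)
      next
        assume j: "j \<in> S01"
        show ?thesis using j e01[OF j] eT[OF jS] dz'(1)[OF jS]
          by (simp add: yw_def unf)
      next
        assume j: "j \<in> S11"
        show ?thesis using j e11[OF j] eT[OF jS] dz'(1)[OF jS]
          by (cases "j \<in> L1") (simp_all add: yw_def unf)
      qed
      have z: "block_sum b (zw j) (P j) \<kappa> g = 0" if jS: "j \<in> ?S" for j
        using jS
      proof (elim UnE)
        assume j: "j \<in> S00"
        have "block_sum b (zw j) (P j) \<kappa> g = (if j \<in> L0 then \<kappa> else 1) * (Y j 0 * F 2 (P j) + Y j 1 * F 3 (P j))"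
          using j by (simp add: zw_def unf algebra_simps power2_eq_square power3_eq_cube)
        then show ?thesis using dz'(2)[OF jS] by simp
      next
        assume j: "j \<in> S10"
        show ?thesis using j e10[OF j] eT[OF jS] dz'(2)[OF jS]
          by (simp add: zw_def unf)
      next
        assume j: "j \<in> S01"
        show ?thesis using j e01[OF j] eT[OF jS] dy(2)[OF jS]
          by (simp add: zw_def unf)
      next
        assume j: "j \<in> S11"
        show ?thesis using j e11[OF j] eT[OF jS] dy(1)[OF jS]
          by (cases "j \<in> R1") (simp_all add: zw_def unf)
      qed
      have t: "block_sum b (tw j) (P j) \<kappa> g = 0" if "j \<in> ?T" for j
      proof -
        have "tform (Suc (Suc b)) f (Q j) = 0" using T that by blast
        then have *: "Y j 0 * Z j 0 * F 0 (P j) + Y j 1 * Z j 0 * F 1 (P j) + Y j 0 * Z j 1 * F 2 (P j) +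
            Y j 1 * Z j 1 * F 3 (P j) = 0"
          by (simp add: tform_Suc_Suc F_def Q_def)
        have ns: "j \<notin> S00" "j \<notin> S10" "j \<notin> S01" "j \<notin> S11" "j \<notin> L1" "j \<notin> R1"
          using that disj(13) flags(4,5) by blast+
        show ?thesis
          using that
        proof (elim UnE)
          assume "j \<in> T00"
          moreover have "j \<notin> T10" "j \<notin> T01" "j \<notin> T11" using calculation disj(7,8,9) by blast+
          ultimately show ?thesis using * ns by (simp add: tw_def unf)
        next
          assume "j \<in> T10"
          moreover have "j \<notin> T00" "j \<notin> T01" "j \<notin> T11" using calculation disj(7,10,11) by blast+
          ultimately show ?thesis using * ns by (simp add: tw_def unf)
        next
          assume "j \<in> T01"
          moreover have "j \<notin> T00" "j \<notin> T10" "j \<notin> T11" using calculation disj(8,10,12) by blast+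
          ultimately show ?thesis using * ns by (simp add: tw_def unf)
        next
          assume "j \<in> T11"
          moreover have "j \<notin> T00" "j \<notin> T10" "j \<notin> T01" using calculation disj(9,11,12) by blast+
          ultimately show ?thesis using * ns by (simp add: tw_def unf)
        qed
      qed
      show ?thesis using that d y z t unfolding R_def C_def block_sum_def by auto
    qed
    then have "g k = 0" using k by (rule good)
    then show "f k = 0" using \<kappa> by (auto simp: g_def split: if_splits)
  qed
  then show ?thesis by blast
qed

lemma card_Un_disjoint3:
  assumes "finite A" "finite B" "finite C" "A \<inter> B = {}" "A \<inter> C = {}" "B \<inter> C = {}"
  shows "card (A \<union> B \<union> C) = card A + card B + card C"
  using assms by (simp add: card_Un_disjoint Int_Un_distrib2)

text \<open>The numerical form, with consecutive intervals as index sets. A point gives a double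
  zero to its own block and a simple zero to each adjacent block; a flag takes one simple zero from
  block 10 or 01 and hands it to the block opposite to its class. Hence zeros travel only from the
  mixed blocks to 00 and 11.\<close>

lemma solvable_twisted:
  assumes "solvable TYPE('k::field_char_0) b s00 (s10 + s01 + l1 + r1 + t00)"
    "solvable TYPE('k) b s11 (s10 + s01 + l0 + r0 + t11)"
    "solvable TYPE('k) b s10 ((s00 - r0) + (s11 - l1) + t10)"
    "solvable TYPE('k) b s01 ((s00 - l0) + (s11 - r1) + t01)"
    and flags: "l0 + r0 \<le> s00" "l1 + r1 \<le> s11"
  shows "solvable TYPE('k) (Suc (Suc b)) (s00 + s10 + s01 + s11) (t00 + t10 + t01 + t11)"
proof -
  define S00 where "S00 = {0..<s00}"
  define S10 where "S10 = {s00..<s00 + s10}"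
  define S01 where "S01 = {s00 + s10..<s00 + s10 + s01}"
  define S11 where "S11 = {s00 + s10 + s01..<s00 + s10 + s01 + s11}"
  define s where "s = s00 + s10 + s01 + s11"
  define T00 where "T00 = {s..<s + t00}"
  define T10 where "T10 = {s + t00..<s + t00 + t10}"
  define T01 where "T01 = {s + t00 + t10..<s + t00 + t10 + t01}"
  define T11 where "T11 = {s + t00 + t10 + t01..<s + t00 + t10 + t01 + t11}"
  define L0 where "L0 = {0..<l0}"
  define R0 where "R0 = {l0..<l0 + r0}"
  define L1 where "L1 = {s00 + s10 + s01..<s00 + s10 + s01 + l1}"
  define R1 where "R1 = {s00 + s10 + s01 + l1..<s00 + s10 + s01 + l1 + r1}"
  note defs = S00_def S10_def S01_def S11_def T00_def T10_def T01_def T11_def L0_def R0_def L1_def R1_def s_def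
  have cards: "card S00 = s00" "card S10 = s10" "card S01 = s01" "card S11 = s11"
    "card T00 = t00" "card T10 = t10" "card T01 = t01" "card T11 = t11"
    "card L0 = l0" "card R0 = r0" "card L1 = l1" "card R1 = r1"
    by (simp_all add: defs)
  have fin: "finite S00" "finite S10" "finite S01" "finite S11" "finite T00" "finite T10" "finite T01"
    "finite T11" "finite L0" "finite R0" "finite L1" "finite R1"
    by (simp_all add: defs)
  have flag_sets: "L0 \<subseteq> S00" "R0 \<subseteq> S00" "L0 \<inter> R0 = {}" "L1 \<subseteq> S11" "R1 \<subseteq> S11" "L1 \<inter> R1 = {}"
    using flags by (auto simp: defs)
  have disj: "S00 \<inter> S10 = {}" "S00 \<inter> S01 = {}" "S00 \<inter> S11 = {}" "S10 \<inter> S01 = {}" "S10 \<inter> S11 = {}"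
      "S01 \<inter> S11 = {}" "T00 \<inter> T10 = {}" "T00 \<inter> T01 = {}" "T00 \<inter> T11 = {}" "T10 \<inter> T01 = {}"
      "T10 \<inter> T11 = {}" "T01 \<inter> T11 = {}"
    by (auto simp: defs)
  have Sall: "S00 \<union> S10 \<union> S01 \<union> S11 = {0..<s}"
    by (simp add: defs ivl_disj_un)
  have Tall: "T00 \<union> T10 \<union> T01 \<union> T11 = {s..<s + (t00 + t10 + t01 + t11)}"
    by (simp add: T00_def T10_def T01_def T11_def ivl_disj_un add.assoc)
  have ST: "(S00 \<union> S10 \<union> S01 \<union> S11) \<inter> (T00 \<union> T10 \<union> T01 \<union> T11) = {}"
    unfolding Sall Tall by auto
  note disj = disj ST
  have d1: "S00 \<inter> (S10 \<union> S01 \<union> L1 \<union> R1 \<union> T00) = {}"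
    using flags by (auto simp: defs)
  have c1: "card (S10 \<union> S01 \<union> L1 \<union> R1 \<union> T00) = s10 + s01 + l1 + r1 + t00"
  proof -
    have "(S10 \<union> S01 \<union> L1) \<inter> R1 = {}" "(S10 \<union> S01 \<union> L1) \<inter> T00 = {}" "R1 \<inter> T00 = {}"
      "S10 \<inter> L1 = {}" "S01 \<inter> L1 = {}"
      using flags by (auto simp: defs)
    then show ?thesis using fin cards disj by (simp add: card_Un_disjoint3)
  qed
  have d2: "S11 \<inter> (S10 \<union> S01 \<union> L0 \<union> R0 \<union> T11) = {}"
    using flags by (auto simp: defs)
  have c2: "card (S10 \<union> S01 \<union> L0 \<union> R0 \<union> T11) = s10 + s01 + l0 + r0 + t11"
  proof -
    have "(S10 \<union> S01 \<union> L0) \<inter> R0 = {}" "(S10 \<union> S01 \<union> L0) \<inter> T11 = {}" "R0 \<inter> T11 = {}"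
      "S10 \<inter> L0 = {}" "S01 \<inter> L0 = {}"
      using flags by (auto simp: defs)
    then show ?thesis using fin cards disj by (simp add: card_Un_disjoint3)
  qed
  have d3: "S10 \<inter> ((S00 - R0) \<union> (S11 - L1) \<union> T10) = {}"
    using flags by (auto simp: defs)
  have c3: "card ((S00 - R0) \<union> (S11 - L1) \<union> T10) = (s00 - r0) + (s11 - l1) + t10"
  proof -
    have "(S00 - R0) \<inter> (S11 - L1) = {}" "(S00 - R0) \<inter> T10 = {}" "(S11 - L1) \<inter> T10 = {}"
      using flags by (auto simp: defs)
    then show ?thesis using fin cards flag_sets by (simp add: card_Un_disjoint3 card_Diff_subset)
  qed
  have d4: "S01 \<inter> ((S00 - L0) \<union> (S11 - R1) \<union> T01) = {}"
    using flags by (auto simp: defs)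
  have c4: "card ((S00 - L0) \<union> (S11 - R1) \<union> T01) = (s00 - l0) + (s11 - r1) + t01"
  proof -
    have "(S00 - L0) \<inter> (S11 - R1) = {}" "(S00 - L0) \<inter> T01 = {}" "(S11 - R1) \<inter> T01 = {}"
      using flags by (auto simp: defs)
    then show ?thesis using fin cards flag_sets by (simp add: card_Un_disjoint3 card_Diff_subset)
  qed
  have "generic (\<lambda>P :: nat \<Rightarrow> nat \<Rightarrow> nat \<Rightarrow> 'k. determines b P S00 (S10 \<union> S01 \<union> L1 \<union> R1 \<union> T00))"
    by (rule generic_solvable[OF assms(1)]) (simp_all add: fin cards c1 d1)
  moreover have "generic (\<lambda>P :: nat \<Rightarrow> nat \<Rightarrow> nat \<Rightarrow> 'k. determines b P S11 (S10 \<union> S01 \<union> L0 \<union> R0 \<union> T11))"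
    by (rule generic_solvable[OF assms(2)]) (simp_all add: fin cards c2 d2)
  moreover have "generic (\<lambda>P :: nat \<Rightarrow> nat \<Rightarrow> nat \<Rightarrow> 'k. determines b P S10 ((S00 - R0) \<union> (S11 - L1) \<union> T10))"
    by (rule generic_solvable[OF assms(3)]) (simp_all add: fin cards c3 d3)
  moreover have "generic (\<lambda>P :: nat \<Rightarrow> nat \<Rightarrow> nat \<Rightarrow> 'k. determines b P S01 ((S00 - L0) \<union> (S11 - R1) \<union> T01))"
    by (rule generic_solvable[OF assms(4)]) (simp_all add: fin cards c4 d4)
  ultimately have "generic (\<lambda>P :: nat \<Rightarrow> nat \<Rightarrow> nat \<Rightarrow> 'k.
      determines b P S00 (S10 \<union> S01 \<union> L1 \<union> R1 \<union> T00) \<and> determines b P S11 (S10 \<union> S01 \<union> L0 \<union> R0 \<union> T11) \<and>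
      determines b P S10 ((S00 - R0) \<union> (S11 - L1) \<union> T10) \<and> determines b P S01 ((S00 - L0) \<union> (S11 - R1) \<union> T01))"
    by (intro generic_conj)
  then obtain P :: "'k config" where
    "determines b P S00 (S10 \<union> S01 \<union> L1 \<union> R1 \<union> T00)" "determines b P S11 (S10 \<union> S01 \<union> L0 \<union> R0 \<union> T11)"
    "determines b P S10 ((S00 - R0) \<union> (S11 - L1) \<union> T10)" "determines b P S01 ((S00 - L0) \<union> (S11 - R1) \<union> T01)"
    using generic_ex by blast
  from solvable_twisted_sets[OF fin(1-8) disj flag_sets this]
  obtain Q :: "'k config" where
    "determines (Suc (Suc b)) Q (S00 \<union> S10 \<union> S01 \<union> S11) (T00 \<union> T10 \<union> T01 \<union> T11)" by blast
  then show ?thesis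
    unfolding Sall Tall
    by (intro solvableI[of "Suc (Suc b)" Q "{0..<s}" "{s..<s + (t00 + t10 + t01 + t11)}"]) (auto simp: s_def)
qed

section \<open>Generic double points impose independent conditions\<close>

lemma solvable_0: "0 < s + t \<Longrightarrow> solvable TYPE('k::field) 0 s t"
  unfolding solvable_def determines_def
proof (intro exI allI impI, elim conjE)
  fix f :: "nat \<Rightarrow> 'k" and k :: nat
  assume "0 < s + t" "\<forall>j\<in>{..<s}. double_zero 0 f ((\<lambda>_ _ _. 0) j)"
    "\<forall>j\<in>{s..<s + t}. tform 0 f ((\<lambda>_ _ _. 0) j) = 0" "k < 2 ^ 0"
  then have "tform 0 f (\<lambda>_ _. 0) = 0"
    using double_zero_tform by (cases "s = 0") fastforce+
  then show "f k = 0"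
    using \<open>k < 2 ^ 0\<close> by (simp add: tform_def segre_vector_def)
qed

section \<open>Vertices of the cube and the covering code for \<open>n = 6\<close>\<close>

definition vertex :: "nat \<Rightarrow> nat \<Rightarrow> nat \<Rightarrow> 'k::field" where
  "vertex v = (\<lambda>i. unit_vec (of_bool (bit v i)))"

lemma bit_less: "k < 2 ^ n \<Longrightarrow> bit k i \<Longrightarrow> i < n" for k :: nat
  by (metis bit_take_bit_iff take_bit_nat_eq_self)

lemma nat_eq_iff_bits: "k < 2 ^ n \<Longrightarrow> v < 2 ^ n \<Longrightarrow> k = v \<longleftrightarrow> (\<forall>i<n. bit k i = bit v i)" for k v :: nat
  using bit_less by (auto simp: bit_eq_iff)

lemma flip_bit_less: "v < 2 ^ n \<Longrightarrow> i < n \<Longrightarrow> flip_bit i v < 2 ^ n" for v :: nat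
proof -
  assume "v < 2 ^ n" "i < n"
  then have "take_bit n (flip_bit i v) = flip_bit i v"
    using bit_less by (intro bit_eqI) (auto simp: bit_take_bit_iff bit_flip_bit_iff)
  then show ?thesis by (metis take_bit_nat_less_exp)
qed

lemma segre_vector_vertex:
  assumes "k < 2 ^ n" "v < 2 ^ n"
  shows "segre_vector n (vertex v) k = of_bool (k = v)"
proof (cases "k = v")
  case True
  then show ?thesis using assms by (simp add: segre_vector_def vertex_def unit_vec_def)
next
  case False
  then obtain i where "i < n" "bit k i \<noteq> bit v i"
    using nat_eq_iff_bits[OF assms] by blast
  then have "(\<Prod>i<n. vertex v i (of_bool (bit k i)) :: 'a) = 0"
    by (intro prod_zero bexI[of _ i]) (auto simp: vertex_def unit_vec_def)
  then show ?thesis using False assms by (simp add: segre_vector_def)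
qed

lemma tform_vertex:
  assumes "v < 2 ^ n"
  shows "tform n f (vertex v) = f v"
proof -
  have "tform n f (vertex v) = (\<Sum>k<2^n. if k = v then f k else 0)"
    unfolding tform_def by (intro sum.cong) (auto simp: segre_vector_vertex assms)
  then show ?thesis using assms by simp
qed

text \<open>Exchanging the unit vector in slot \<open>i\<close> moves to the neighbouring vertex. A
  double zero at a vertex therefore kills the coefficients of its whole Hamming ball of radius
  1.\<close>

lemma double_zero_vertex:
  assumes "double_zero n f (vertex v)" "v < 2 ^ n" "i < n"
  shows "f (flip_bit i v) = 0"
proof -
  have "(vertex v)(i := unit_vec (of_bool (\<not> bit v i))) = (vertex (flip_bit i v) :: nat \<Rightarrow> nat \<Rightarrow> 'a)"
    by (auto simp: vertex_def fun_eq_iff bit_flip_bit_iff)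
  moreover have "flip_bit i v < 2 ^ n"
    using assms flip_bit_less by blast
  ultimately show ?thesis
    using double_zero_unit[OF assms(1,3), of "of_bool (\<not> bit v i)"] tform_vertex[of "flip_bit i v" n f]
    by (simp split: if_splits)
qed

text \<open>The balls of radius 1 around eight code words cover all but eight vertices of the cube, and
  these eight span it affinely.\<close>

lemma solvable_6_9_1: "solvable TYPE('k::field_char_0) 6 9 1"
proof -
  \<comment> \<open>The words form the shortened Hamming code generated by 15, 19 and 37 under xor.
    Its minimum distance is 3, so the eight balls of seven vertices are disjoint and cover 56 of the
    64 vertices; the remaining set \<open>U\<close> is the coset of 6.\<close>
  define C :: "nat list" where "C = [0, 15, 19, 28, 37, 42, 54, 57]"
  define U :: "nat set" where "U = {6, 9, 21, 26, 35, 44, 48, 63}"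
  \<comment> \<open>The ninth double point is the all-ones point, whose tangent equations are sums
    of coefficients; the tenth point, a simple zero, is the vertex 6.\<close>
  define P :: "'k config" where
    "P j = (if j < 8 then vertex (C ! j) else if j = 8 then (\<lambda>_ _. 1) else vertex 6)" for j
  have "determines 6 P {..<9} {9..<9 + 1}"
    unfolding determines_def
  proof (intro allI impI; elim conjE)
    fix f :: "nat \<Rightarrow> 'k" and k :: nat
    assume S: "\<forall>j\<in>{..<9}. double_zero 6 f (P j)" and T: "\<forall>j\<in>{9..<9 + 1}. tform 6 f (P j) = 0"
      and k: "k < 2 ^ 6"
    have cover: "\<forall>k\<in>{..<64::nat}. k \<in> {6, 9, 21, 26, 35, 44, 48, 63} \<or>
        (\<exists>v\<in>{0, 15, 19, 28, 37, 42, 54, 57}. k = v \<or> (\<exists>i\<in>{0, 1, 2, 3, 4, 5}. k = flip_bit i v))"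
      by (simp add: lessThan_nat_numeral flip_bit_eq_xor push_bit_eq_mult)
    have zero: "f k = 0" if k: "k < 64" "k \<notin> U" for k
    proof -
      have "k \<in> {..<64}" using k by simp
      then have "\<exists>v\<in>{0, 15, 19, 28, 37, 42, 54, 57}. k = v \<or> (\<exists>i\<in>{0, 1, 2, 3, 4, 5}. k = flip_bit i v)"
        using bspec[OF cover] k(2) unfolding U_def by blast
      then obtain v where "v \<in> {0, 15, 19, 28, 37, 42, 54, 57}"
        and v: "k = v \<or> (\<exists>i\<in>{0, 1, 2, 3, 4, 5}. k = flip_bit i v)" by (rule bexE)
      then have "v \<in> set C" by (simp add: C_def)
      moreover have "{0, 1, 2, 3, 4, 5} \<subseteq> {..<6::nat}" by simp
      then have "k = v \<or> (\<exists>i<6. k = flip_bit i v)" using v by (meson lessThan_iff subsetD)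
      ultimately have v: "v \<in> set C" "k = v \<or> (\<exists>i<6. k = flip_bit i v)" by blast+
      moreover have "length C = 8" by (simp add: C_def)
      ultimately obtain j where j: "j < 8" "v = C ! j" by (metis in_set_conv_nth)
      have "v < 2 ^ 6" using v(1) by (auto simp: C_def)
      moreover have "double_zero 6 f (vertex v)" using bspec[OF S, of j] j by (simp add: P_def)
      ultimately show ?thesis
        using v(2) double_zero_vertex double_zero_tform tform_vertex by metis
    qed
    have dz: "double_zero 6 f (\<lambda>_ _. 1)" using S[rule_format, of 8] by (simp add: P_def)
    have sums: "tform 6 f a = (\<Sum>k\<in>U. segre_vector 6 a k * f k)" for a
      unfolding tform_def using zero by (intro sum.mono_neutral_right) (auto simp: U_def)
    have sv: "segre_vector 6 ((\<lambda>_ _. 1)(i := unit_vec (Suc 0))) k = (of_bool (bit k i) :: 'k)" 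
      if "i < 6" "k < 64" for i k
      using that by (simp add: segre_vector_def prod.remove[of "{..<6}" i] unit_vec_def fun_upd_def)
    have s1: "segre_vector 6 (\<lambda>_ _. 1) k = (1 :: 'k)" if "k < 64" for k
      using that by (simp add: segre_vector_def)
    have "(\<Sum>k\<in>U. of_bool (bit k i) * f k) = 0" if "i < 6" for i
    proof -
      have "(\<Sum>k\<in>U. of_bool (bit k i) * f k) = tform 6 f ((\<lambda>_ _. 1)(i := unit_vec (Suc 0)))"
        unfolding sums by (intro sum.cong refl arg_cong2[of _ _ _ _ "(*)"] sv[symmetric] that) (auto simp: U_def)
      then show ?thesis using double_zero_unit[OF dz that, of 1] by simp
    qed
    from this[of 0] this[of 1] this[of 2] this[of 3] this[of 4] this[of 5]
    have e: "f 9 + f 21 + f 35 + f 63 = 0" "f 6 + f 26 + f 35 + f 63 = 0" "f 6 + f 21 + f 44 + f 63 = 0"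
      "f 9 + f 26 + f 44 + f 63 = 0" "f 21 + f 26 + f 48 + f 63 = 0" "f 35 + f 44 + f 48 + f 63 = 0"
      by (simp_all add: U_def bit_numeral_rec add.assoc bit_iff_odd)
    have "(\<Sum>k\<in>U. f k) = tform 6 f (\<lambda>_ _. 1)"
      unfolding sums by (intro sum.cong) (auto simp: U_def s1)
    then have s: "f 6 + f 9 + f 21 + f 26 + f 35 + f 44 + f 48 + f 63 = 0"
      using double_zero_tform[OF dz] by (simp add: U_def add.assoc)
    \<comment> \<open>The ninth double point gives seven independent equations for the eight
      remaining coefficients; the simple zero removes the last degree of freedom.\<close>
    have 6: "f 6 = 0" using bspec[OF T, of 9] tform_vertex[of 6 6 f] by (simp add: P_def)
    have "2 * f 9 = 2 * f 6" using e(1-4) by algebra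
    then have 9: "f 9 = 0" using 6 by simp
    have "f 48 + f 63 = 0" using e(5,6) s 6 9 by algebra
    moreover have "2 * f 63 = f 48 + f 63 + (f 48 + f 63)" using e 6 9 by algebra
    ultimately have 63: "f 63 = 0" "f 48 = 0" by auto
    have "2 * f 35 = 0" using e 6 9 63 by algebra
    then have 35: "f 35 = 0" by simp
    then have "f 21 = 0" "f 26 = 0" "f 44 = 0" using e 6 9 63 by auto
    then have "f k = 0" if "k \<in> U" for k using that 6 9 63 35 by (auto simp: U_def)
    then show "f k = 0" using zero k by (cases "k \<in> U") auto
  qed
  then show ?thesis unfolding solvable_def by blast
qed

section \<open>The arithmetic of the induction\<close>

lemma power2_growth: "7 \<le> b \<Longrightarrow> 6 * b * b + 20 * b + 3 < 4 * 2 ^ b" for b :: nat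
proof (induction b rule: dec_induct)
  case (step b)
  have "7 * b \<le> b * b" using step by (intro mult_right_mono) auto
  then show ?case using step by (simp add: algebra_simps)
qed simp

text \<open>With \<open>\<sigma> = s div 4\<close> points in each class every block would have
  \<open>(b + 3) * \<sigma>\<close> conditions and lack \<open>D\<close>. Flags feed only the blocks
  00 and 11, so the surplus double points go to the mixed classes: the classes 00, 10, 01, 11 get
  \<sigma> - 1, \<sigma> + 1, \<sigma> + 1, \<sigma> points if \<open>s = 4 * \<sigma> + 1\<close>,
  and \<sigma>, \<sigma> + 1, \<sigma> + 2, \<sigma> points if
  \<open>s = 4 * \<sigma> + 3\<close>.\<close>

lemma solvable_twisted_step:
  assumes IH: "\<And>s t. 2 ^ b \<le> (b + 1) * s + t \<Longrightarrow> solvable TYPE('k::field_char_0) b s t"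
    and b: "6 \<le> b" and t: "t \<le> b" and h: "s = 2 * h + 1"
    and lower: "4 * 2 ^ b \<le> (b + 3) * s + t" and upper: "(b + 3) * (2 * h) + t < 4 * 2 ^ b"
  shows "solvable TYPE('k) (Suc (Suc b)) s t"
proof -
  define B :: nat where "B = 2 ^ b"
  define \<sigma> where "\<sigma> = h div 2"
  \<comment> \<open>Naming this product leaves linear goals.\<close>
  define X where "X = b * \<sigma>"
  \<comment> \<open>There are enough points to carry the flags; otherwise the number of conditions
    would be bounded quadratically in \<open>b\<close>, against \<open>power2_growth\<close>. That
    estimate fails at \<open>b = 6\<close>, where \<sigma> is computed instead.\<close>
  have large: "3 * b \<le> 2 * \<sigma>" if "7 \<le> b"
  proof (rule ccontr)
    assume "\<not> ?thesis"
    then have *: "2 * \<sigma> + 1 \<le> 3 * b" by simp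
    then have "b * (2 * \<sigma> + 1) \<le> b * (3 * b)" by (rule mult_le_mono2)
    then have "2 * X + b \<le> 3 * (b * b)" by (simp add: X_def algebra_simps)
    moreover have "h \<le> 2 * \<sigma> + 1" by (simp add: \<sigma>_def)
    then have "(b + 3) * s \<le> (b + 3) * (4 * \<sigma> + 3)" unfolding h by (intro mult_le_mono2) simp
    then have "(b + 3) * s \<le> 4 * X + 12 * \<sigma> + 3 * b + 9" by (simp add: X_def algebra_simps)
    moreover have "b \<le> b * b" by simp
    ultimately have "4 * 2 ^ b \<le> 6 * (b * b) + 20 * b + 3" using lower t * by linarith
    then show False using power2_growth[OF that] by (simp add: mult.assoc)
  qed
  consider "h = 2 * \<sigma>" | "h = 2 * \<sigma> + 1" unfolding \<sigma>_def by linarith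
  then show ?thesis
  proof cases
    case 1
    have lo: "4 * B \<le> 4 * X + 12 * \<sigma> + b + 3 + t" and up: "4 * X + 12 * \<sigma> + t < 4 * B"
      using lower upper unfolding h 1 by (simp_all add: B_def X_def algebra_simps)
    have "X + 3 * \<sigma> < B" using up by linarith
    then obtain D where D: "B = X + 3 * \<sigma> + D" "0 < D"
      using less_imp_add_positive by metis
    have D4: "4 * D \<le> b + 3 + t" using lo D by simp
    have \<sigma>: "D + b \<le> \<sigma> + 1"
    proof (cases "b = 6")
      case True
      then have "B = 64" "X = 6 * \<sigma>" by (simp_all add: B_def X_def)
      with lo up D(1) t True have "\<sigma> \<le> 7" "7 \<le> \<sigma>" by linarith+
      then show ?thesis using \<open>B = 64\<close> \<open>X = 6 * \<sigma>\<close> D(1) True by simp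
    next
      case False
      then show ?thesis using large D4 t b by simp
    qed
    \<comment> \<open>Block 11 lacks \<open>D - 2\<close> conditions, to be supplied by flags of
      class 00, and block 00 lacks \<open>D + b - 1\<close>, to be supplied by class 11. Halves are
      rounded crosswise: each mixed block loses one half rounded up and one rounded down.\<close>
    define \<alpha> where "\<alpha> = D - 2"
    define l0 where "l0 = (\<alpha> + 1) div 2"
    define r0 where "r0 = \<alpha> div 2"
    define \<beta> where "\<beta> = D + b - 1"
    define l1 where "l1 = (\<beta> + 1) div 2"
    define r1 where "r1 = \<beta> div 2"
    have lr: "l0 + r0 = \<alpha>" "l1 + r1 = \<beta>" by (simp_all add: l0_def r0_def l1_def r1_def)
    obtain \<rho> where \<rho>: "\<sigma> = Suc \<rho>" using \<sigma> b D(2) by (cases \<sigma>) auto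
    \<comment> \<open>Exactly the shortfall of block 01; block 10 takes the other simple
      points.\<close>
    define t01 where "t01 = (D + l0 + r1) - b"
    have B: "B = b * \<rho> + b + 3 * \<rho> + 3 + D" using D by (simp add: X_def \<rho>)
    have le: "r0 \<le> \<rho>" "l0 \<le> \<rho>" "l1 \<le> Suc \<rho>" "r1 \<le> Suc \<rho>" "l0 + r0 \<le> \<rho>" "l1 + r1 \<le> Suc \<rho>"
      using lr \<sigma> D b unfolding \<rho> \<alpha>_def \<beta>_def by linarith+
    \<comment> \<open>For \<open>D = 1\<close> the subtraction \<open>D - 2\<close> is truncated,
      hence the separate case.\<close>
    have "D + l0 + r1 \<le> b + t \<and> D + r0 + l1 \<le> b + (t - t01)"
    proof (cases "D = 1")
      case True
      then show ?thesis
        using b unfolding t01_def l0_def r0_def l1_def r1_def \<alpha>_def \<beta>_def by simp linarith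
    next
      case False
      define e where "e = D - 2"
      have e: "D = e + 2" using False D(2) by (simp add: e_def)
      have ab: "\<alpha> = e" "\<beta> = e + b + 1" by (simp_all add: \<alpha>_def \<beta>_def e)
      have 4: "4 * e + 5 \<le> b + t" using D4 e by simp
      define x y where "x = e div 2" and "y = b div 2"
      have "e = 2 * x \<or> e = 2 * x + 1" "b = 2 * y \<or> b = 2 * y + 1" unfolding x_def y_def by linarith+
      then show ?thesis
        using 4 b unfolding e t01_def l0_def r0_def l1_def r1_def ab by (elim disjE) simp_all
    qed
    then have t01: "t01 \<le> t" "D + l0 + r1 \<le> b + t01" "D + r0 + l1 \<le> b + (t - t01)"
      unfolding t01_def by linarith+
    have "solvable TYPE('k) (Suc (Suc b)) (\<rho> + (\<rho> + 2) + (\<rho> + 2) + Suc \<rho>) (0 + (t - t01) + t01 + 0)"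
    proof (rule solvable_twisted[where ?l0.0 = l0 and ?r0.0 = r0 and ?l1.0 = l1 and ?r1.0 = r1];
        (rule IH, unfold B_def[symmetric] B)?)
      show "b * \<rho> + b + 3 * \<rho> + 3 + D \<le> (b + 1) * \<rho> + (\<rho> + 2 + (\<rho> + 2) + l1 + r1 + 0)"
        using lr(2) by (simp add: \<beta>_def)
      show "b * \<rho> + b + 3 * \<rho> + 3 + D \<le> (b + 1) * Suc \<rho> + (\<rho> + 2 + (\<rho> + 2) + l0 + r0 + 0)"
        using lr(1) by (simp add: \<alpha>_def)
      show "b * \<rho> + b + 3 * \<rho> + 3 + D \<le> (b + 1) * (\<rho> + 2) + (\<rho> - r0 + (Suc \<rho> - l1) + (t - t01))"
        using le t01 by (simp add: algebra_simps)
      show "b * \<rho> + b + 3 * \<rho> + 3 + D \<le> (b + 1) * (\<rho> + 2) + (\<rho> - l0 + (Suc \<rho> - r1) + t01)"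
        using le t01 by (simp add: algebra_simps)
    qed (use le in auto)
    moreover have "\<rho> + (\<rho> + 2) + (\<rho> + 2) + Suc \<rho> = s" using h 1 \<rho> by simp
    ultimately show ?thesis using t01(1) by simp
  next
    case 2
    have lo: "4 * B \<le> 4 * X + 12 * \<sigma> + 3 * b + 9 + t" and up: "4 * X + 12 * \<sigma> + 2 * b + 6 + t < 4 * B"
      using lower upper unfolding h 2 by (simp_all add: B_def X_def algebra_simps)
    have "X + 3 * \<sigma> < B" using up by linarith
    then obtain D where D: "B = X + 3 * \<sigma> + D" "0 < D"
      using less_imp_add_positive by metis
    have D4: "4 * D \<le> 3 * b + 9 + t" "2 * b + 7 + t \<le> 4 * D" using lo up D by simp_all
    \<comment> \<open>For \<open>b = 6\<close> the two bounds leave no value of \<sigma> in this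
      residue class.\<close>
    have b7: "7 \<le> b"
    proof (rule ccontr)
      assume "\<not> 7 \<le> b"
      then have "b = 6" using b by simp
      then have "B = 64" "X = 6 * \<sigma>" by (simp_all add: B_def X_def)
      with up \<open>b = 6\<close> have "\<sigma> \<le> 6" by linarith
      then show False using lo t \<open>b = 6\<close> \<open>B = 64\<close> \<open>X = 6 * \<sigma>\<close> by linarith
    qed
    define \<gamma> where "\<gamma> = D - 3"
    have "3 \<le> D" using D4(2) b7 by simp
    then have \<gamma>D: "D = \<gamma> + 3" by (simp add: \<gamma>_def)
    have "b \<le> \<sigma>" using large[OF b7] by simp
    moreover have "D \<le> b + 3" using D4(1) t by simp
    ultimately have \<gamma>: "\<gamma> \<le> \<sigma>" "D = \<gamma> + 3" using \<gamma>D by simp_all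
    \<comment> \<open>Blocks 00 and 11 lack \<gamma> each, so \<open>2 * \<gamma>\<close> zeros have
      to leave the mixed blocks. Class 01 has one double point more than class 10, so block 01
      should give up about \<open>b + 1\<close> more than block 10; \<open>r\<close> is the share of
      block 10.\<close>
    define r where "r = (2 * \<gamma> - (b + 1)) div 2"
    define r0 where "r0 = r div 2"
    define l1 where "l1 = r - r div 2"
    define l0 where "l0 = \<gamma> - r0"
    define r1 where "r1 = \<gamma> - l1"
    have lr: "r0 + l1 = r" "l0 + r0 = \<gamma>" "l1 + r1 = \<gamma>" "l0 + r1 + r = 2 * \<gamma>"
    proof -
      have "r \<le> \<gamma>" unfolding r_def by simp
      moreover have "r div 2 \<le> r" by simp
      ultimately show "r0 + l1 = r" "l0 + r0 = \<gamma>" "l1 + r1 = \<gamma>" "l0 + r1 + r = 2 * \<gamma>"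
        unfolding l0_def r0_def l1_def r1_def by simp_all
    qed
    \<comment> \<open>Again the shortfall of block 01, namely
      \<open>D + (l0 + r1) - (2 * b + 2)\<close>, expressed through \<open>D\<close> and
      \<open>r\<close>.\<close>
    define t01 where "t01 = D - (2 * b + 8 + r - 2 * D)"
    have t01: "t01 \<le> t" "D + r \<le> b + 1 + (t - t01)" "D + (l0 + r1) \<le> 2 * b + 2 + t01"
    proof -
      define x where "x = (2 * \<gamma> - (b + 1)) div 2"
      have "2 * x + 1 = 2 * \<gamma> - (b + 1) \<or> 2 * x = 2 * \<gamma> - (b + 1)" unfolding x_def by linarith
      then have "2 * x + b + 2 = 2 * \<gamma> \<or> 2 * x + b + 1 = 2 * \<gamma> \<or> x = 0 \<and> 2 * \<gamma> \<le> b + 1" by linarith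
      moreover have "r = x" by (simp add: r_def x_def)
      moreover define y where "y = b div 2"
      have "b = 2 * y \<or> b = 2 * y + 1" unfolding y_def by linarith
      ultimately show "t01 \<le> t" "D + r \<le> b + 1 + (t - t01)" "D + (l0 + r1) \<le> 2 * b + 2 + t01"
        using D4 \<gamma>(2) b7 t lr(4) unfolding t01_def by (elim disjE; linarith)+
    qed
    have B: "B = b * \<sigma> + 3 * \<sigma> + D" using D by (simp add: X_def)
    have le: "r0 \<le> \<sigma>" "l0 \<le> \<sigma>" "l1 \<le> \<sigma>" "r1 \<le> \<sigma>" "l0 + r0 \<le> \<sigma>" "l1 + r1 \<le> \<sigma>"
      using lr \<gamma> by linarith+
    have "solvable TYPE('k) (Suc (Suc b)) (\<sigma> + (\<sigma> + 1) + (\<sigma> + 2) + \<sigma>) (0 + (t - t01) + t01 + 0)"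
    proof (rule solvable_twisted[where ?l0.0 = l0 and ?r0.0 = r0 and ?l1.0 = l1 and ?r1.0 = r1];
        (rule IH, unfold B_def[symmetric] B)?)
      show "b * \<sigma> + 3 * \<sigma> + D \<le> (b + 1) * \<sigma> + (\<sigma> + 1 + (\<sigma> + 2) + l1 + r1 + 0)"
        using lr(3) \<gamma>(2) by simp
      show "b * \<sigma> + 3 * \<sigma> + D \<le> (b + 1) * \<sigma> + (\<sigma> + 1 + (\<sigma> + 2) + l0 + r0 + 0)"
        using lr(2) \<gamma>(2) by simp
      show "b * \<sigma> + 3 * \<sigma> + D \<le> (b + 1) * (\<sigma> + 1) + (\<sigma> - r0 + (\<sigma> - l1) + (t - t01))"
        using le t01 lr by (simp add: algebra_simps)
      show "b * \<sigma> + 3 * \<sigma> + D \<le> (b + 1) * (\<sigma> + 2) + (\<sigma> - l0 + (\<sigma> - r1) + t01)"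
        using le t01 by (simp add: algebra_simps)
    qed (use le in auto)
    moreover have "\<sigma> + (\<sigma> + 1) + (\<sigma> + 2) + \<sigma> = s" using h 2 by simp
    ultimately show ?thesis using t01(1) by simp
  qed
qed

text \<open>The half with \<open>h + 1\<close> double points is ahead by \<open>m\<close>
  conditions; the first \<open>m\<close> simple points go to the other half, the rest are shared
  evenly.\<close>

lemma halves:
  fixes B X h n m t :: nat
  assumes "2 * B \<le> 2 * X + 2 * h + n + 1 + t" "m \<le> t" "n = Suc m"
  shows "B \<le> X + n + h + (t - m) div 2 \<and> B \<le> X + (h + 1) + (t - (t - m) div 2)"
proof -
  obtain u where u: "t = m + u" using assms(2) le_Suc_ex by blast
  have "2 * (u div 2) \<le> u" "u \<le> 2 * (u div 2) + 1" by simp_all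
  then show ?thesis using assms unfolding u by auto
qed

text \<open>The exception is genuine: a single simple zero for \<open>n = 4\<close> and
  \<open>s = 3\<close> would give dimension at least 14 by \<open>secant_dim_ge\<close>, contrary to
  \<open>secant_dim_4_3\<close>.\<close>

theorem solvable_expected:
  assumes "2 ^ n \<le> (n + 1) * s + t" "n = 4 \<Longrightarrow> s = 3 \<Longrightarrow> 2 \<le> t"
  shows "solvable TYPE('k::field_char_0) n s t"
  using assms
proof (induction n arbitrary: s t rule: less_induct)
  case (less n)
  show ?case
  proof (cases n)
    case 0
    then show ?thesis using less.prems by (intro solvable_0[of s t, folded 0]) (auto simp: Suc_le_eq)
  next
    case (Suc m)
    have split: "solvable TYPE('k) n (s0 + s1) (t0 + t1)"
      if "2 ^ m \<le> n * s0 + s1 + t0" "2 ^ m \<le> n * s1 + s0 + t1"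
        "m = 4 \<Longrightarrow> s0 = 3 \<Longrightarrow> 2 \<le> s1 + t0" "m = 4 \<Longrightarrow> s1 = 3 \<Longrightarrow> 2 \<le> s0 + t1" for s0 s1 t0 t1
      unfolding Suc using that Suc by (intro solvable_split less.IH) auto
    have even: "solvable TYPE('k) n (2 * h) t" if "2 ^ n \<le> (n + 1) * (2 * h) + t" for h t
    proof -
      define X where "X = n * h"
      have *: "2 * 2 ^ m \<le> 2 * X + 2 * h + t"
        using that Suc by (simp add: X_def algebra_simps)
      have "solvable TYPE('k) n (h + h) (t div 2 + (t - t div 2))"
      proof (intro split)
        show "2 ^ m \<le> n * h + h + t div 2" "2 ^ m \<le> n * h + h + (t - t div 2)"
          using * unfolding X_def[symmetric] by presburger+
      qed auto
      then show ?thesis by (simp add: mult_2)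
    qed
    show ?thesis
    proof (cases "even s")
      case True
      then show ?thesis using even less.prems(1) by (metis evenE)
    next
      case False
      then obtain h where h: "s = 2 * h + 1" by (rule oddE)
      define X where "X = n * h"
      have lower: "2 * 2 ^ m \<le> 2 * X + 2 * h + n + 1 + t"
        using less.prems(1) Suc by (simp add: h X_def algebra_simps)
      consider "2 ^ n \<le> (n + 1) * (2 * h) + t" | "m \<le> t"
        | "(n + 1) * (2 * h) + t < 2 ^ n" "t < m" by linarith
      then show ?thesis
      proof cases
        case 1
        from even[OF this] show ?thesis by (rule solvable_mono) (auto simp: h)
      next
        case 2
        define t0 where "t0 = (t - m) div 2"
        have t0: "t0 \<le> t" by (simp add: t0_def)
        have "solvable TYPE('k) n ((h + 1) + h) (t0 + (t - t0))"
        proof (intro split)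
          have X: "n * (h + 1) = X + n" "n * h = X" by (simp_all add: X_def)
          show "2 ^ m \<le> n * (h + 1) + h + t0" "2 ^ m \<le> n * h + (h + 1) + (t - t0)"
            using halves[OF lower 2 Suc] unfolding t0_def X by blast+
        qed auto
        then show ?thesis using t0 by (simp add: h mult_2)
      next
        case 3
        \<comment> \<open>The window for \<open>(n + 1) * s\<close> is narrow. If
          \<open>n + 1\<close> is a power of two, as for 3 and 7, only the even number
          \<open>2 ^ n div (n + 1)\<close> could fit.\<close>
        have small: "n = 4 \<and> h = 1 \<and> t = 2 \<or> n = 5 \<and> h = 2 \<and> 2 \<le> t \<or> n = 6 \<and> h = 4 \<and> 1 \<le> t \<or> 8 \<le> n"
        proof (rule ccontr)
          assume no: "\<not> ?thesis"
          then have "n < 8" by (meson not_le)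
          then have "n = 1 \<or> n = 2 \<or> n = 3 \<or> n = 4 \<or> n = 5 \<or> n = 6 \<or> n = 7"
            using Suc by linarith
          moreover have False if "n = 1" using 3 Suc that by simp
          moreover have False if "n = 2"
          proof -
            have m: "m = 1" using Suc that by simp
            have "6 * h + t < 4" "4 \<le> 6 * h + 3 + t" "t < 1"
              using 3 less.prems(1) unfolding that h m by simp_all
            then show False by presburger
          qed
          moreover have False if "n = 3"
          proof -
            have m: "m = 2" using Suc that by simp
            have "8 * h + t < 8" "8 \<le> 8 * h + 4 + t" "t < 2"
              using 3 less.prems(1) unfolding that h m by simp_all
            then show False by presburger
          qed
          moreover have False if "n = 4"
          proof -
            have m: "m = 3" using Suc that by simp
            have "10 * h + t < 16" "16 \<le> 10 * h + 5 + t" "t < 3"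
              using 3 less.prems(1) unfolding that h m by simp_all
            then have "h = 1" "1 \<le> t" by presburger+
            then show False using no that less.prems(2) \<open>t < 3\<close> h by auto
          qed
          moreover have False if "n = 5"
          proof -
            have m: "m = 4" using Suc that by simp
            have "12 * h + t < 32" "32 \<le> 12 * h + 6 + t" "t < 4"
              using 3 less.prems(1) unfolding that h m by simp_all
            then have "h = 2" "2 \<le> t" by presburger+
            then show False using no that less.prems(2) by auto
          qed
          moreover have False if "n = 6"
          proof -
            have m: "m = 5" using Suc that by simp
            have "14 * h + t < 64" "64 \<le> 14 * h + 7 + t" "t < 5"
              using 3 less.prems(1) unfolding that h m by simp_all
            then have "h = 4" "1 \<le> t" by presburger+
            then show False using no that less.prems(2) by auto
          qed
          moreover have False if "n = 7"
          proof -
            have m: "m = 6" using Suc that by simp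
            have "16 * h + t < 128" "128 \<le> 16 * h + 8 + t" "t < 6"
              using 3 less.prems(1) unfolding that h m by simp_all
            then show False by presburger
          qed
          ultimately show False by blast
        qed
        then consider "n = 4" "h = 1" "t = 2" | "n = 5" "h = 2" "2 \<le> t" | "n = 6" "h = 4" "1 \<le> t" | "8 \<le> n"
          by blast
        then show ?thesis
        proof cases
          case 1
          then have "solvable TYPE('k) n (2 + 1) (0 + 2)" using Suc by (intro split) auto
          then show ?thesis using 1 h by (simp add: numeral_2_eq_2)
        next
          case 2
          \<comment> \<open>With this distribution each of the four blocks gets exactly
            \<open>2 ^ 3\<close> conditions.\<close>
          have "solvable TYPE('k) (Suc (Suc 3)) (1 + 1 + 2 + 1) (0 + 2 + 0 + 0)"
          proof (rule solvable_twisted[where ?l0.0 = 1 and ?r0.0 = 0 and ?l1.0 = 0 and ?r1.0 = 1])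
            show "solvable TYPE('k) 3 1 (1 + 2 + 0 + 1 + 0)" "solvable TYPE('k) 3 1 (1 + 2 + 1 + 0 + 0)"
              "solvable TYPE('k) 3 1 (1 - 0 + (1 - 0) + 2)" "solvable TYPE('k) 3 2 (1 - 1 + (1 - 1) + 0)"
              by (rule less.IH; simp add: 2)+
          qed simp_all
          then have "solvable TYPE('k) 5 5 2" by (simp add: numeral_eq_Suc)
          then show ?thesis unfolding 2(1) by (rule solvable_mono) (use 2 h in simp_all)
        next
          \<comment> \<open>For \<open>t = 1\<close> the count is exact, so a four-block step would
            need exactly 16 conditions in each block, and some block would hold at least three
            double zeros: three with one simple zero is the exception, four are too many. Hence the
            covering code.\<close>
          case 3
          then show ?thesis
            using solvable_mono[OF solvable_6_9_1, of 9 t] h by simp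
        next
          case 4
          \<comment> \<open>Here \<open>b\<close> is at least 6, so the recursive calls stay clear
            of the exception.\<close>
          define b where "b = n - 2"
          have b: "n = Suc (Suc b)" "m = Suc b" using 4 Suc by (simp_all add: b_def)
          have "solvable TYPE('k) (Suc (Suc b)) s t"
          proof (rule solvable_twisted_step[OF _ _ _ h])
            show "solvable TYPE('k) b s t" if "2 ^ b \<le> (b + 1) * s + t" for s t
              using that 4 b by (intro less.IH) auto
            show "6 \<le> b" "t \<le> b" using 4 3(2) b by simp_all
            show "4 * 2 ^ b \<le> (b + 3) * s + t" using less.prems(1) b(1) by (simp add: algebra_simps)
            show "(b + 3) * (2 * h) + t < 4 * 2 ^ b" using 3(1) b(1) by (simp add: algebra_simps)
          qed
          then show ?thesis by (simp add: b)
        qed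
      qed
    qed
  qed
qed

section \<open>Forms and the dimension of projective sets\<close>

definition is_form :: "nat \<Rightarrow> nat \<Rightarrow> 'k::field mpoly \<Rightarrow> bool" where
  "is_form N d F \<longleftrightarrow> (\<forall>m\<in>Poly_Mapping.keys F. Poly_Mapping.keys m \<subseteq> {..N} \<and> mono_degree m = d)"

lemma homogeneous_iff: "homogeneous N F \<longleftrightarrow> (\<exists>d. is_form N d F)"
  by (simp add: homogeneous_def is_form_def)

lemma is_formD: "is_form N d F \<Longrightarrow> homogeneous N F"
  by (auto simp: homogeneous_iff)

lemma is_form_0 [simp]: "is_form N d 0"
  by (simp add: is_form_def)

lemma is_form_1 [simp]: "is_form N 0 1"
  by (simp add: is_form_def mono_degree_def)

lemma is_form_add: "is_form N d F \<Longrightarrow> is_form N d G \<Longrightarrow> is_form N d (F + G)"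
  using keys_add[of F G] by (auto simp: is_form_def)

lemma is_form_sum: "(\<And>i. i \<in> A \<Longrightarrow> is_form N d (F i)) \<Longrightarrow> is_form N d (sum F A)"
  by (induction A rule: infinite_finite_induct) (auto intro: is_form_add)

lemma is_form_mult:
  assumes "is_form N d F" "is_form N e G"
  shows "is_form N (d + e) (F * G)"
  unfolding is_form_def
proof
  fix m assume "m \<in> Poly_Mapping.keys (F * G)"
  then obtain a b where ab: "m = a + b" "a \<in> Poly_Mapping.keys F" "b \<in> Poly_Mapping.keys G"
    using keys_mult[of F G] by blast
  moreover have "Poly_Mapping.keys a \<subseteq> {..N}" "mono_degree a = d"
    "Poly_Mapping.keys b \<subseteq> {..N}" "mono_degree b = e"
    using assms ab unfolding is_form_def by blast+
  ultimately show "Poly_Mapping.keys m \<subseteq> {..N} \<and> mono_degree m = d + e"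
    using keys_add[of a b] by (auto simp: mono_degree_add)
qed

lemma is_form_power: "is_form N d F \<Longrightarrow> is_form N (d * e) (F ^ e)"
  by (induction e) (auto intro: is_form_mult)

lemma poly_eval_power: "poly_eval (F ^ e) v = poly_eval F v ^ e"
  by (induction e) (simp_all add: poly_eval_mult)

definition const_form :: "'k::field \<Rightarrow> 'k mpoly" where
  "const_form c = Poly_Mapping.single 0 c"

lemma is_form_const: "is_form N 0 (const_form c)"
  by (simp add: is_form_def const_form_def mono_degree_def)

lemma poly_eval_const [simp]: "poly_eval (const_form c) v = c"
  by (simp add: const_form_def poly_eval_single mono_eval_def)

definition coord_form :: "nat \<Rightarrow> 'k::field mpoly" where
  "coord_form k = Poly_Mapping.single (Poly_Mapping.single k 1) 1"

lemma is_form_coord: "k \<le> N \<Longrightarrow> is_form N 1 (coord_form k)"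
  by (simp add: is_form_def coord_form_def mono_degree_def)

lemma poly_eval_coord [simp]: "poly_eval (coord_form k) v = v k"
  by (simp add: coord_form_def poly_eval_single mono_eval_def)

lemma is_form_lincomb:
  assumes "\<And>i. i \<in> A \<Longrightarrow> is_form N d (F i)"
  shows "is_form N d (\<Sum>i\<in>A. const_form (c i) * F i)"
proof (rule is_form_sum)
  show "is_form N d (const_form (c i) * F i)" if "i \<in> A" for i
    using is_form_mult[OF is_form_const assms[OF that], of "c i"] by simp
qed

lemma poly_eval_lincomb:
  "poly_eval (\<Sum>i\<in>A. const_form (c i) * F i) v = (\<Sum>i\<in>A. c i * poly_eval (F i) v)"
  by (simp add: poly_eval_sum poly_eval_mult)

section \<open>Affine representatives of projective sets\<close>

definition cone :: "nat \<Rightarrow> 'k::field point set \<Rightarrow> (nat \<Rightarrow> 'k) set" where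
  "cone N Z = {v \<in> coord_space N. v \<noteq> 0 \<and> vspan {v} \<in> Z}"

definition points :: "(nat \<Rightarrow> 'k::field) set \<Rightarrow> 'k point set" where
  "points W = (\<lambda>v. vspan {v}) ` W"

lemma vspan_in_proj_space: "v \<in> coord_space N \<Longrightarrow> v \<noteq> 0 \<Longrightarrow> vspan {v} \<in> proj_space N"
  unfolding proj_space_def by blast

lemma proj_spaceE:
  assumes "P \<in> proj_space N"
  obtains v where "v \<in> coord_space N" "v \<noteq> 0" "P = vspan {v}"
  using assms unfolding proj_space_def by blast

lemma vspan_in_zero_locus:
  assumes "\<forall>F\<in>T. homogeneous N F" "v \<in> coord_space N" "v \<noteq> 0"
  shows "vspan {v} \<in> zero_locus N T \<longleftrightarrow> (\<forall>F\<in>T. poly_eval F v = 0)"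
  using assms vspan_in_proj_space vanishing_representative
  unfolding zero_locus_def by blast

text \<open>Closed sets are zero loci of forms, so membership in a closure is tested by forms on
  representatives. This turns later topological arguments into statements about polynomials.\<close>

lemma vspan_in_closure:
  fixes W :: "(nat \<Rightarrow> 'k::field) set"
  assumes "W \<subseteq> coord_space N - {0}" "v \<in> coord_space N" "v \<noteq> 0"
  shows "vspan {v} \<in> zariski N closure_of points W \<longleftrightarrow>
    (\<forall>F. homogeneous N F \<and> (\<forall>w\<in>W. poly_eval F w = 0) \<longrightarrow> poly_eval F v = 0)"
proof
  assume cl: "vspan {v} \<in> zariski N closure_of points W"
  show "\<forall>F. homogeneous N F \<and> (\<forall>w\<in>W. poly_eval F w = 0) \<longrightarrow> poly_eval F v = 0"
  proof (intro allI impI, elim conjE)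
    fix F :: "'k mpoly" assume F: "homogeneous N F" "\<forall>w\<in>W. poly_eval F w = 0"
    have "points W \<subseteq> zero_locus N {F}"
      using assms(1) F vspan_in_zero_locus[of "{F}" N] unfolding points_def by auto
    moreover have "closedin (zariski N) (zero_locus N {F})"
      unfolding closedin_zariski using F(1) by blast
    ultimately have "zariski N closure_of points W \<subseteq> zero_locus N {F}"
      by (rule closure_of_minimal)
    then show "poly_eval F v = 0"
      using cl F(1) assms vspan_in_zero_locus[of "{F}" N v] by blast
  qed
next
  assume *: "\<forall>F. homogeneous N F \<and> (\<forall>w\<in>W. poly_eval F w = 0) \<longrightarrow> poly_eval F v = 0"
  have "points W \<subseteq> proj_space N"
    using assms(1) vspan_in_proj_space unfolding points_def by blast
  then have sub: "points W \<subseteq> zariski N closure_of points W"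
    by (simp add: closure_of_subset)
  have "closedin (zariski N) (zariski N closure_of points W)" by simp
  then obtain T where T: "\<forall>F\<in>T. homogeneous N F" "zariski N closure_of points W = zero_locus N T"
    unfolding closedin_zariski by blast
  have "poly_eval F w = 0" if "F \<in> T" "w \<in> W" for F w
  proof -
    have "vspan {w} \<in> zero_locus N T" using sub that T(2) unfolding points_def by blast
    then show ?thesis using vspan_in_zero_locus[OF T(1)] assms(1) that by blast
  qed
  then have "\<forall>F\<in>T. poly_eval F v = 0" using * T(1) by blast
  then show "vspan {v} \<in> zariski N closure_of points W"
    unfolding T(2) using vspan_in_zero_locus[OF T(1) assms(2,3)] by blast
qed

lemma closed_cone_iff:
  assumes "closedin (zariski N) Z" "v \<in> coord_space N" "v \<noteq> 0"
  shows "v \<in> cone N Z \<longleftrightarrow>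
    (\<forall>F. homogeneous N F \<and> (\<forall>w\<in>cone N Z. poly_eval F w = 0) \<longrightarrow> poly_eval F v = 0)"
proof
  assume *: "\<forall>F. homogeneous N F \<and> (\<forall>w\<in>cone N Z. poly_eval F w = 0) \<longrightarrow> poly_eval F v = 0"
  obtain T where T: "\<forall>F\<in>T. homogeneous N F" "Z = zero_locus N T"
    using assms(1) unfolding closedin_zariski by blast
  have "\<forall>w\<in>cone N Z. poly_eval F w = 0" if "F \<in> T" for F
    using that vspan_in_zero_locus[OF T(1)] unfolding cone_def T(2) by blast
  then have "\<forall>F\<in>T. poly_eval F v = 0" using * T(1) by blast
  then show "v \<in> cone N Z"
    using assms vspan_in_zero_locus[OF T(1)] unfolding cone_def T(2) by blast
qed blast

lemma cone_nonempty:
  assumes "Z \<subseteq> proj_space N" "Z \<noteq> {}"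
  obtains v where "v \<in> cone N Z"
proof -
  obtain P where P: "P \<in> Z" using assms(2) by blast
  then have "P \<in> proj_space N" using assms(1) by blast
  then obtain v where "v \<in> coord_space N" "v \<noteq> 0" "P = vspan {v}" by (rule proj_spaceE)
  then show ?thesis using that P unfolding cone_def by blast
qed

lemma cone_mono: "Z \<subseteq> Z' \<Longrightarrow> cone N Z \<subseteq> cone N Z'"
  unfolding cone_def by blast

lemma points_cone: "Z \<subseteq> proj_space N \<Longrightarrow> points (cone N Z) = Z"
  unfolding points_def cone_def by (auto elim!: proj_spaceE)

lemma separating_form:
  assumes "closedin (zariski N) Z" "closedin (zariski N) Z'" "Z \<subset> Z'"
  obtains F where "homogeneous N F" "\<forall>v\<in>cone N Z. poly_eval F v = 0" "\<exists>v\<in>cone N Z'. poly_eval F v \<noteq> 0"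
proof -
  have sub: "Z \<subseteq> proj_space N" "Z' \<subseteq> proj_space N"
    using assms(1,2) closedin_subset by fastforce+
  have "\<not> cone N Z' \<subseteq> cone N Z"
  proof
    assume "cone N Z' \<subseteq> cone N Z"
    then have "points (cone N Z') \<subseteq> points (cone N Z)" unfolding points_def by blast
    then show False using assms(3) points_cone sub by blast
  qed
  then obtain v where v: "v \<in> cone N Z'" "v \<notin> cone N Z" by blast
  then have "v \<in> coord_space N" "v \<noteq> 0" unfolding cone_def by blast+
  from closed_cone_iff[OF assms(1) this] v that show ?thesis by blast
qed

text \<open>Otherwise the zero loci of \<open>F\<close> and \<open>G\<close> would cut
  \<open>Z\<close> into two proper closed pieces. Irreducibility enters the counting of forms
  through this primality.\<close>

lemma irreducible_imp_prime:
  fixes F G :: "'k::field mpoly"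
  assumes Z: "closedin (zariski N) Z" "irreducible_space (subtopology (zariski N) Z)"
    and F: "homogeneous N F" and G: "homogeneous N G"
    and FG: "\<forall>v\<in>cone N Z. poly_eval F v * poly_eval G v = 0"
  shows "(\<forall>v\<in>cone N Z. poly_eval F v = 0) \<or> (\<forall>v\<in>cone N Z. poly_eval G v = 0)"
proof -
  have sub: "Z \<subseteq> proj_space N" using Z(1) closedin_subset by fastforce
  then have top: "topspace (subtopology (zariski N) Z) = Z" by (auto simp: topspace_subtopology)
  define A where "A H = Z \<inter> zero_locus N {H}" for H :: "'k mpoly"
  have closed: "closedin (subtopology (zariski N) Z) (A H)" if "homogeneous N H" for H
  proof -
    have "closedin (zariski N) (zero_locus N {H})" unfolding closedin_zariski using that by blast
    then show ?thesis unfolding A_def by (simp add: closedin_subtopology_Int_closed)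
  qed
  have mem: "vspan {v} \<in> A H \<longleftrightarrow> poly_eval H v = 0" if "homogeneous N H" "v \<in> cone N Z" for H v
    using that vspan_in_zero_locus[of "{H}" N v] unfolding A_def cone_def by simp
  have "A F \<union> A G = Z"
  proof
    show "Z \<subseteq> A F \<union> A G"
    proof
      fix P assume P: "P \<in> Z"
      then have "P \<in> proj_space N" using sub by blast
      then obtain v where v: "v \<in> coord_space N" "v \<noteq> 0" "P = vspan {v}" by (rule proj_spaceE)
      then have "v \<in> cone N Z" using P unfolding cone_def by blast
      then show "P \<in> A F \<union> A G" using FG mem F G v(3) by auto
    qed
  qed (auto simp: A_def)
  then have "A F = Z \<or> A G = Z"
    using Z(2) closed F G unfolding irreducible_space_def top by blast
  then show ?thesis
    using mem F G unfolding cone_def by blast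
qed

text \<open>The Hilbert function of \<open>W\<close> in degree \<open>d\<close> is at least
  \<open>M\<close>, phrased by independent restrictions so that no quotient ring has to be
  formed.\<close>

definition indep_forms :: "nat \<Rightarrow> (nat \<Rightarrow> 'k::field) set \<Rightarrow> nat \<Rightarrow> nat \<Rightarrow> bool" where
  "indep_forms N W d M \<longleftrightarrow> (\<exists>G. (\<forall>j<M. is_form N d (G j)) \<and>
     (\<forall>c. (\<forall>v\<in>W. (\<Sum>j<M. c j * poly_eval (G j) v) = 0) \<longrightarrow> (\<forall>j<M. c j = 0)))"

lemma indep_forms_1:
  assumes "is_form N d F" "v \<in> W" "poly_eval F v \<noteq> 0"
  shows "indep_forms N W d 1"
  unfolding indep_forms_def using assms by (intro exI[of _ "\<lambda>_. F"]) fastforce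

text \<open>A form vanishing on \<open>W\<close> vanishes on the closure, so restriction to the
  dense part loses no independence.\<close>

lemma indep_forms_closure:
  fixes W :: "(nat \<Rightarrow> 'k::field) set"
  assumes W: "W \<subseteq> coord_space N - {0}" and Z: "Z \<subseteq> zariski N closure_of points W"
    and "indep_forms N (cone N Z) d M"
  shows "indep_forms N W d M"
proof -
  obtain G where G: "\<forall>j<M. is_form N d (G j)"
    "\<And>c. (\<forall>v\<in>cone N Z. (\<Sum>j<M. c j * poly_eval (G j) v) = 0) \<Longrightarrow> \<forall>j<M. c j = 0"
    using assms(3) unfolding indep_forms_def by blast
  have "\<forall>j<M. c j = 0" if c: "\<forall>v\<in>W. (\<Sum>j<M. c j * poly_eval (G j) v) = 0" for c
  proof (rule G(2), rule ballI)
    fix v assume "v \<in> cone N Z"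
    then have v: "v \<in> coord_space N" "v \<noteq> 0" "vspan {v} \<in> zariski N closure_of points W"
      using Z unfolding cone_def by blast+
    define H where "H = (\<Sum>j<M. const_form (c j) * G j)"
    have "homogeneous N H"
      unfolding H_def using G(1) by (intro is_formD[of N d] is_form_lincomb) auto
    moreover have "\<forall>w\<in>W. poly_eval H w = 0"
      using c by (simp add: H_def poly_eval_lincomb)
    ultimately have "poly_eval H v = 0" using vspan_in_closure[OF W v(1,2)] v(3) by blast
    then show "(\<Sum>j<M. c j * poly_eval (G j) v) = 0" by (simp add: H_def poly_eval_lincomb)
  qed
  then show ?thesis using G(1) unfolding indep_forms_def by blast
qed

text \<open>
  If \<open>F\<close> vanishes on \<open>Y\<close> but not on the irreducible set \<open>Z\<close>, then the multiples of \<open>F\<close> are independent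
  modulo the lifts of forms on \<open>Y\<close>; iterating this along the chain gives a binomial coefficient.
\<close>

lemma indep_forms_step:
  fixes F :: "'k::field mpoly"
  assumes Z: "closedin (zariski N) Z" "irreducible_space (subtopology (zariski N) Z)" "Y \<subseteq> Z"
    and F: "is_form N f F" "\<forall>v\<in>cone N Y. poly_eval F v = 0" "\<exists>v\<in>cone N Z. poly_eval F v \<noteq> 0"
    and 1: "indep_forms N (cone N Y) (f + d) M1" and 2: "indep_forms N (cone N Z) d M2"
  shows "indep_forms N (cone N Z) (f + d) (M1 + M2)"
proof -
  obtain G1 where G1: "\<And>j. j < M1 \<Longrightarrow> is_form N (f + d) (G1 j)"
    "\<And>c. (\<forall>v\<in>cone N Y. (\<Sum>j<M1. c j * poly_eval (G1 j) v) = 0) \<Longrightarrow> \<forall>j<M1. c j = 0"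
    using 1 unfolding indep_forms_def by blast
  obtain G2 where G2: "\<And>j. j < M2 \<Longrightarrow> is_form N d (G2 j)"
    "\<And>c. (\<forall>v\<in>cone N Z. (\<Sum>j<M2. c j * poly_eval (G2 j) v) = 0) \<Longrightarrow> \<forall>j<M2. c j = 0"
    using 2 unfolding indep_forms_def by blast
  define G where "G j = (if j < M1 then G1 j else F * G2 (j - M1))" for j
  have split: "(\<Sum>j<M1 + M2. c j * poly_eval (G j) v) = (\<Sum>j<M1. c j * poly_eval (G1 j) v) +
      poly_eval F v * (\<Sum>j<M2. c (M1 + j) * poly_eval (G2 j) v)" for c v
  proof -
    have "(\<Sum>j<M1 + M2. c j * poly_eval (G j) v) =
        (\<Sum>j<M1. c j * poly_eval (G j) v) + (\<Sum>j<M2. c (M1 + j) * poly_eval (G (M1 + j)) v)"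
      using sum.atLeastLessThan_concat[of 0 M1 "M1 + M2" "\<lambda>j. c j * poly_eval (G j) v", symmetric]
        sum.shift_bounds_nat_ivl[of "\<lambda>j. c j * poly_eval (G j) v" 0 M1 M2]
      by (simp add: lessThan_atLeast0 add.commute)
    then show ?thesis
      by (simp add: G_def poly_eval_mult sum_distrib_left mult_ac)
  qed
  have "\<forall>j<M1 + M2. c j = 0" if c: "\<forall>v\<in>cone N Z. (\<Sum>j<M1 + M2. c j * poly_eval (G j) v) = 0" for c
  proof -
    \<comment> \<open>On \<open>Y\<close> the multiples of \<open>F\<close> drop out, which isolates
      the first family; afterwards \<open>F\<close> is cancelled by primality.\<close>
    have "\<forall>v\<in>cone N Y. (\<Sum>j<M1. c j * poly_eval (G1 j) v) = 0"
      using c F(2) cone_mono[OF Z(3), of N] unfolding split by fastforce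
    then have c1: "\<forall>j<M1. c j = 0" by (rule G1(2))
    define H where "H = (\<Sum>j<M2. const_form (c (M1 + j)) * G2 j)"
    have H: "homogeneous N H" "poly_eval H v = (\<Sum>j<M2. c (M1 + j) * poly_eval (G2 j) v)" for v
      unfolding H_def using G2(1) by (auto intro!: is_formD[of N d] is_form_lincomb simp: poly_eval_lincomb)
    have "\<forall>v\<in>cone N Z. poly_eval F v * poly_eval H v = 0"
      using c c1 unfolding split H(2) by simp
    then have "\<forall>v\<in>cone N Z. poly_eval H v = 0"
      using irreducible_imp_prime[OF Z(1,2) is_formD[OF F(1)] H(1)] F(3) by blast
    then have "\<forall>j<M2. c (M1 + j) = 0" unfolding H(2) by (rule G2(2))
    then show ?thesis using c1 by (metis add_diff_inverse_nat nat_add_left_cancel_less)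
  qed
  moreover have "is_form N (f + d) (G j)" if "j < M1 + M2" for j
    using that G1(1) is_form_mult[OF F(1) G2(1), of "j - M1"] by (simp add: G_def)
  ultimately show ?thesis unfolding indep_forms_def by blast
qed

text \<open>Double induction along Pascal's rule, with separating forms raised to a common degree
  \<open>f\<close>: in degree \<open>Suc e * f\<close> the set \<open>Z (Suc i)\<close> has the
  forms lifted from \<open>Z i\<close> and the multiples of forms of degree
  \<open>e * f\<close>.\<close>

lemma indep_forms_chain:
  fixes Z :: "nat \<Rightarrow> 'k::field point set"
  assumes Z: "\<And>i. i \<le> l \<Longrightarrow> closedin (zariski N) (Z i)"
      "\<And>i. i \<le> l \<Longrightarrow> irreducible_space (subtopology (zariski N) (Z i))"
    and strict: "\<And>i. i < l \<Longrightarrow> Z i \<subset> Z (Suc i)"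
  shows "\<exists>f\<ge>1. \<forall>e. indep_forms N (cone N (Z l)) (e * f) ((e + l) choose l)"
proof -
  have sub: "Z i \<subseteq> proj_space N" if "i \<le> l" for i
    using Z(1)[OF that] closedin_subset by fastforce
  have "Z 0 \<noteq> {}" using Z(2)[of 0] unfolding irreducible_space_def by auto
  then obtain v0 where v0: "v0 \<in> cone N (Z 0)" using cone_nonempty[OF sub[of 0]] by blast
  then obtain k where k: "v0 k \<noteq> 0" "k \<le> N"
    unfolding cone_def coord_space_def by (auto simp: fun_eq_iff) (metis not_le)
  have Zmono: "Z i \<subseteq> Z j" if "i \<le> j" "j \<le> l" for i j
    using that(1,2)
  proof (induction j rule: dec_induct)
    case (step j)
    then show ?case using strict[of j] by auto
  qed simp
  have v0_in: "v0 \<in> cone N (Z i)" if "i \<le> l" for i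
    using v0 cone_mono[OF Zmono[OF _ that, of 0]] by blast
  have "\<forall>i<l. \<exists>F d. is_form N d F \<and> (\<forall>v\<in>cone N (Z i). poly_eval F v = 0) \<and>
      (\<exists>v\<in>cone N (Z (Suc i)). poly_eval F v \<noteq> 0)"
  proof (intro allI impI)
    fix i assume i: "i < l"
    obtain F where "homogeneous N F" "\<forall>v\<in>cone N (Z i). poly_eval F v = 0"
      "\<exists>v\<in>cone N (Z (Suc i)). poly_eval F v \<noteq> 0"
      using separating_form[OF Z(1) Z(1) strict[OF i]] i by auto
    then show "\<exists>F d. is_form N d F \<and> (\<forall>v\<in>cone N (Z i). poly_eval F v = 0) \<and>
        (\<exists>v\<in>cone N (Z (Suc i)). poly_eval F v \<noteq> 0)"
      unfolding homogeneous_iff by blast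
  qed
  then obtain F d where F: "\<And>i. i < l \<Longrightarrow> is_form N (d i) (F i)"
    "\<And>i v. i < l \<Longrightarrow> v \<in> cone N (Z i) \<Longrightarrow> poly_eval (F i) v = 0"
    "\<And>i. i < l \<Longrightarrow> \<exists>v\<in>cone N (Z (Suc i)). poly_eval (F i) v \<noteq> 0"
    by metis
  \<comment> \<open>A form of degree 0 is constant, and \<open>F i\<close> vanishes at
    \<open>v0\<close>, which lies in all the cones; yet \<open>F i\<close> is not zero on the next
    one.\<close>
  have d: "d i \<noteq> 0" if i: "i < l" for i
  proof
    assume "d i = 0"
    have empty: "Poly_Mapping.keys m = {}" if "m \<in> Poly_Mapping.keys (F i)" for m
    proof -
      have "mono_degree m = 0" using F(1)[OF i] that \<open>d i = 0\<close> unfolding is_form_def by simp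
      then have "\<forall>x\<in>Poly_Mapping.keys m. Poly_Mapping.lookup m x = 0" by (simp add: mono_degree_def)
      then show ?thesis by (metis ex_in_conv in_keys_iff)
    qed
    have "mono_eval m v = 1" if "m \<in> Poly_Mapping.keys (F i)" for m and v :: "nat \<Rightarrow> 'k"
      unfolding mono_eval_def empty[OF that] by simp
    then have "poly_eval (F i) v = poly_eval (F i) v0" for v
      unfolding poly_eval_def by (intro sum.cong refl) simp
    moreover have "poly_eval (F i) v0 = 0" using F(2)[OF i] v0_in[of i] i by simp
    ultimately show False using F(3)[OF i] by auto
  qed
  define f where "f = (\<Prod>i<l. d i)"
  have f: "f \<ge> 1" using d by (auto simp: f_def Suc_le_eq intro!: prod_pos)
  define H where "H i = F i ^ (f div d i)" for i
  have H: "is_form N f (H i)" "\<forall>v\<in>cone N (Z i). poly_eval (H i) v = 0"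
    "\<exists>v\<in>cone N (Z (Suc i)). poly_eval (H i) v \<noteq> 0" if i: "i < l" for i
  proof -
    have dvd: "d i dvd f" unfolding f_def using i by (intro dvd_prodI) auto
    then show "is_form N f (H i)" using is_form_power[OF F(1)[OF i], of "f div d i"] by (simp add: H_def)
    have "f div d i > 0" using dvd f d[OF i] by (auto simp: dvd_div_eq_0_iff)
    then show "\<forall>v\<in>cone N (Z i). poly_eval (H i) v = 0"
      using F(2)[OF i] by (simp add: H_def poly_eval_power)
    show "\<exists>v\<in>cone N (Z (Suc i)). poly_eval (H i) v \<noteq> 0"
      using F(3)[OF i] by (auto simp: H_def poly_eval_power)
  qed
  \<comment> \<open>The base of both inductions: a power of a coordinate that does not vanish at
    \<open>v0\<close>.\<close>
  have one: "indep_forms N (cone N (Z i)) (e * f) 1" if "i \<le> l" for i e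
  proof (rule indep_forms_1[OF _ v0_in[OF that]])
    show "is_form N (e * f) (coord_form k ^ (e * f))"
      using is_form_power[OF is_form_coord[OF k(2)], of "e * f"] by simp
    show "poly_eval (coord_form k ^ (e * f)) v0 \<noteq> 0"
      using k by (simp add: poly_eval_power)
  qed
  have "indep_forms N (cone N (Z i)) (e * f) ((e + i) choose i)" if "i \<le> l" for i e
    using that
  proof (induction i arbitrary: e)
    case 0
    then show ?case using one by simp
  next
    case (Suc i)
    show ?case
    proof (induction e)
      case 0
      then show ?case using one[OF Suc.prems, of 0] by simp
    next
      case (Suc e)
      have i: "i < l" using Suc.prems \<open>Suc i \<le> l\<close> by simp
      have "indep_forms N (cone N (Z (Suc i))) (f + e * f) (((Suc e + i) choose i) + ((e + Suc i) choose Suc i))"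
      proof (rule indep_forms_step[OF Z(1) Z(2) _ H(1)[OF i] H(2)[OF i] H(3)[OF i]])
        show "indep_forms N (cone N (Z i)) (f + e * f) ((Suc e + i) choose i)"
          using \<open>\<And>e. i \<le> l \<Longrightarrow> indep_forms N (cone N (Z i)) (e * f) ((e + i) choose i)\<close>[of "Suc e"] i by simp
      qed (use i Suc strict[OF i] in auto)
      then show ?case by simp
    qed
  qed
  then show ?thesis using f by blast
qed

lemma power_le_fact_choose: "(e + 1) ^ l \<le> fact l * ((e + l) choose l)"
proof (induction l)
  case (Suc l)
  have "(e + 1) ^ Suc l \<le> (e + 1) * (fact l * ((e + l) choose l))"
    unfolding power_Suc using Suc by (rule mult_le_mono2)
  also have "\<dots> \<le> (e + l + 1) * (fact l * ((e + l) choose l))" by (intro mult_right_mono) auto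
  also have "\<dots> = fact l * (Suc (e + l) * ((e + l) choose l))" by (simp add: algebra_simps)
  also have "Suc (e + l) * ((e + l) choose l) = (Suc (e + l) choose Suc l) * Suc l"
    by (rule Suc_times_binomial_eq)
  finally show ?case by (simp add: algebra_simps)
qed simp

text \<open>A chain longer than \<open>q\<close> forces at least order \<open>e ^ (q + 1)\<close>
  independent forms in degree \<open>e * f\<close>, while the bound allows only order
  \<open>e ^ q\<close>.\<close>

lemma chain_length_le:
  fixes W :: "(nat \<Rightarrow> 'k::field) set"
  assumes W: "W \<subseteq> coord_space N - {0}"
    and bound: "\<And>d M. indep_forms N W d M \<Longrightarrow> M \<le> K * (d + 1) ^ q"
    and Z: "\<And>i. i \<le> l \<Longrightarrow> closedin (zariski N) (Z i)"
      "\<And>i. i \<le> l \<Longrightarrow> irreducible_space (subtopology (zariski N) (Z i))"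
      "\<And>i. i < l \<Longrightarrow> Z i \<subset> Z (Suc i)" "Z l \<subseteq> zariski N closure_of points W"
  shows "l \<le> q"
proof (rule ccontr)
  assume "\<not> l \<le> q"
  then have "Suc q \<le> l" by simp
  obtain f where f: "f \<ge> 1" "\<And>e. indep_forms N (cone N (Z l)) (e * f) ((e + l) choose l)"
    using indep_forms_chain[of l N Z] Z(1-3) by blast
  have "e + 1 \<le> fact l * K * f ^ q" for e
  proof -
    have "(e + 1) ^ Suc q \<le> (e + 1) ^ l" using \<open>Suc q \<le> l\<close> by (intro power_increasing) auto
    also have "\<dots> \<le> fact l * ((e + l) choose l)" by (rule power_le_fact_choose)
    also have "\<dots> \<le> fact l * (K * (e * f + 1) ^ q)"
      by (intro mult_left_mono bound indep_forms_closure[OF W Z(4)] f) auto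
    also have "\<dots> \<le> fact l * (K * ((e + 1) * f) ^ q)"
      using f(1) by (intro mult_left_mono power_mono) (auto simp: algebra_simps)
    also have "\<dots> = (fact l * K * f ^ q) * (e + 1) ^ q"
      by (simp only: power_mult_distrib mult_ac)
    finally have "(e + 1) * (e + 1) ^ q \<le> (fact l * K * f ^ q) * (e + 1) ^ q"
      by (simp only: power_Suc)
    then show ?thesis unfolding mult_le_cancel2 by simp
  qed
  \<comment> \<open>The alleged bound itself, inserted for \<open>e\<close>, violates the
    inequality.\<close>
  from this[of "fact l * K * f ^ q"] show False by simp
qed

lemma subtopology_closed:
  assumes "closedin X Y" "closedin (subtopology X Y) Z"
  shows "closedin X Z" "Z \<subseteq> Y" "subtopology (subtopology X Y) Z = subtopology X Z"
proof -
  show "closedin X Z" using assms closedin_trans_full by blast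
  show "Z \<subseteq> Y" using assms by (meson closedin_closed_subtopology)
  then show "subtopology (subtopology X Y) Z = subtopology X Z"
    by (simp add: subtopology_subtopology Int_absorb1)
qed

lemma proj_dim_le:
  fixes W :: "(nat \<Rightarrow> 'k::field) set"
  assumes W: "W \<subseteq> coord_space N - {0}"
    and bound: "\<And>d M. indep_forms N W d M \<Longrightarrow> M \<le> K * (d + 1) ^ q"
  shows "proj_dim N (zariski N closure_of points W) \<le> enat q"
  unfolding proj_dim_def krull_dim_def
proof (rule Sup_least, elim CollectE exE conjE)
  let ?Y = "zariski N closure_of points W"
  fix x l and Z :: "nat \<Rightarrow> 'k point set"
  assume x: "x = enat l" and Z: "\<forall>i\<le>l. closedin (subtopology (zariski N) ?Y) (Z i) \<and>
      irreducible_space (subtopology (subtopology (zariski N) ?Y) (Z i))" "\<forall>i<l. Z i \<subset> Z (Suc i)"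
  have Y: "closedin (zariski N) ?Y" by simp
  have "l \<le> q"
    by (rule chain_length_le[OF W bound, where Z = Z])
      (use Z subtopology_closed[OF Y] in auto)
  then show "x \<le> enat q" by (simp add: x)
qed

section \<open>Upper bounds for Hilbert functions\<close>

definition fscale :: "'k::field \<Rightarrow> ('x \<Rightarrow> 'k) \<Rightarrow> 'x \<Rightarrow> 'k" where
  "fscale c g = (\<lambda>x. c * g x)"

lemma fscale_apply: "fscale c g x = c * g x"
  by (simp add: fscale_def)

global_interpretation funs: vector_space fscale
  by unfold_locales (auto simp: fscale_def fun_eq_iff algebra_simps)

lemma sum_fun_apply: "(\<Sum>i\<in>A. g i) x = (\<Sum>i\<in>A. g i x)" for g :: "'i \<Rightarrow> 'x \<Rightarrow> 'k::comm_monoid_add"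
  by (induction A rule: infinite_finite_induct) auto

lemma funs_span_sum:
  "(\<And>i. i \<in> A \<Longrightarrow> g i \<in> funs.span B) \<Longrightarrow> (\<lambda>x. \<Sum>i\<in>A. g i x) \<in> funs.span B"
  using funs.span_sum[of A g B] by (simp add: sum_fun_apply[abs_def, symmetric] flip: sum_fun_apply)

lemma funs_span_cmult: "g \<in> funs.span B \<Longrightarrow> (\<lambda>x. c * g x) \<in> funs.span B"
  using funs.span_scale[of g B c] by (simp add: fscale_def)

lemma funs_span_add: "g \<in> funs.span B \<Longrightarrow> h \<in> funs.span B \<Longrightarrow> (\<lambda>x. g x + h x) \<in> funs.span B"
  using funs.span_add[of g B h] by (simp add: plus_fun_def)

lemma funs_span_zero: "(\<lambda>x. 0) \<in> funs.span B"
  using funs.span_zero[of B] by (simp add: zero_fun_def)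

text \<open>Independence on the image of \<Phi> makes the pulled-back functions linearly
  independent, and they lie in a space spanned by \<open>B\<close>.\<close>

lemma indep_forms_le_card:
  fixes \<Phi> :: "'x \<Rightarrow> nat \<Rightarrow> 'k::field"
  assumes B: "finite B" "\<And>F. is_form N d F \<Longrightarrow> (\<lambda>x. poly_eval F (\<Phi> x)) \<in> funs.span B"
    and W: "W \<subseteq> range \<Phi>" and "indep_forms N W d M"
  shows "M \<le> card B"
proof -
  obtain G where G: "\<And>j. j < M \<Longrightarrow> is_form N d (G j)"
    "\<And>c. (\<forall>v\<in>W. (\<Sum>j<M. c j * poly_eval (G j) v) = 0) \<Longrightarrow> \<forall>j<M. c j = 0"
    using assms(4) unfolding indep_forms_def by blast
  define g where "g j = (\<lambda>x. poly_eval (G j) (\<Phi> x))" for j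
  have indep: "\<forall>j<M. c j = 0" if "\<And>x. (\<Sum>j<M. c j * g j x) = 0" for c
    using that W by (intro G(2)) (auto simp: g_def)
  \<comment> \<open>Two equal functions would be a nontrivial relation; injectivity lets
    independence of the family pass to independence of the set.\<close>
  have inj: "inj_on g {..<M}"
  proof (rule inj_onI, rule ccontr)
    fix i j assume ij: "i \<in> {..<M}" "j \<in> {..<M}" "g i = g j" "i \<noteq> j"
    have "(\<Sum>l<M. (of_bool (l = i) - of_bool (l = j)) * g l x) = g i x - g j x" for x
      using ij by (simp add: left_diff_distrib sum_subtractf of_bool_def if_distrib[of "\<lambda>c. c * _"] cong: if_cong)
    then have "\<forall>l<M. (of_bool (l = i) - of_bool (l = j) :: 'k) = 0"
      by (intro indep) (simp add: ij(3))
    then show False using ij by auto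
  qed
  have "funs.independent (g ` {..<M})"
  proof (rule funs.independent_if_scalars_zero)
    fix f h assume sum: "(\<Sum>x\<in>g ` {..<M}. fscale (f x) x) = 0" and h: "h \<in> g ` {..<M}"
    have "(\<Sum>j<M. f (g j) * g j x) = 0" for x
    proof -
      have "(\<Sum>j<M. f (g j) * g j x) = (\<Sum>j<M. fscale (f (g j)) (g j)) x"
        by (simp add: sum_fun_apply fscale_def)
      also have "(\<Sum>j<M. fscale (f (g j)) (g j)) = 0"
        using sum by (simp add: sum.reindex[OF inj])
      finally show ?thesis by simp
    qed
    then show "f h = 0" using indep[of "\<lambda>j. f (g j)"] h by auto
  qed simp
  moreover have "g ` {..<M} \<subseteq> funs.span B" using B(2) G(1) by (auto simp: g_def)
  ultimately have "card (g ` {..<M}) \<le> card B"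
    using funs.independent_span_bound[OF B(1)] by blast
  then show ?thesis by (simp add: card_image[OF inj])
qed

text \<open>A multiplicative family of spanning sets. Once the coordinates pull back into the span
  of \<open>B 1\<close>, every form of degree \<open>d\<close> pulls back into the span of
  \<open>B d\<close>, so each Hilbert function bound reduces to counting \<open>B d\<close>.\<close>

locale graded_functions =
  fixes B :: "nat \<Rightarrow> ('x \<Rightarrow> 'k::field) set"
  assumes one: "(\<lambda>_. 1) \<in> B 0"
    and mult: "\<And>d e g h. g \<in> B d \<Longrightarrow> h \<in> B e \<Longrightarrow> (\<lambda>x. g x * h x) \<in> B (d + e)"
begin

lemma span_mult:
  assumes "g \<in> funs.span (B d)" "h \<in> funs.span (B e)"
  shows "(\<lambda>x. g x * h x) \<in> funs.span (B (d + e))"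
proof -
  have 1: "(\<lambda>x. g x * h x) \<in> funs.span (B (d + e))" if "h \<in> B e" for h
    using assms(1)
  proof (induction rule: funs.span_induct_alt)
    case base
    then show ?case by (simp add: funs_span_zero)
  next
    case (step c u v)
    have "(\<lambda>x. c * (u x * h x) + v x * h x) \<in> funs.span (B (d + e))"
      by (intro funs_span_add funs_span_cmult) (use step that in \<open>auto intro: funs.span_base mult\<close>)
    moreover have "(\<lambda>x. (fscale c u + v) x * h x) = (\<lambda>x. c * (u x * h x) + v x * h x)"
      by (simp add: fun_eq_iff fscale_apply algebra_simps)
    ultimately show ?case by (simp only:)
  qed
  show ?thesis
    using assms(2)
  proof (induction rule: funs.span_induct_alt)
    case base
    then show ?case by (simp add: funs_span_zero)
  next
    case (step c u v)
    have "(\<lambda>x. c * (g x * u x) + g x * v x) \<in> funs.span (B (d + e))"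
      by (intro funs_span_add funs_span_cmult) (use step 1 in auto)
    moreover have "(\<lambda>x. g x * (fscale c u + v) x) = (\<lambda>x. c * (g x * u x) + g x * v x)"
      by (simp add: fun_eq_iff fscale_apply algebra_simps)
    ultimately show ?case by (simp only:)
  qed
qed

lemma span_prod:
  assumes "\<And>i. i \<in> A \<Longrightarrow> g i \<in> funs.span (B (e i))"
  shows "(\<lambda>x. \<Prod>i\<in>A. g i x) \<in> funs.span (B (\<Sum>i\<in>A. e i))"
  using assms
proof (induction A rule: infinite_finite_induct)
  case (insert i A)
  then show ?case using span_mult[of "g i" "e i" "\<lambda>x. \<Prod>i\<in>A. g i x"] by simp
qed (simp_all add: one funs.span_base)

lemma span_power: "g \<in> funs.span (B d) \<Longrightarrow> (\<lambda>x. g x ^ m) \<in> funs.span (B (m * d))"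
  using span_prod[of "{..<m}" "\<lambda>_. g" "\<lambda>_. d"] by simp

lemma form_in_span:
  assumes coord: "\<And>k. k \<le> N \<Longrightarrow> (\<lambda>x. \<Phi> x k) \<in> funs.span (B 1)" and F: "is_form N d F"
  shows "(\<lambda>x. poly_eval F (\<Phi> x)) \<in> funs.span (B d)"
  unfolding poly_eval_def
proof (intro funs_span_sum funs_span_cmult)
  fix m assume m: "m \<in> Poly_Mapping.keys F"
  then have keys: "Poly_Mapping.keys m \<subseteq> {..N}" and deg: "mono_degree m = d"
    using F unfolding is_form_def by blast+
  have "(\<lambda>x. \<Prod>i\<in>Poly_Mapping.keys m. \<Phi> x i ^ Poly_Mapping.lookup m i)
      \<in> funs.span (B (\<Sum>i\<in>Poly_Mapping.keys m. Poly_Mapping.lookup m i))"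
  proof (rule span_prod)
    fix i assume "i \<in> Poly_Mapping.keys m"
    then have "i \<le> N" using keys by auto
    from span_power[OF coord[OF this], of "Poly_Mapping.lookup m i"]
    show "(\<lambda>x. \<Phi> x i ^ Poly_Mapping.lookup m i) \<in> funs.span (B (Poly_Mapping.lookup m i))" by simp
  qed
  then show "(\<lambda>x. mono_eval m (\<Phi> x)) \<in> funs.span (B d)"
    using deg by (simp add: mono_eval_def mono_degree_def)
qed

end

lemma card_image_PiE_le:
  assumes "finite I" "S \<subseteq> f ` (PiE I (\<lambda>_. {..d::nat}))"
  shows "finite S \<and> card S \<le> (d + 1) ^ card I"
proof -
  have fin: "finite (PiE I (\<lambda>_. {..d}))" using assms(1) by (simp add: finite_PiE)
  have "card S \<le> card (f ` (PiE I (\<lambda>_. {..d})))"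
    using fin by (intro card_mono assms(2)) auto
  also have "\<dots> \<le> card (PiE I (\<lambda>_. {..d}))" by (rule card_image_le[OF fin])
  also have "\<dots> = (d + 1) ^ card I" by (simp add: card_PiE[OF assms(1)])
  finally show ?thesis using finite_subset[OF assms(2)] fin by blast
qed

section \<open>Counting monomials in the ambient coordinates and in configurations\<close>

definition monomials :: "nat \<Rightarrow> nat \<Rightarrow> ((nat \<Rightarrow> 'k::field) \<Rightarrow> 'k) set" where
  "monomials N d = {\<lambda>v. \<Prod>k\<le>N. v k ^ \<beta> k |\<beta>. (\<Sum>k\<le>N. \<beta> k) = d}"

interpretation monomials: graded_functions "monomials N"
proof
  show "(\<lambda>_. 1) \<in> monomials N 0"
    unfolding monomials_def by (intro CollectI exI[of _ "\<lambda>_. 0"]) auto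
  fix d e and g h :: "(nat \<Rightarrow> 'a) \<Rightarrow> 'a"
  assume "g \<in> monomials N d" "h \<in> monomials N e"
  then obtain \<beta> \<gamma> where "g = (\<lambda>v. \<Prod>k\<le>N. v k ^ \<beta> k)" "(\<Sum>k\<le>N. \<beta> k) = d"
    "h = (\<lambda>v. \<Prod>k\<le>N. v k ^ \<gamma> k)" "(\<Sum>k\<le>N. \<gamma> k) = e"
    unfolding monomials_def by blast
  then show "(\<lambda>x. g x * h x) \<in> monomials N (d + e)"
    unfolding monomials_def
    by (intro CollectI exI[of _ "\<lambda>k. \<beta> k + \<gamma> k"]) (auto simp: power_add prod.distrib sum.distrib)
qed

lemma coord_in_monomials:
  assumes "k \<le> N"
  shows "(\<lambda>v. v k) \<in> monomials N 1"
proof -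
  have "(\<Prod>i\<le>N. v i ^ of_bool (i = k)) = v k" for v :: "nat \<Rightarrow> 'a"
  proof -
    have "(\<Prod>i\<le>N. v i ^ of_bool (i = k)) = (\<Prod>i\<le>N. if i = k then v i else 1)"
      by (intro prod.cong) auto
    then show ?thesis using assms by simp
  qed
  moreover have "(\<Sum>i\<le>N. of_bool (i = k)) = (1::nat)"
    using assms by (simp add: of_bool_def)
  ultimately show ?thesis unfolding monomials_def by (intro CollectI exI[of _ "\<lambda>i. of_bool (i = k)"]) auto
qed

text \<open>Of the \<open>N + 1\<close> exponents only \<open>N\<close> are free, as the degree
  fixes the last one.\<close>

lemma card_monomials:
  "finite (monomials N d :: ((nat \<Rightarrow> 'a::field) \<Rightarrow> 'a) set) \<and>
    card (monomials N d :: ((nat \<Rightarrow> 'a) \<Rightarrow> 'a) set) \<le> (d + 1) ^ N"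
proof -
  have "(monomials N d :: ((nat \<Rightarrow> 'a) \<Rightarrow> 'a) set) \<subseteq> (\<lambda>\<beta> v. (\<Prod>k<N. v k ^ \<beta> k) * v N ^ (d - (\<Sum>k<N. \<beta> k))) ` (PiE {..<N} (\<lambda>_. {..d}))"
  proof
    fix g :: "(nat \<Rightarrow> 'a) \<Rightarrow> 'a" assume "g \<in> monomials N d"
    then obtain \<beta> where \<beta>: "g = (\<lambda>v. \<Prod>k\<le>N. v k ^ \<beta> k)" "(\<Sum>k\<le>N. \<beta> k) = d"
      unfolding monomials_def by blast
    have s: "(\<Sum>k<N. \<beta> k) + \<beta> N = d" using \<beta>(2) by (simp flip: lessThan_Suc_atMost)
    have "\<beta> k \<le> d" if "k < N" for k
      using member_le_sum[of k "{..<N}" \<beta>] that s by simp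
    then have "restrict \<beta> {..<N} \<in> PiE {..<N} (\<lambda>_. {..d})" by auto
    moreover have "g = (\<lambda>v. (\<Prod>k<N. v k ^ restrict \<beta> {..<N} k) * v N ^ (d - (\<Sum>k<N. restrict \<beta> {..<N} k)))"
      using s[symmetric] unfolding \<beta>(1) by (simp flip: lessThan_Suc_atMost)
    ultimately show "g \<in> (\<lambda>\<beta> v. (\<Prod>k<N. v k ^ \<beta> k) * v N ^ (d - (\<Sum>k<N. \<beta> k))) ` (PiE {..<N} (\<lambda>_. {..d}))"
      by blast
  qed
  from card_image_PiE_le[OF _ this] show ?thesis by simp
qed

lemma indep_forms_ambient: "indep_forms N W d M \<Longrightarrow> M \<le> 1 * (d + 1) ^ N"
  for W :: "(nat \<Rightarrow> 'k::field) set"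
proof -
  assume *: "indep_forms N W d M"
  have "M \<le> card (monomials N d :: ((nat \<Rightarrow> 'k) \<Rightarrow> 'k) set)"
  proof (rule indep_forms_le_card[where \<Phi> = "\<lambda>v. v", OF _ _ _ *])
    show "(\<lambda>v. poly_eval F v) \<in> funs.span (monomials N d)" if "is_form N d F" for F :: "'k mpoly"
      by (rule monomials.form_in_span[OF _ that]) (intro funs.span_base coord_in_monomials)
  qed (use card_monomials in auto)
  also have "\<dots> \<le> (d + 1) ^ N" using card_monomials by blast
  finally show ?thesis by simp
qed

text \<open>The sum carries no coefficients because a scalar can be absorbed into one factor of a
  tuple; see \<open>segre_vector_absorb_scalar\<close>.\<close>

definition segre_sum :: "nat \<Rightarrow> nat \<Rightarrow> 'k::field config \<Rightarrow> nat \<Rightarrow> 'k" where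
  "segre_sum n s P = (\<lambda>k. \<Sum>j<s. segre_vector n (P j) k)"

text \<open>Pulled back to \<open>s\<close> tuples, a form of degree \<open>d\<close> consists of
  monomials with the same degree \<open>D j\<close> in all pairs \<open>P j i\<close>, and the
  \<open>D j\<close> add up to \<open>d\<close>. This leaves \<open>s - 1\<close> free degrees and
  \<open>s * n\<close> free exponents, which is the expected dimension
  \<open>s * (n + 1) - 1\<close>.\<close>

definition multi_monomials ::
    "nat \<Rightarrow> nat \<Rightarrow> nat \<Rightarrow> ('k::field config \<Rightarrow> 'k) set" where
  "multi_monomials n s d = {\<lambda>P. \<Prod>j<s. \<Prod>i<n. P j i 0 ^ e j i * P j i 1 ^ (D j - e j i) |D e.
     (\<Sum>j<s. D j) = d \<and> (\<forall>j<s. \<forall>i<n. e j i \<le> D j)}"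

interpretation multi_monomials: graded_functions "multi_monomials n s"
proof
  show "(\<lambda>_. 1) \<in> multi_monomials n s 0"
    unfolding multi_monomials_def by (intro CollectI exI[of _ "\<lambda>_. 0"] exI[of _ "\<lambda>_ _. 0"]) auto
  fix d d' and g h :: "(nat \<Rightarrow> nat \<Rightarrow> nat \<Rightarrow> 'a) \<Rightarrow> 'a"
  assume "g \<in> multi_monomials n s d" "h \<in> multi_monomials n s d'"
  then obtain D e D' e' where
    g: "g = (\<lambda>P. \<Prod>j<s. \<Prod>i<n. P j i 0 ^ e j i * P j i 1 ^ (D j - e j i))" and
    h: "h = (\<lambda>P. \<Prod>j<s. \<Prod>i<n. P j i 0 ^ e' j i * P j i 1 ^ (D' j - e' j i))" and
    D: "(\<Sum>j<s. D j) = d" "\<forall>j<s. \<forall>i<n. e j i \<le> D j" "(\<Sum>j<s. D' j) = d'" "\<forall>j<s. \<forall>i<n. e' j i \<le> D' j"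
    unfolding multi_monomials_def by blast
  have "(\<lambda>P. g P * h P) =
      (\<lambda>P. \<Prod>j<s. \<Prod>i<n. P j i 0 ^ (e j i + e' j i) * P j i 1 ^ (D j + D' j - (e j i + e' j i)))"
  proof
    fix P :: "nat \<Rightarrow> nat \<Rightarrow> nat \<Rightarrow> 'a"
    have "P j i 0 ^ (e j i + e' j i) * P j i 1 ^ (D j + D' j - (e j i + e' j i)) =
        P j i 0 ^ e j i * P j i 1 ^ (D j - e j i) * (P j i 0 ^ e' j i * P j i 1 ^ (D' j - e' j i))"
      if "j < s" "i < n" for j i
    proof -
      have *: "D j + D' j - (e j i + e' j i) = (D j - e j i) + (D' j - e' j i)" using D(2,4) that by simp
      show ?thesis unfolding * power_add by (simp only: mult_ac)
    qed
    then show "g P * h P =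
        (\<Prod>j<s. \<Prod>i<n. P j i 0 ^ (e j i + e' j i) * P j i 1 ^ (D j + D' j - (e j i + e' j i)))"
      unfolding g h by (simp add: prod.distrib[symmetric])
  qed
  moreover have "(\<Sum>j<s. D j + D' j) = d + d'" using D by (simp add: sum.distrib)
  moreover have "\<forall>j<s. \<forall>i<n. e j i + e' j i \<le> D j + D' j" using D(2,4) by (simp add: add_mono)
  ultimately show "(\<lambda>P. g P * h P) \<in> multi_monomials n s (d + d')"
    unfolding multi_monomials_def
    by (intro CollectI exI[of _ "\<lambda>j. D j + D' j"] exI[of _ "\<lambda>j i. e j i + e' j i"]) simp
qed

lemma segre_sum_in_multi_monomials:
  "(\<lambda>P :: nat \<Rightarrow> nat \<Rightarrow> nat \<Rightarrow> 'a::field. segre_sum n s P k) \<in> funs.span (multi_monomials n s 1)"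
proof (cases "k < 2 ^ n")
  case True
  have "(\<lambda>P :: nat \<Rightarrow> nat \<Rightarrow> nat \<Rightarrow> 'a. segre_vector n (P j) k) \<in> multi_monomials n s 1" if j: "j < s" for j
  proof -
    define e where "e j' i = (of_bool (j' = j \<and> \<not> bit k i) :: nat)" for j' i
    define D where "D j' = (of_bool (j' = j) :: nat)" for j'
    have eq: "(\<Prod>j'<s. \<Prod>i<n. P j' i 0 ^ e j' i * P j' i 1 ^ (D j' - e j' i)) = segre_vector n (P j) k"
      for P :: "nat \<Rightarrow> nat \<Rightarrow> nat \<Rightarrow> 'a"
    proof -
      have "(\<Prod>i<n. P j' i 0 ^ e j' i * P j' i 1 ^ (D j' - e j' i)) =
          (if j' = j then segre_vector n (P j') k else 1)" for j'
      proof (cases "j' = j")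
        case j': True
        have "P j i 0 ^ e j i * P j i 1 ^ (D j - e j i) = P j i (of_bool (bit k i))" for i
          by (auto simp: e_def D_def)
        then show ?thesis using j' True by (simp add: segre_vector_def)
      qed (simp add: e_def D_def)
      then show ?thesis using j by simp
    qed
    have "(\<Sum>j'<s. D j') = 1" using j by (simp add: D_def of_bool_def)
    moreover have "\<forall>j'<s. \<forall>i<n. e j' i \<le> D j'" by (simp add: e_def D_def)
    ultimately show ?thesis
      unfolding multi_monomials_def eq[symmetric] by blast
  qed
  then show ?thesis
    unfolding segre_sum_def by (intro funs_span_sum funs.span_base) auto
next
  case False
  then show ?thesis by (simp add: segre_sum_def segre_vector_def funs_span_zero)
qed

lemma card_multi_monomials:
  assumes "1 \<le> s"
  shows "finite (multi_monomials n s d :: ('k::field config \<Rightarrow> 'k) set) \<and>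
    card (multi_monomials n s d :: ('k config \<Rightarrow> 'k) set) \<le> (d + 1) ^ (s * (n + 1) - 1)"
proof -
  let ?I = "Inl ` {..<s - 1} \<union> Inr ` ({..<s} \<times> {..<n}) :: (nat + nat \<times> nat) set"
  define mon :: "(nat + nat \<times> nat \<Rightarrow> nat) \<Rightarrow> 'k config \<Rightarrow> 'k" where
    "mon x = (\<lambda>P. \<Prod>j<s. \<Prod>i<n. P j i 0 ^ x (Inr (j, i)) *
       P j i 1 ^ ((if j < s - 1 then x (Inl j) else d - (\<Sum>j<s - 1. x (Inl j))) - x (Inr (j, i))))" for x
  have "multi_monomials n s d \<subseteq> mon ` (PiE ?I (\<lambda>_. {..d}))"
  proof
    fix g :: "'k config \<Rightarrow> 'k" assume "g \<in> multi_monomials n s d"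
    then obtain D e where g: "g = (\<lambda>P. \<Prod>j<s. \<Prod>i<n. P j i 0 ^ e j i * P j i 1 ^ (D j - e j i))" and
      D: "(\<Sum>j<s. D j) = d" "\<forall>j<s. \<forall>i<n. e j i \<le> D j"
      unfolding multi_monomials_def by blast
    define x where "x = restrict (case_sum D (\<lambda>(j, i). e j i)) ?I"
    have Dd: "D j \<le> d" if "j < s" for j
      using member_le_sum[of j "{..<s}" D] that D(1) by simp
    have "x \<in> PiE ?I (\<lambda>_. {..d})"
      unfolding x_def restrict_PiE_iff
    proof
      fix z assume "z \<in> ?I"
      then consider j where "z = Inl j" "j < s - 1" | j i where "z = Inr (j, i)" "j < s" "i < n" by auto
      then show "case_sum D (\<lambda>(j, i). e j i) z \<in> {..d}"
      proof cases
        case (2 j i)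
        then show ?thesis using D(2) Dd[of j] order_trans[of "e j i" "D j" d] by simp
      qed (use Dd in auto)
    qed
    moreover have "g = mon x"
    proof -
      have xl: "x (Inl j) = D j" if "j < s - 1" for j using that by (simp add: x_def)
      have xr: "x (Inr (j, i)) = e j i" if "j < s" "i < n" for j i using that by (auto simp: x_def)
      obtain s' where s': "s = Suc s'" using assms by (cases s) auto
      have "(if j < s - 1 then x (Inl j) else d - (\<Sum>j<s - 1. x (Inl j))) = D j" if "j < s" for j
        using that xl D(1)[symmetric] by (auto simp: s' less_Suc_eq)
      then show ?thesis unfolding g mon_def using xr by (intro ext prod.cong refl) auto
    qed
    ultimately show "g \<in> mon ` (PiE ?I (\<lambda>_. {..d}))" by blast
  qed
  moreover have "card ?I = s * (n + 1) - 1"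
  proof -
    have "card ?I = card (Inl ` {..<s - 1} :: (nat + nat \<times> nat) set) +
        card (Inr ` ({..<s} \<times> {..<n}) :: (nat + nat \<times> nat) set)"
      by (intro card_Un_disjoint) auto
    also have "\<dots> = (s - 1) + s * n" by (simp add: card_image)
    finally show ?thesis using assms by simp
  qed
  moreover have "finite ?I" by simp
  ultimately show ?thesis using card_image_PiE_le[of ?I "multi_monomials n s d" mon d] by (simp only:)
qed

lemma indep_forms_segre_sum:
  fixes W :: "(nat \<Rightarrow> 'k::field) set"
  assumes "1 \<le> s" "W \<subseteq> range (segre_sum n s)" "indep_forms N W d M"
  shows "M \<le> 1 * (d + 1) ^ (s * (n + 1) - 1)"
proof -
  have "M \<le> card (multi_monomials n s d :: ('k config \<Rightarrow> 'k) set)"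
  proof (rule indep_forms_le_card[where \<Phi> = "segre_sum n s", OF _ _ assms(2,3)])
    show "(\<lambda>P. poly_eval F (segre_sum n s P)) \<in> funs.span (multi_monomials n s d)"
      if "is_form N d F" for F :: "'k mpoly"
      by (rule multi_monomials.form_in_span[OF _ that]) (rule segre_sum_in_multi_monomials)
  qed (use card_multi_monomials[OF assms(1)] in blast)
  also have "\<dots> \<le> (d + 1) ^ (s * (n + 1) - 1)" using card_multi_monomials[OF assms(1)] by blast
  finally show ?thesis by simp
qed

section \<open>Secant varieties as closures of images\<close>

text \<open>The set \<open>C\<close> is everything for the secant variety itself and an affine
  subspace for a member of the chain that bounds its dimension from below.\<close>

definition secant_cone :: "nat \<Rightarrow> nat \<Rightarrow> 'k::field config set \<Rightarrow> (nat \<Rightarrow> 'k) set" where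
  "secant_cone n s C = segre_sum n s ` C - {0}"

lemma segre_vector_in_coord_space: "segre_vector n a \<in> coord_space (2 ^ n - 1)"
  by (auto simp: coord_space_def segre_vector_def)

lemma segre_sum_in_coord_space: "segre_sum n s P \<in> coord_space (2 ^ n - 1)"
  using segre_vector_in_coord_space unfolding segre_sum_def coord_space_def
  by (auto intro!: sum.neutral)

lemma secant_cone_subset: "secant_cone n s C \<subseteq> coord_space (2 ^ n - 1) - {0}"
  using segre_sum_in_coord_space unfolding secant_cone_def by blast

lemma polyfun_segre_sum_line: "polyfun (\<lambda>\<tau>. segre_sum n s (line P Q \<tau>) k)"
  unfolding segre_sum_def line_def
  by (intro polyfun_sum polyfun_segre_vector polyfun_add polyfun_mult polyfun_const polyfun_id)

lemma polyfun_poly_eval: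
  assumes "\<And>k. polyfun (\<lambda>\<tau>. v \<tau> k)"
  shows "polyfun (\<lambda>\<tau>. poly_eval F (v \<tau>))"
  unfolding poly_eval_def mono_eval_def
  by (intro polyfun_sum polyfun_mult polyfun_prod polyfun_power polyfun_const assms)

lemma polyfun_not_all_zero:
  fixes g :: "'k::field_char_0 \<Rightarrow> 'k"
  assumes "polyfun g" "g x \<noteq> 0" "finite S"
  obtains \<tau> where "\<tau> \<notin> S" "g \<tau> \<noteq> 0"
proof -
  have "finite (S \<union> {\<tau>. g \<tau> = 0})" using polyfun_finite_zeros[OF assms(1,2)] assms(3) by simp
  from ex_new_if_finite[OF infinite_UNIV_char_0 this] show ?thesis using that by blast
qed

text \<open>Each of two proper closed pieces is avoided by some point of the image. On the line
  joining the two configurations the separating forms are nonzero polynomials in one variable, so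
  some point of that line avoids both pieces.\<close>

lemma irreducible_closure:
  fixes C :: "'k::field_char_0 config set"
  assumes lines: "\<And>P Q \<tau>. P \<in> C \<Longrightarrow> Q \<in> C \<Longrightarrow> line P Q \<tau> \<in> C" and ne: "secant_cone n s C \<noteq> {}"
  defines "N \<equiv> 2 ^ n - 1"
  defines "Z \<equiv> zariski N closure_of points (secant_cone n s C)"
  shows "irreducible_space (subtopology (zariski N) Z)"
proof -
  have W: "secant_cone n s C \<subseteq> coord_space N - {0}"
    unfolding N_def by (rule secant_cone_subset)
  have Zc: "closedin (zariski N) Z" unfolding Z_def by simp
  then have "Z \<subseteq> proj_space N" using closedin_subset by fastforce
  then have top: "topspace (subtopology (zariski N) Z) = Z" by (auto simp: topspace_subtopology)
  have sub: "points (secant_cone n s C) \<subseteq> Z"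
    unfolding Z_def using W vspan_in_proj_space by (intro closure_of_subset) (auto simp: points_def)
  have W_cone: "secant_cone n s C \<subseteq> cone N Z"
    using W sub unfolding cone_def points_def by blast
  have no: False
    if AB: "closedin (subtopology (zariski N) Z) A" "closedin (subtopology (zariski N) Z) B" "A \<union> B = Z"
      "A \<noteq> Z" "B \<noteq> Z" for A B
  proof -
    have cl: "closedin (zariski N) A" "closedin (zariski N) B" "A \<subset> Z" "B \<subset> Z"
      using subtopology_closed[OF Zc AB(1)] subtopology_closed[OF Zc AB(2)] AB(4,5) by blast+
    have sep: "\<exists>F P. P \<in> C \<and> segre_sum n s P \<noteq> 0 \<and> (\<forall>v\<in>cone N A. poly_eval F v = 0) \<and>
        poly_eval F (segre_sum n s P) \<noteq> 0"
      if A: "closedin (zariski N) A" "A \<subset> Z" for A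
    proof -
      obtain F where F: "homogeneous N F" "\<forall>v\<in>cone N A. poly_eval F v = 0" "\<exists>v\<in>cone N Z. poly_eval F v \<noteq> 0"
        using separating_form[OF A(1) Zc A(2)] by blast
      have "\<exists>w\<in>secant_cone n s C. poly_eval F w \<noteq> 0"
      proof (rule ccontr)
        assume "\<not> ?thesis"
        then have "\<forall>w\<in>secant_cone n s C. poly_eval F w = 0" by blast
        then have "poly_eval F v = 0" if "v \<in> cone N Z" for v
          using vspan_in_closure[OF W, of v] that F(1) unfolding cone_def Z_def by blast
        then show False using F(3) by blast
      qed
      then show ?thesis using F(2) unfolding secant_cone_def by blast
    qed
    obtain F P where F: "P \<in> C" "segre_sum n s P \<noteq> 0" "\<forall>v\<in>cone N A. poly_eval F v = 0"
      "poly_eval F (segre_sum n s P) \<noteq> 0" using sep[OF cl(1,3)] by blast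
    obtain G Q where G: "Q \<in> C" "\<forall>v\<in>cone N B. poly_eval G v = 0"
      "poly_eval G (segre_sum n s Q) \<noteq> 0" using sep[OF cl(2,4)] by blast
    obtain k where k: "segre_sum n s P k \<noteq> 0" using F(2) by (auto simp: fun_eq_iff)
    define w where "w \<tau> = segre_sum n s (line P Q \<tau>)" for \<tau>
    have poly: "polyfun (\<lambda>\<tau>. w \<tau> k)" for k unfolding w_def by (rule polyfun_segre_sum_line)
    have fin: "finite {\<tau>. poly_eval G (w \<tau>) = 0}"
      by (rule polyfun_finite_zeros[of _ 1, OF polyfun_poly_eval[OF poly]]) (simp add: w_def G(3))
    \<comment> \<open>The coordinate factor keeps the chosen vector nonzero.\<close>
    have "polyfun (\<lambda>\<tau>. poly_eval F (w \<tau>) * w \<tau> k)"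
      by (intro polyfun_mult polyfun_poly_eval poly)
    moreover have "poly_eval F (w 0) * w 0 k \<noteq> 0" using F(4) k by (simp add: w_def)
    ultimately obtain \<tau> where \<tau>: "poly_eval G (w \<tau>) \<noteq> 0" "poly_eval F (w \<tau>) * w \<tau> k \<noteq> 0"
      using polyfun_not_all_zero[OF _ _ fin] by blast
    then have "w \<tau> \<noteq> 0" by auto
    then have "w \<tau> \<in> secant_cone n s C"
      unfolding secant_cone_def w_def using lines F(1) G(1) by blast
    then have "w \<tau> \<in> cone N Z" using W_cone by blast
    then have "w \<tau> \<in> cone N A \<or> w \<tau> \<in> cone N B" using AB(3) unfolding cone_def by blast
    then show False using \<tau> F(3) G(2) by auto
  qed
  have "Z \<noteq> {}" using ne sub unfolding points_def by blast
  then show ?thesis unfolding irreducible_space_def top using no by blast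
qed

lemma segre_varietyE:
  assumes "Q \<in> segre_variety n"
  obtains a where "Q = vspan {segre_vector n a}"
proof -
  obtain p where p: "Q = segre_map n p" "\<And>i. i < n \<Longrightarrow> p i \<in> proj_space 1"
    using assms by (auto simp: segre_variety_def PiE_def Pi_def)
  then have "\<forall>i<n. \<exists>v. p i = vspan {v}" by (auto simp: proj_space_def)
  then obtain a where a: "\<And>i. i < n \<Longrightarrow> p i = vspan {a i}" by metis
  have "segre_map n p = vspan {segre_vector n a}" by (rule segre_map_eq) (rule a)
  then show ?thesis using that p(1) by blast
qed

lemma segre_point_in_variety:
  fixes a :: "nat \<Rightarrow> nat \<Rightarrow> 'k::field"
  assumes "\<And>i. i < n \<Longrightarrow> a i 0 \<noteq> 0"
  shows "vspan {segre_vector n a} \<in> segre_variety n"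
proof -
  \<comment> \<open>Entries beyond the two coordinates are arbitrary in a configuration and are cut
    off to obtain points of the projective line.\<close>
  define b where "b i = (\<lambda>c. if c < 2 then a i c else 0)" for i
  have b: "segre_vector n a = segre_vector n b" by (rule segre_vector_cong) (simp add: b_def)
  have "b i \<in> coord_space 1" for i by (auto simp: coord_space_def b_def)
  moreover have "b i \<noteq> 0" if "i < n" for i
  proof
    assume "b i = 0"
    then have "b i 0 = 0" by simp
    then show False using assms[OF that] by (simp add: b_def)
  qed
  ultimately have "vspan {b i} \<in> proj_space 1" if "i < n" for i
    using that vspan_in_proj_space by blast
  then have "restrict (\<lambda>i. vspan {b i}) {..<n} \<in> {..<n} \<rightarrow>\<^sub>E proj_space 1" by auto
  moreover have "segre_map n (restrict (\<lambda>i. vspan {b i}) {..<n}) = vspan {segre_vector n b}"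
    by (rule segre_map_eq) simp
  ultimately show ?thesis unfolding segre_variety_def b by (metis imageI)
qed

text \<open>The determinant compares the first factors of the two tuples.\<close>

lemma segre_points_distinct:
  fixes a b :: "nat \<Rightarrow> nat \<Rightarrow> 'k::field"
  assumes n: "1 \<le> n" and a: "\<And>i. i < n \<Longrightarrow> a i 0 \<noteq> 0"
    and det: "a 0 0 * b 0 1 - a 0 1 * b 0 0 \<noteq> 0"
  shows "vspan {segre_vector n a} \<noteq> vspan {segre_vector n b}"
proof
  assume "vspan {segre_vector n a} = vspan {segre_vector n b}"
  then have "segre_vector n a \<in> vspan {segre_vector n b}"
    using vec.span_base[of "segre_vector n a" "{segre_vector n a}"] by simp
  then obtain c where c: "segre_vector n a = vscale c (segre_vector n b)"
    unfolding vspan_singleton by blast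
  obtain m where m: "n = Suc m" using n by (cases n) auto
  define R where "R x = (\<Prod>i<m. x (Suc i) 0)" for x :: "nat \<Rightarrow> nat \<Rightarrow> 'k"
  have 0: "segre_vector n x 0 = x 0 0 * R x" for x :: "nat \<Rightarrow> nat \<Rightarrow> 'k"
    by (simp add: segre_vector_def m R_def prod.lessThan_Suc_shift del: prod.lessThan_Suc)
  have "(1::nat) < 2 ^ Suc m" by (rule one_less_power) simp_all
  then have 1: "segre_vector n x 1 = x 0 1 * R x" for x :: "nat \<Rightarrow> nat \<Rightarrow> 'k"
    by (simp add: segre_vector_def m R_def prod.lessThan_Suc_shift bit_1_iff del: prod.lessThan_Suc One_nat_def power_Suc)
  have "a 0 0 * R a = c * (b 0 0 * R b)" "a 0 1 * R a = c * (b 0 1 * R b)"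
    using c 0[of a] 0[of b] 1[of a] 1[of b] by (simp_all add: vscale_def)
  then have "(a 0 0 * b 0 1 - a 0 1 * b 0 0) * R a = 0" by algebra
  moreover have "R a \<noteq> 0" using a by (simp add: R_def m)
  ultimately show False using det by simp
qed

lemma segre_vector_absorb_scalar:
  assumes "1 \<le> n"
  shows "\<exists>b. segre_vector n b = vscale c (segre_vector n a)"
proof -
  have "(\<Prod>i<n. if i = 0 then c else 1) = c" using assms by simp
  then show ?thesis using segre_vector_vscale[of n "\<lambda>i. if i = 0 then c else 1" a] by metis
qed

text \<open>A point in the span of \<open>s\<close> points is a sum of \<open>s\<close> Segre
  vectors, with the coefficients absorbed. Conversely, the tuples of a sum may coincide or have a
  zero factor and then do not give \<open>s\<close> distinct points of the variety; such a sum is a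
  limit of sums that do.\<close>

lemma secant_variety_eq:
  fixes n s :: nat
  assumes n: "1 \<le> n"
  shows "secant_variety (2 ^ n - 1) s (segre_variety n :: 'k::field_char_0 point set) =
    zariski (2 ^ n - 1) closure_of points (secant_cone n s UNIV)"
proof -
  define N :: nat where "N = 2 ^ n - 1"
  define U :: "'k point set" where
    "U = (\<Union>A\<in>{A. A \<subseteq> segre_variety n \<and> finite A \<and> card A = s}. proj_span N A)"
  let ?W = "secant_cone n s UNIV :: (nat \<Rightarrow> 'k) set"
  have W: "?W \<subseteq> coord_space N - {0}" unfolding N_def by (rule secant_cone_subset)
  have Usub: "U \<subseteq> proj_space N" unfolding U_def proj_span_def by blast
  have "U \<subseteq> points ?W"
  proof
    fix p assume "p \<in> U"
    then obtain A where A: "A \<subseteq> segre_variety n" "finite A" "card A = s" "p \<in> proj_space N" "p \<subseteq> vspan (\<Union>A)"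
      unfolding U_def proj_span_def by blast
    obtain v where v: "v \<in> coord_space N" "v \<noteq> 0" "p = vspan {v}" using A(4) by (rule proj_spaceE)
    have "\<forall>q\<in>A. \<exists>a. q = vspan {segre_vector n a}" using A(1) segre_varietyE by blast
    then obtain x where x: "\<And>q. q \<in> A \<Longrightarrow> q = vspan {segre_vector n (x q)}" by metis
    define w where "w q = segre_vector n (x q)" for q
    have inj: "inj_on w A" using x unfolding w_def inj_on_def by metis
    have "\<Union>A \<subseteq> vspan (w ` A)"
    proof
      fix u assume "u \<in> \<Union>A"
      then obtain q where q: "q \<in> A" "u \<in> q" by blast
      have "vspan {w q} \<subseteq> vspan (w ` A)" using q(1) by (intro vec.span_mono) auto
      then show "u \<in> vspan (w ` A)" using x[OF q(1)] q(2) unfolding w_def by blast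
    qed
    then have "vspan (\<Union>A) \<subseteq> vspan (w ` A)" by (rule vec.span_minimal) simp
    moreover have "v \<in> p" unfolding v(3) by (simp add: vec.span_base)
    ultimately have "v \<in> vspan (w ` A)" using A(5) by blast
    then obtain c where c: "v = (\<Sum>u\<in>w ` A. vscale (c u) u)"
      using vec.span_finite[of "w ` A"] A(2) by auto
    obtain h where h: "bij_betw h {..<s} A" using A(2,3) ex_bij_betw_nat_finite[of A] by (auto simp: lessThan_atLeast0)
    have "v = (\<Sum>q\<in>A. vscale (c (w q)) (w q))" unfolding c by (simp add: sum.reindex[OF inj])
    also have "\<dots> = (\<Sum>j<s. vscale (c (w (h j))) (w (h j)))"
      by (rule sum.reindex_bij_betw[OF h, symmetric])
    finally have v': "v = (\<Sum>j<s. vscale (c (w (h j))) (w (h j)))" .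
    have "\<forall>j. \<exists>b. segre_vector n b = vscale (c (w (h j))) (w (h j))"
      using segre_vector_absorb_scalar[OF n] unfolding w_def by blast
    then obtain P where P: "\<And>j. segre_vector n (P j) = vscale (c (w (h j))) (w (h j))" by metis
    have "v = segre_sum n s P"
      unfolding v' segre_sum_def P[symmetric] by (simp add: fun_eq_iff sum_fun_apply)
    then show "p \<in> points ?W" using v unfolding points_def secant_cone_def by blast
  qed
  moreover have "points ?W \<subseteq> zariski N closure_of U"
  proof
    fix p assume "p \<in> points ?W"
    then obtain P where P: "p = vspan {segre_sum n s P}" "segre_sum n s P \<noteq> 0"
      unfolding points_def secant_cone_def by blast
    \<comment> \<open>All tuples of \<open>Q\<close> have first coordinates 1, hence are points of
      the variety, and their first factors \<open>(1 : j)\<close> are pairwise distinct in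
      characteristic 0. Almost all members of the line from \<open>P\<close> to \<open>Q\<close>
      inherit both properties.\<close>
    define Q :: "'k config" where "Q j i = (\<lambda>c. if c = 0 then 1 else of_nat j)" for j i
    define L where "L = line P Q"
    define bad where "bad = (\<Union>j<s. \<Union>i<n. {\<tau>. L \<tau> j i 0 = 0}) \<union>
      (\<Union>j<s. \<Union>j'\<in>{..<s} - {j}. {\<tau>. L \<tau> j 0 0 * L \<tau> j' 0 1 - L \<tau> j 0 1 * L \<tau> j' 0 0 = 0})"
    have pl: "polyfun (\<lambda>\<tau>. L \<tau> j i c)" for j i c
      unfolding L_def line_def by (intro polyfun_add polyfun_mult polyfun_const polyfun_id)
    have "finite {\<tau>. L \<tau> j i 0 = 0}" for j i
      by (rule polyfun_finite_zeros[OF pl, of 1]) (simp add: L_def Q_def)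
    moreover have "finite {\<tau>. L \<tau> j 0 0 * L \<tau> j' 0 1 - L \<tau> j 0 1 * L \<tau> j' 0 0 = 0}" if "j \<noteq> j'" for j j'
      by (rule polyfun_finite_zeros[of _ 1]) (use that in \<open>auto simp: L_def Q_def intro!: polyfun_diff polyfun_mult pl[unfolded L_def]\<close>)
    ultimately have fin: "finite bad" unfolding bad_def by auto
    have good: "vspan {segre_sum n s (L \<tau>)} \<in> U" if "\<tau> \<notin> bad" "segre_sum n s (L \<tau>) \<noteq> 0" for \<tau>
    proof -
      have nz: "L \<tau> j i 0 \<noteq> 0" if "j < s" "i < n" for j i using \<open>\<tau> \<notin> bad\<close> that unfolding bad_def by blast
      define q where "q j = vspan {segre_vector n (L \<tau> j)}" for j
      have "inj_on q {..<s}"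
      proof (rule inj_onI, rule ccontr)
        fix j j' assume j: "j \<in> {..<s}" "j' \<in> {..<s}" "q j = q j'" "j \<noteq> j'"
        then have "L \<tau> j 0 0 * L \<tau> j' 0 1 - L \<tau> j 0 1 * L \<tau> j' 0 0 \<noteq> 0"
          using \<open>\<tau> \<notin> bad\<close> unfolding bad_def by blast
        moreover have "L \<tau> j i 0 \<noteq> 0" if "i < n" for i using nz j(1) that by simp
        ultimately have "q j \<noteq> q j'"
          unfolding q_def using segre_points_distinct[of n "L \<tau> j" "L \<tau> j'"] n by blast
        with j(3) show False by contradiction
      qed
      then have "card (q ` {..<s}) = s" by (simp add: card_image)
      moreover have "q ` {..<s} \<subseteq> segre_variety n"
        using nz unfolding q_def by (auto intro!: segre_point_in_variety)
      moreover have "vspan {segre_sum n s (L \<tau>)} \<in> proj_span N (q ` {..<s})"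
      proof -
        have "segre_vector n (L \<tau> j) \<in> vspan (\<Union>(q ` {..<s}))" if "j < s" for j
        proof -
          have "segre_vector n (L \<tau> j) \<in> q j" unfolding q_def by (simp add: vec.span_base)
          then show ?thesis using that by (intro vec.span_base) blast
        qed
        then have "(\<Sum>j<s. segre_vector n (L \<tau> j)) \<in> vspan (\<Union>(q ` {..<s}))"
          by (intro vec.span_sum) auto
        moreover have "(\<Sum>j<s. segre_vector n (L \<tau> j)) = segre_sum n s (L \<tau>)"
          by (simp add: segre_sum_def fun_eq_iff sum_fun_apply)
        ultimately have "vspan {segre_sum n s (L \<tau>)} \<subseteq> vspan (\<Union>(q ` {..<s}))"
          by (intro vec.span_minimal) auto
        moreover have "vspan {segre_sum n s (L \<tau>)} \<in> proj_space N"
          using that(2) segre_sum_in_coord_space unfolding N_def by (intro vspan_in_proj_space)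
        ultimately show ?thesis unfolding proj_span_def by blast
      qed
      ultimately show ?thesis unfolding U_def by blast
    qed
    obtain k where k: "segre_sum n s P k \<noteq> 0" using P(2) by (auto simp: fun_eq_iff)
    have "poly_eval F (segre_sum n s P) = 0" if F: "\<forall>w\<in>cone N U. poly_eval F w = 0" for F
    proof (rule ccontr)
      assume nz: "poly_eval F (segre_sum n s P) \<noteq> 0"
      have poly: "polyfun (\<lambda>\<tau>. segre_sum n s (L \<tau>) k)" for k
        unfolding L_def by (rule polyfun_segre_sum_line)
      have "polyfun (\<lambda>\<tau>. poly_eval F (segre_sum n s (L \<tau>)) * segre_sum n s (L \<tau>) k)"
        by (intro polyfun_mult polyfun_poly_eval poly)
      moreover have "poly_eval F (segre_sum n s (L 0)) * segre_sum n s (L 0) k \<noteq> 0"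
        using nz k by (simp add: L_def)
      ultimately obtain \<tau> where \<tau>: "\<tau> \<notin> bad" "poly_eval F (segre_sum n s (L \<tau>)) * segre_sum n s (L \<tau>) k \<noteq> 0"
        using polyfun_not_all_zero[OF _ _ fin] by blast
      then have "segre_sum n s (L \<tau>) \<noteq> 0" by auto
      then have "segre_sum n s (L \<tau>) \<in> cone N U"
        using good[OF \<tau>(1)] segre_sum_in_coord_space unfolding cone_def N_def by blast
      then show False using F \<tau>(2) by simp
    qed
    moreover have "cone N U \<subseteq> coord_space N - {0}" unfolding cone_def by blast
    ultimately have "vspan {segre_sum n s P} \<in> zariski N closure_of points (cone N U)"
      using vspan_in_closure[of "cone N U" N "segre_sum n s P"] P(2) segre_sum_in_coord_space
      unfolding N_def by blast
    then show "p \<in> zariski N closure_of U" unfolding P(1) points_cone[OF Usub] .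
  qed
  ultimately have "zariski N closure_of U = zariski N closure_of points ?W"
    by (intro subset_antisym closure_of_mono closure_of_minimal) auto
  then show ?thesis unfolding secant_variety_def U_def N_def .
qed

section \<open>Lower bounds for the dimension\<close>

lemma coeffs_zero:
  fixes c :: "nat \<Rightarrow> 'k::field_char_0"
  assumes "\<And>x. (\<Sum>i\<le>D. c i * x ^ i) = 0" and "i \<le> D"
  shows "c i = 0"
proof -
  define p where "p = (\<Sum>i\<le>D. monom (c i) i)"
  have "poly p x = 0" for x using assms(1)[of x] by (simp add: p_def poly_sum poly_monom)
  then have "p = 0" using poly_all_0_iff_0 by blast
  moreover have "coeff p i = c i" using assms(2) by (simp add: p_def coeff_sum)
  ultimately show ?thesis by simp
qed

lemma multi_coeffs_zero:
  fixes c :: "(nat \<Rightarrow> nat) \<Rightarrow> 'k::field_char_0"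
  assumes "\<And>z. (\<Sum>\<alpha>\<in>PiE {..<m} (\<lambda>_. {..D}). c \<alpha> * (\<Prod>l<m. z l ^ \<alpha> l)) = 0"
    and "\<alpha> \<in> PiE {..<m} (\<lambda>_. {..D})"
  shows "c \<alpha> = 0"
  using assms
proof (induction m arbitrary: c \<alpha>)
  case 0
  then show ?case by simp
next
  case (Suc m)
  let ?I = "PiE {..<m} (\<lambda>_. {..D})" and ?f = "\<lambda>(y, g). g(m := y)"
  have PiE: "PiE {..<Suc m} (\<lambda>_. {..D}) = ?f ` ({..D} \<times> ?I)"
    by (simp add: lessThan_Suc PiE_insert_eq)
  have inj: "inj_on ?f ({..D} \<times> ?I)" by (rule inj_combinator) simp
  obtain y g where yg: "y \<le> D" "g \<in> ?I" "\<alpha> = g(m := y)"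
    using Suc.prems(2) unfolding PiE by auto
  have "(\<Sum>g\<in>?I. c (g(m := y)) * (\<Prod>l<m. z l ^ g l)) = 0" for z
  proof (rule coeffs_zero[OF _ yg(1)])
    fix x
    have upd: "(\<Prod>l<Suc m. (z(m := x)) l ^ (g(m := y)) l) = (\<Prod>l<m. z l ^ g l) * x ^ y" for g y
      by (simp cong: prod.cong_simp)
    have "0 = (\<Sum>\<alpha>\<in>?f ` ({..D} \<times> ?I). c \<alpha> * (\<Prod>l<Suc m. (z(m := x)) l ^ \<alpha> l))"
      using Suc.prems(1)[of "z(m := x)"] unfolding PiE by simp
    also have "\<dots> = (\<Sum>(y, g)\<in>{..D} \<times> ?I. c (g(m := y)) * (\<Prod>l<Suc m. (z(m := x)) l ^ (g(m := y)) l))"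
      by (subst sum.reindex[OF inj]) (simp add: case_prod_unfold o_def)
    also have "\<dots> = (\<Sum>(y, g)\<in>{..D} \<times> ?I. c (g(m := y)) * ((\<Prod>l<m. z l ^ g l) * x ^ y))"
      by (simp only: upd)
    also have "\<dots> = (\<Sum>y\<le>D. (\<Sum>g\<in>?I. c (g(m := y)) * (\<Prod>l<m. z l ^ g l)) * x ^ y)"
      by (simp add: sum.cartesian_product[symmetric] sum_distrib_right mult.assoc)
    finally show "(\<Sum>y\<le>D. (\<Sum>g\<in>?I. c (g(m := y)) * (\<Prod>l<m. z l ^ g l)) * x ^ y) = 0" by simp
  qed
  from Suc.IH[where c = "\<lambda>g. c (g(m := y))", OF this yg(2)] show ?case unfolding yg(3) .
qed

lemma indep_formsI:
  fixes W :: "(nat \<Rightarrow> 'k::field) set"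
  assumes "finite I" "\<And>\<alpha>. \<alpha> \<in> I \<Longrightarrow> is_form N d (G \<alpha>)"
    and indep: "\<And>c \<alpha>. (\<And>v. v \<in> W \<Longrightarrow> (\<Sum>\<alpha>\<in>I. c \<alpha> * poly_eval (G \<alpha>) v) = 0) \<Longrightarrow> \<alpha> \<in> I \<Longrightarrow> c \<alpha> = 0"
  shows "indep_forms N W d (card I)"
proof -
  obtain h where h: "bij_betw h {..<card I} I"
    using ex_bij_betw_nat_finite[OF assms(1)] by (auto simp: atLeast0LessThan)
  have hI: "h j \<in> I" if "j < card I" for j using h that by (auto simp: bij_betw_def)
  have "\<forall>j<card I. c j = 0" if c: "\<forall>v\<in>W. (\<Sum>j<card I. c j * poly_eval (G (h j)) v) = 0" for c
  proof -
    define c' where "c' \<alpha> = c (inv_into {..<card I} h \<alpha>)" for \<alpha>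
    have c': "c' (h j) = c j" if "j < card I" for j
      using h that by (simp add: c'_def bij_betw_def)
    have "(\<Sum>\<alpha>\<in>I. c' \<alpha> * poly_eval (G \<alpha>) v) = (\<Sum>j<card I. c j * poly_eval (G (h j)) v)" for v
      by (subst sum.reindex_bij_betw[OF h, symmetric]) (simp add: c')
    then have "c' \<alpha> = 0" if "\<alpha> \<in> I" for \<alpha> using indep[of c' \<alpha>] c that by simp
    then show ?thesis using c' hI by metis
  qed
  then show ?thesis unfolding indep_forms_def using assms(2) hI by (intro exI[of _ "\<lambda>j. G (h j)"]) blast
qed

lemma indep_forms_mono:
  "indep_forms N W d M \<Longrightarrow> W \<subseteq> W' \<Longrightarrow> indep_forms N W' d M"
  unfolding indep_forms_def by blast

definition linear_form :: "nat \<Rightarrow> (nat \<Rightarrow> 'k::field) \<Rightarrow> 'k mpoly" where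
  "linear_form N a = (\<Sum>k\<le>N. const_form (a k) * coord_form k)"

lemma is_form_linear: "is_form N 1 (linear_form N a)"
  unfolding linear_form_def by (rule is_form_lincomb, rule is_form_coord) simp

lemma poly_eval_linear: "poly_eval (linear_form N a) v = (\<Sum>k\<le>N. a k * v k)"
  unfolding linear_form_def poly_eval_lincomb by simp

lemma poly_eval_prod: "poly_eval (\<Prod>i\<in>A. F i) v = (\<Prod>i\<in>A. poly_eval (F i) v)"
  by (induction A rule: infinite_finite_induct) (simp_all add: poly_eval_mult)

lemma is_form_prod:
  "(\<And>i. i \<in> A \<Longrightarrow> is_form N (e i) (F i)) \<Longrightarrow> is_form N (\<Sum>i\<in>A. e i) (\<Prod>i\<in>A. F i)"
  by (induction A rule: infinite_finite_induct) (auto intro: is_form_mult)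

text \<open>
  The forms are the monomials in the linear forms with coefficients \<open>a 0, \<dots>, a m\<close>; along the line \<open>\<tau> \<mapsto> \<tau> z\<close> their leading terms
  are distinct monomials in \<open>\<tau> z\<close>.
\<close>

lemma indep_forms_leading_terms:
  fixes \<Phi> :: "(nat \<Rightarrow> 'k::field_char_0) \<Rightarrow> nat \<Rightarrow> 'k"
  assumes L0: "\<And>z. \<exists>R. polyfun R \<and> R 0 = 1 \<and> (\<forall>\<tau>. (\<Sum>k\<le>N. a 0 k * \<Phi> (\<lambda>l. \<tau> * z l) k) = R \<tau>)"
    and L: "\<And>z l. l < m \<Longrightarrow> \<exists>R. polyfun R \<and> R 0 = z l \<and>
      (\<forall>\<tau>. (\<Sum>k\<le>N. a (Suc l) k * \<Phi> (\<lambda>l. \<tau> * z l) k) = \<tau> * R \<tau>)"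
  shows "indep_forms N (range \<Phi> - {0}) (m * D) ((D + 1) ^ m)"
proof -
  let ?I = "PiE {..<m} (\<lambda>_. {..D})"
  have I: "finite ?I" by (intro finite_PiE) auto
  define deg where "deg \<alpha> = (\<Sum>l<m. \<alpha> l)" for \<alpha> :: "nat \<Rightarrow> nat"
  have deg: "deg \<alpha> \<le> m * D" if "\<alpha> \<in> ?I" for \<alpha>
    using sum_bounded_above[of "{..<m}" \<alpha> D] that by (auto simp: deg_def)
  \<comment> \<open>The power of the linear form \<open>a 0\<close> brings all monomials to the
    degree \<open>m * D\<close>; its value at \<tau> = 0 is 1.\<close>
  define G where "G \<alpha> = linear_form N (a 0) ^ (m * D - deg \<alpha>) * (\<Prod>l<m. linear_form N (a (Suc l)) ^ \<alpha> l)" for \<alpha>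
  have form: "is_form N (m * D) (G \<alpha>)" if "\<alpha> \<in> ?I" for \<alpha>
  proof -
    have p: "is_form N e (linear_form N b ^ e)" for b :: "nat \<Rightarrow> 'k" and e
      using is_form_power[OF is_form_linear[of N b], of e] by simp
    have "is_form N ((m * D - deg \<alpha>) + deg \<alpha>) (G \<alpha>)"
      unfolding G_def deg_def by (intro is_form_mult is_form_prod p)
    then show ?thesis using deg[OF that] by simp
  qed
  have indep: "c \<alpha> = 0"
    if c: "\<And>v. v \<in> range \<Phi> - {0} \<Longrightarrow> (\<Sum>\<alpha>\<in>?I. c \<alpha> * poly_eval (G \<alpha>) v) = 0" and \<alpha>: "\<alpha> \<in> ?I" for c \<alpha>
  proof -
    \<comment> \<open>Induction on the total degree: the terms of lower degree are gone, so after
      division by \<open>\<tau> ^ e\<close> the value at 0 is the part of degree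
      \<open>e\<close>.\<close>
    have "\<forall>\<alpha>\<in>?I. deg \<alpha> = e \<longrightarrow> c \<alpha> = 0" for e
    proof (induction e rule: less_induct)
      case (less e)
      have low: "c \<alpha> = 0" if "\<alpha> \<in> ?I" "deg \<alpha> < e" for \<alpha> using less that by blast
      define c' where "c' \<alpha> = (if deg \<alpha> = e then c \<alpha> else 0)" for \<alpha>
      have "(\<Sum>\<alpha>\<in>?I. c' \<alpha> * (\<Prod>l<m. z l ^ \<alpha> l)) = 0" for z
      proof -
        obtain R0 where R0: "polyfun R0" "R0 0 = 1" "\<And>\<tau>. (\<Sum>k\<le>N. a 0 k * \<Phi> (\<lambda>l. \<tau> * z l) k) = R0 \<tau>"
          using L0 by blast
        have "\<forall>l. \<exists>R. l < m \<longrightarrow> polyfun R \<and> R 0 = z l \<and>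
          (\<forall>\<tau>. (\<Sum>k\<le>N. a (Suc l) k * \<Phi> (\<lambda>l. \<tau> * z l) k) = \<tau> * R \<tau>)" using L by blast
        then obtain R where R: "\<And>l. l < m \<Longrightarrow> polyfun (R l)" "\<And>l. l < m \<Longrightarrow> R l 0 = z l"
          "\<And>l \<tau>. l < m \<Longrightarrow> (\<Sum>k\<le>N. a (Suc l) k * \<Phi> (\<lambda>l. \<tau> * z l) k) = \<tau> * R l \<tau>"
          by metis
        define U where "U \<alpha> \<tau> = R0 \<tau> ^ (m * D - deg \<alpha>) * (\<Prod>l<m. R l \<tau> ^ \<alpha> l)" for \<alpha> \<tau>
        have U: "poly_eval (G \<alpha>) (\<Phi> (\<lambda>l. \<tau> * z l)) = \<tau> ^ deg \<alpha> * U \<alpha> \<tau>" for \<alpha> \<tau>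
        proof -
          have "(\<Prod>l<m. (\<tau> * R l \<tau>) ^ \<alpha> l) = \<tau> ^ deg \<alpha> * (\<Prod>l<m. R l \<tau> ^ \<alpha> l)"
            by (simp add: power_mult_distrib prod.distrib power_sum deg_def)
          then show ?thesis
            by (simp add: G_def U_def poly_eval_mult poly_eval_power poly_eval_prod poly_eval_linear R0(3) R(3))
        qed
        define J where "J = {\<alpha> \<in> ?I. e \<le> deg \<alpha>}"
        \<comment> \<open>The factor \<open>R0 \<tau>\<close> covers the parameters at which \<Phi>
          is the zero vector, where the relation is not assumed: there this factor is zero.\<close>
        define H where "H \<tau> = (\<Sum>\<alpha>\<in>J. c \<alpha> * (\<tau> ^ (deg \<alpha> - e) * U \<alpha> \<tau>)) * R0 \<tau>" for \<tau>
        have "polyfun H"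
          unfolding H_def U_def
          by (intro polyfun_mult polyfun_sum polyfun_prod polyfun_power polyfun_const polyfun_id R0 R) auto
        have H: "\<tau> ^ e * H \<tau> = 0" for \<tau>
        proof (cases "\<Phi> (\<lambda>l. \<tau> * z l) = 0")
          case True
          then have "R0 \<tau> = 0" using R0(3)[of \<tau>] by simp
          then show ?thesis by (simp add: H_def)
        next
          case False
          then have "0 = (\<Sum>\<alpha>\<in>?I. c \<alpha> * poly_eval (G \<alpha>) (\<Phi> (\<lambda>l. \<tau> * z l)))" using c by simp
          also have "\<dots> = (\<Sum>\<alpha>\<in>J. c \<alpha> * poly_eval (G \<alpha>) (\<Phi> (\<lambda>l. \<tau> * z l)))"
            using I low by (intro sum.mono_neutral_right) (auto simp: J_def not_le)
          also have "\<dots> = (\<Sum>\<alpha>\<in>J. c \<alpha> * (\<tau> ^ e * (\<tau> ^ (deg \<alpha> - e) * U \<alpha> \<tau>)))"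
            by (intro sum.cong refl) (simp add: U J_def flip: mult.assoc power_add)
          finally have "\<tau> ^ e * (\<Sum>\<alpha>\<in>J. c \<alpha> * (\<tau> ^ (deg \<alpha> - e) * U \<alpha> \<tau>)) = 0"
            by (simp add: sum_distrib_left algebra_simps)
          then show ?thesis unfolding H_def by auto
        qed
        have "H 0 = 0"
        proof (rule ccontr)
          assume "H 0 \<noteq> 0"
          from polyfun_not_all_zero[OF \<open>polyfun H\<close> this, of "{0}"] obtain \<tau> where "\<tau> \<noteq> 0" "H \<tau> \<noteq> 0" by auto
          then show False using H[of \<tau>] by simp
        qed
        moreover have "H 0 = (\<Sum>\<alpha>\<in>J. c' \<alpha> * (\<Prod>l<m. z l ^ \<alpha> l))"
          unfolding H_def R0(2) mult_1_right
          by (intro sum.cong refl) (auto simp: U_def R0(2) R(2) c'_def J_def)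
        moreover have "\<dots> = (\<Sum>\<alpha>\<in>?I. c' \<alpha> * (\<Prod>l<m. z l ^ \<alpha> l))"
          using I by (intro sum.mono_neutral_left) (auto simp: J_def c'_def)
        ultimately show ?thesis by simp
      qed
      then have "c' \<alpha> = 0" if "\<alpha> \<in> ?I" for \<alpha>
        by (rule multi_coeffs_zero[where c = c' and m = m and D = D and \<alpha> = \<alpha>, OF _ that])
      then show ?case unfolding c'_def by (metis (no_types, lifting))
    qed
    then show ?thesis using \<alpha> by blast
  qed
  have "card ?I = (D + 1) ^ m" by (simp add: card_PiE)
  moreover have "indep_forms N (range \<Phi> - {0}) (m * D) (card ?I)"
  proof (rule indep_formsI[where G = G, OF I form])
    fix c :: "(nat \<Rightarrow> nat) \<Rightarrow> 'k" and \<alpha>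
    assume "\<And>v. v \<in> range \<Phi> - {0} \<Longrightarrow> (\<Sum>\<alpha>\<in>?I. c \<alpha> * poly_eval (G \<alpha>) v) = 0" "\<alpha> \<in> ?I"
    then show "c \<alpha> = 0" by (rule indep[where c = c and \<alpha> = \<alpha>])
  qed
  ultimately show ?thesis by (simp only:)
qed

text \<open>Each exponent is bounded separately, not their sum; this coarser count has the same
  order of growth, \<open>e ^ m\<close>.\<close>

definition bounded_monomials :: "nat \<Rightarrow> nat \<Rightarrow> ((nat \<Rightarrow> 'k::field) \<Rightarrow> 'k) set" where
  "bounded_monomials m e = {\<lambda>y. \<Prod>l<m. y l ^ \<beta> l |\<beta>. \<forall>l<m. \<beta> l \<le> e}"

lemma graded_bounded_monomials:
  "graded_functions (\<lambda>d. bounded_monomials m (e * d) :: ((nat \<Rightarrow> 'k::field) \<Rightarrow> 'k) set)"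
proof
  have "(\<lambda>_ :: nat \<Rightarrow> 'k. 1) = (\<lambda>y. \<Prod>l<m. y l ^ 0)" by simp
  then show "(\<lambda>_ :: nat \<Rightarrow> 'k. 1) \<in> bounded_monomials m (e * 0)"
    unfolding bounded_monomials_def mem_Collect_eq by (intro exI[of _ "\<lambda>_. 0"]) simp
  fix d d' and g h :: "(nat \<Rightarrow> 'k) \<Rightarrow> 'k"
  assume "g \<in> bounded_monomials m (e * d)" "h \<in> bounded_monomials m (e * d')"
  then obtain \<beta> \<gamma> where "g = (\<lambda>y. \<Prod>l<m. y l ^ \<beta> l)" "\<forall>l<m. \<beta> l \<le> e * d"
    "h = (\<lambda>y. \<Prod>l<m. y l ^ \<gamma> l)" "\<forall>l<m. \<gamma> l \<le> e * d'"
    unfolding bounded_monomials_def by blast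
  then show "(\<lambda>y. g y * h y) \<in> bounded_monomials m (e * (d + d'))"
    unfolding bounded_monomials_def mem_Collect_eq
    by (intro exI[of _ "\<lambda>l. \<beta> l + \<gamma> l"]) (simp add: power_add prod.distrib distrib_left add_mono)
qed

lemma card_bounded_monomials:
  "finite (bounded_monomials m e :: ((nat \<Rightarrow> 'k::field) \<Rightarrow> 'k) set) \<and>
    card (bounded_monomials m e :: ((nat \<Rightarrow> 'k) \<Rightarrow> 'k) set) \<le> (e + 1) ^ m"
proof -
  have "(bounded_monomials m e :: ((nat \<Rightarrow> 'k) \<Rightarrow> 'k) set)
    \<subseteq> (\<lambda>\<beta> y. \<Prod>l<m. y l ^ \<beta> l) ` PiE {..<m} (\<lambda>_. {..e})"
  proof
    fix g :: "(nat \<Rightarrow> 'k) \<Rightarrow> 'k" assume "g \<in> bounded_monomials m e"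
    then obtain \<beta> where \<beta>: "g = (\<lambda>y. \<Prod>l<m. y l ^ \<beta> l)" "\<forall>l<m. \<beta> l \<le> e"
      unfolding bounded_monomials_def by blast
    have "g = (\<lambda>y. \<Prod>l<m. y l ^ restrict \<beta> {..<m} l)" unfolding \<beta>(1) by simp
    then show "g \<in> (\<lambda>\<beta> y. \<Prod>l<m. y l ^ \<beta> l) ` PiE {..<m} (\<lambda>_. {..e})"
      using \<beta>(2) by (intro image_eqI[of _ _ "restrict \<beta> {..<m}"]) auto
  qed
  then show ?thesis using card_image_PiE_le[of "{..<m}"] by fastforce
qed


section \<open>Affine families of configurations and their differentials\<close>

definition affine_config ::
    "'k::field config \<Rightarrow> (nat \<Rightarrow> 'k config) \<Rightarrow> nat \<Rightarrow> (nat \<Rightarrow> 'k) \<Rightarrow> 'k config" where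
  "affine_config P E m y = (\<lambda>j i c. P j i c + (\<Sum>l<m. y l * E l j i c))"

text \<open>The differential of \<open>segre_sum n s\<close> at \<open>P\<close> in the direction
  \<open>E\<close>: the product rule replaces one factor of one tuple at a time.\<close>

definition segre_derivative ::
    "nat \<Rightarrow> nat \<Rightarrow> 'k::field config \<Rightarrow> 'k config \<Rightarrow> nat \<Rightarrow> 'k" where
  "segre_derivative n s P E = (\<lambda>k. \<Sum>j<s. \<Sum>i<n. segre_vector n ((P j)(i := E j i)) k)"

lemma affine_config_line:
  "line (affine_config P E m y) (affine_config P E m y') \<tau> =
    affine_config P E m (\<lambda>l. y l + \<tau> * (y' l - y l))"
  by (simp add: line_def affine_config_def fun_eq_iff sum_distrib_left sum_subtractf
      sum.distrib algebra_simps)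

lemma affine_config_Suc: "range (affine_config P E m) \<subseteq> range (affine_config P E (Suc m))"
proof
  fix Q assume "Q \<in> range (affine_config P E m)"
  then obtain y where "Q = affine_config P E m y" by blast
  then have "Q = affine_config P E (Suc m) (y(m := 0))"
    by (simp add: affine_config_def)
  then show "Q \<in> range (affine_config P E (Suc m))" by blast
qed

text \<open>A coordinate is a sum of products of \<open>n\<close> affine functions of
  \<open>y\<close>, so a form of degree \<open>d\<close> has degree at most \<open>n * d\<close> in
  each of the \<open>m\<close> parameters.\<close>

lemma indep_forms_affine_config:
  fixes P :: "'k::field config"
  assumes "indep_forms N (secant_cone n s (range (affine_config P E m))) d M"
  shows "M \<le> (n * d + 1) ^ m"
proof -
  interpret unit: graded_functions "\<lambda>d. bounded_monomials m (1 * d) :: ((nat \<Rightarrow> 'k) \<Rightarrow> 'k) set"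
    by (rule graded_bounded_monomials)
  interpret graded_functions "\<lambda>d. bounded_monomials m (n * d) :: ((nat \<Rightarrow> 'k) \<Rightarrow> 'k) set"
    by (rule graded_bounded_monomials)
  let ?\<Phi> = "\<lambda>y. segre_sum n s (affine_config P E m y)"
  have const: "(\<lambda>y :: nat \<Rightarrow> 'k. 1) \<in> bounded_monomials m e" for e
    unfolding bounded_monomials_def mem_Collect_eq by (intro exI[of _ "\<lambda>_. 0"]) simp
  have coord: "(\<lambda>y :: nat \<Rightarrow> 'k. y l) \<in> bounded_monomials m 1" if "l < m" for l
  proof -
    have "(\<Prod>i<m. y i ^ of_bool (i = l)) = (\<Prod>i<m. if i = l then y i else 1)" for y :: "nat \<Rightarrow> 'k"
      by (intro prod.cong) auto
    then have "(\<lambda>y :: nat \<Rightarrow> 'k. y l) = (\<lambda>y. \<Prod>i<m. y i ^ of_bool (i = l))" using that by simp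
    then show ?thesis unfolding bounded_monomials_def mem_Collect_eq
      by (intro exI[of _ "\<lambda>i. of_bool (i = l)"]) simp
  qed
  have entry: "(\<lambda>y. affine_config P E m y j i c) \<in> funs.span (bounded_monomials m (1 * 1))" for j i c
  proof -
    have "(\<lambda>y. P j i c * 1 + (\<Sum>l<m. E l j i c * y l)) \<in> funs.span (bounded_monomials m (1 * 1))"
      using const coord
      by (intro funs_span_add funs_span_cmult funs_span_sum funs.span_base) auto
    moreover have "(\<lambda>y. P j i c * 1 + (\<Sum>l<m. E l j i c * y l)) = (\<lambda>y. affine_config P E m y j i c)"
      by (simp add: affine_config_def mult.commute)
    ultimately show ?thesis by simp
  qed
  have segre: "(\<lambda>y. ?\<Phi> y k) \<in> funs.span (bounded_monomials m (n * 1))" for k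
  proof -
    have "(\<lambda>y. segre_vector n (affine_config P E m y j) k) \<in> funs.span (bounded_monomials m (n * 1))" for j
    proof (cases "k < 2 ^ n")
      case True
      then show ?thesis
        using unit.span_prod[of "{..<n}" "\<lambda>i y. affine_config P E m y j i (of_bool (bit k i))" "\<lambda>_. 1"] entry
        by (simp add: segre_vector_def)
    qed (simp add: segre_vector_def funs_span_zero)
    then show ?thesis unfolding segre_sum_def by (rule funs_span_sum)
  qed
  have "M \<le> card (bounded_monomials m (n * d) :: ((nat \<Rightarrow> 'k) \<Rightarrow> 'k) set)"
    by (rule indep_forms_le_card[where \<Phi> = ?\<Phi>, OF _ form_in_span[OF segre] _ assms])
      (use card_bounded_monomials in \<open>auto simp: secant_cone_def\<close>)
  also have "\<dots> \<le> (n * d + 1) ^ m" using card_bounded_monomials by blast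
  finally show ?thesis .
qed

lemma prod_first_order:
  fixes a b :: "nat \<Rightarrow> 'k::field"
  shows "\<exists>R. polyfun R \<and> (\<forall>\<tau>. (\<Prod>i<n. a i + \<tau> * b i) =
    (\<Prod>i<n. a i) + \<tau> * (\<Sum>i<n. \<Prod>i'<n. if i' = i then b i' else a i') + \<tau> ^ 2 * R \<tau>)"
proof (induction n)
  case 0
  show ?case by (intro exI[of _ "\<lambda>_. 0"]) simp
next
  case (Suc n)
  define A where "A = (\<Prod>i<n. a i)"
  define B where "B = (\<Sum>i<n. \<Prod>i'<n. if i' = i then b i' else a i')"
  obtain R where R: "polyfun R" "\<And>\<tau>. (\<Prod>i<n. a i + \<tau> * b i) = A + \<tau> * B + \<tau> ^ 2 * R \<tau>"
    using Suc.IH unfolding A_def B_def by blast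
  have "(\<Sum>i<n. \<Prod>i'<Suc n. if i' = i then b i' else a i') = B * a n"
    unfolding B_def sum_distrib_right by (intro sum.cong refl) (simp add: lessThan_Suc)
  moreover have "(\<Prod>i'<Suc n. if i' = n then b i' else a i') = A * b n"
    unfolding A_def by (simp cong: prod.cong_simp)
  ultimately have B': "(\<Sum>i<Suc n. \<Prod>i'<Suc n. if i' = i then b i' else a i') = B * a n + A * b n"
    unfolding sum.lessThan_Suc by (simp only:)
  define R' where "R' \<tau> = R \<tau> * (a n + \<tau> * b n) + B * b n" for \<tau>
  have "polyfun R'" unfolding R'_def by (intro polyfun_add polyfun_mult polyfun_const polyfun_id R(1))
  moreover have "(\<Prod>i<Suc n. a i + \<tau> * b i) = (\<Prod>i<Suc n. a i) + \<tau> * (B * a n + A * b n) + \<tau> ^ 2 * R' \<tau>" for \<tau>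
    by (simp add: R(2) R'_def flip: A_def) (simp add: algebra_simps power2_eq_square)
  ultimately show ?case unfolding B' by blast
qed

lemma segre_vector_linear_slot:
  assumes "i < n"
  shows "segre_vector n (a(i := (\<lambda>c. \<Sum>l\<in>A. y l * b l c))) k = (\<Sum>l\<in>A. y l * segre_vector n (a(i := b l)) k)"
proof (cases "k < 2 ^ n")
  case True
  have "segre_vector n (a(i := w)) k = w (of_bool (bit k i)) * (\<Prod>i'\<in>{..<n} - {i}. a i' (of_bool (bit k i')))" for w
    using True assms by (simp add: segre_vector_def prod.remove[of "{..<n}" i])
  then show ?thesis by (simp add: sum_distrib_right mult.assoc)
qed (simp add: segre_vector_def)

lemma segre_sum_first_order:
  "\<exists>R. polyfun R \<and> (\<forall>\<tau>. segre_sum n s (affine_config P E m (\<lambda>l. \<tau> * z l)) k =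
    segre_sum n s P k + \<tau> * (\<Sum>l<m. z l * segre_derivative n s P (E l) k) + \<tau> ^ 2 * R \<tau>)"
proof (cases "k < 2 ^ n")
  case True
  define b where "b j i c = (\<Sum>l<m. z l * E l j i c)" for j i c
  have cfg: "affine_config P E m (\<lambda>l. \<tau> * z l) j i c = P j i c + \<tau> * b j i c" for \<tau> j i c
    by (simp add: affine_config_def b_def sum_distrib_left mult.assoc)
  have "\<forall>j. \<exists>R. polyfun R \<and> (\<forall>\<tau>. segre_vector n (affine_config P E m (\<lambda>l. \<tau> * z l) j) k =
    segre_vector n (P j) k + \<tau> * (\<Sum>i<n. segre_vector n ((P j)(i := b j i)) k) + \<tau> ^ 2 * R \<tau>)"
  proof
    fix j
    have if_app: "((P j)(i := b j i)) i' c = (if i' = i then b j i' c else P j i' c)" for i i' c by simp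
    show "\<exists>R. polyfun R \<and> (\<forall>\<tau>. segre_vector n (affine_config P E m (\<lambda>l. \<tau> * z l) j) k =
      segre_vector n (P j) k + \<tau> * (\<Sum>i<n. segre_vector n ((P j)(i := b j i)) k) + \<tau> ^ 2 * R \<tau>)"
      using prod_first_order[of "\<lambda>i. P j i (of_bool (bit k i))" "\<lambda>i. b j i (of_bool (bit k i))" n] True
      unfolding segre_vector_def if_app cfg by simp
  qed
  then obtain R where R: "\<And>j. polyfun (R j)"
    "\<And>j \<tau>. segre_vector n (affine_config P E m (\<lambda>l. \<tau> * z l) j) k =
      segre_vector n (P j) k + \<tau> * (\<Sum>i<n. segre_vector n ((P j)(i := b j i)) k) + \<tau> ^ 2 * R j \<tau>"
    by metis
  have "(\<Sum>j<s. \<Sum>i<n. segre_vector n ((P j)(i := b j i)) k) = (\<Sum>j<s. \<Sum>i<n. \<Sum>l<m. z l * segre_vector n ((P j)(i := E l j i)) k)"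
    unfolding b_def[abs_def] by (intro sum.cong refl segre_vector_linear_slot) simp
  also have "\<dots> = (\<Sum>j<s. \<Sum>l<m. \<Sum>i<n. z l * segre_vector n ((P j)(i := E l j i)) k)"
    by (intro sum.cong refl sum.swap)
  also have "\<dots> = (\<Sum>l<m. \<Sum>j<s. \<Sum>i<n. z l * segre_vector n ((P j)(i := E l j i)) k)"
    by (rule sum.swap)
  also have "\<dots> = (\<Sum>l<m. z l * segre_derivative n s P (E l) k)"
    by (simp add: segre_derivative_def sum_distrib_left)
  finally have D: "(\<Sum>j<s. \<Sum>i<n. segre_vector n ((P j)(i := b j i)) k) =
    (\<Sum>l<m. z l * segre_derivative n s P (E l) k)" .
  have "segre_sum n s (affine_config P E m (\<lambda>l. \<tau> * z l)) k =
    segre_sum n s P k + \<tau> * (\<Sum>l<m. z l * segre_derivative n s P (E l) k) + \<tau> ^ 2 * (\<Sum>j<s. R j \<tau>)" for \<tau>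
    unfolding D[symmetric] by (simp add: segre_sum_def R(2) sum.distrib sum_distrib_left)
  moreover have "polyfun (\<lambda>\<tau>. \<Sum>j<s. R j \<tau>)" by (intro polyfun_sum R(1))
  ultimately show ?thesis by blast
qed (auto simp: segre_sum_def segre_derivative_def segre_vector_def intro!: exI[of _ "\<lambda>_. 0"])


text \<open>\<open>u 0\<close> is a vector of the cone and the other \<open>u m\<close> are
  derivatives there. Functionals dual to them make \<open>indep_forms_leading_terms\<close>
  applicable to each family, and the inclusions in the chain are strict because the orders of growth
  of consecutive members differ.\<close>

lemma proj_dim_ge:
  fixes P :: "'k::field_char_0 config" and E :: "nat \<Rightarrow> 'k config" and n s r :: nat
  defines "N \<equiv> 2 ^ n - 1"
  defines "u \<equiv> (\<lambda>m. case m of 0 \<Rightarrow> segre_sum n s P | Suc l \<Rightarrow> segre_derivative n s P (E l))"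
  assumes dual: "\<And>m. m \<le> r \<Longrightarrow> \<exists>a. \<forall>m'\<le>r. (\<Sum>k\<le>N. a k * u m' k) = of_bool (m = m')"
  shows "enat r \<le> proj_dim N (zariski N closure_of points (secant_cone n s (UNIV :: 'k config set)))"
proof -
  have "\<forall>m. \<exists>a. m \<le> r \<longrightarrow> (\<forall>m'\<le>r. (\<Sum>k\<le>N. a k * u m' k) = of_bool (m = m'))" using dual by blast
  then obtain a where a: "\<And>m m'. m \<le> r \<Longrightarrow> m' \<le> r \<Longrightarrow> (\<Sum>k\<le>N. a m k * u m' k) = of_bool (m = m')" by metis
  define W where "W m = secant_cone n s (range (affine_config P E m))" for m
  define Z where "Z m = zariski N closure_of points (W m)" for m
  define Y where "Y = zariski N closure_of points (secant_cone n s (UNIV :: 'k config set))"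
  have W: "W m \<subseteq> coord_space N - {0}" for m unfolding W_def N_def by (rule secant_cone_subset)
  have expand: "\<exists>R. polyfun R \<and> (\<forall>\<tau>. (\<Sum>k\<le>N. a m' k * segre_sum n s (affine_config P E m (\<lambda>l. \<tau> * z l)) k)
      = of_bool (m' = 0) + \<tau> * (\<Sum>l<m. z l * of_bool (m' = Suc l)) + \<tau> ^ 2 * R \<tau>)"
    if m: "m \<le> r" "m' \<le> r" for m m' z
  proof -
    obtain R where R: "\<And>k. polyfun (R k)" "\<And>k \<tau>. segre_sum n s (affine_config P E m (\<lambda>l. \<tau> * z l)) k =
        u 0 k + \<tau> * (\<Sum>l<m. z l * u (Suc l) k) + \<tau> ^ 2 * R k \<tau>"
      using segre_sum_first_order[of n s P E m z] unfolding u_def by simp metis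
    have "(\<Sum>k\<le>N. a m' k * (u 0 k + \<tau> * (\<Sum>l<m. z l * u (Suc l) k) + \<tau> ^ 2 * R k \<tau>)) =
      (\<Sum>k\<le>N. a m' k * u 0 k) + \<tau> * (\<Sum>l<m. z l * (\<Sum>k\<le>N. a m' k * u (Suc l) k)) + \<tau> ^ 2 * (\<Sum>k\<le>N. a m' k * R k \<tau>)" for \<tau>
    proof -
      have "(\<Sum>k\<le>N. a m' k * (\<tau> * (\<Sum>l<m. z l * u (Suc l) k))) = (\<Sum>k\<le>N. \<Sum>l<m. \<tau> * (z l * (a m' k * u (Suc l) k)))"
        by (simp add: sum_distrib_left mult.left_commute)
      also have "\<dots> = (\<Sum>l<m. \<Sum>k\<le>N. \<tau> * (z l * (a m' k * u (Suc l) k)))" by (rule sum.swap)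
      finally show ?thesis
        by (simp add: distrib_left sum.distrib sum_distrib_left mult.left_commute)
    qed
    also have "(\<Sum>l<m. z l * (\<Sum>k\<le>N. a m' k * u (Suc l) k)) = (\<Sum>l<m. z l * of_bool (m' = Suc l))"
      using a m by (intro sum.cong refl) simp
    also have "(\<Sum>k\<le>N. a m' k * u 0 k) = of_bool (m' = 0)" using a m by simp
    finally have "(\<Sum>k\<le>N. a m' k * segre_sum n s (affine_config P E m (\<lambda>l. \<tau> * z l)) k)
      = of_bool (m' = 0) + \<tau> * (\<Sum>l<m. z l * of_bool (m' = Suc l)) + \<tau> ^ 2 * (\<Sum>k\<le>N. a m' k * R k \<tau>)" for \<tau>
      unfolding R(2) .
    moreover have "polyfun (\<lambda>\<tau>. \<Sum>k\<le>N. a m' k * R k \<tau>)" by (intro polyfun_sum polyfun_mult polyfun_const R(1))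
    ultimately show ?thesis by blast
  qed
  have low: "indep_forms N (W m) (m * D) ((D + 1) ^ m)" if m: "m \<le> r" for m D
  proof -
    have "indep_forms N (range (\<lambda>y. segre_sum n s (affine_config P E m y)) - {0}) (m * D) ((D + 1) ^ m)"
    proof (rule indep_forms_leading_terms[where a = a])
      fix z :: "nat \<Rightarrow> 'k"
      obtain R where R: "polyfun R" "\<And>\<tau>. (\<Sum>k\<le>N. a 0 k * segre_sum n s (affine_config P E m (\<lambda>l. \<tau> * z l)) k)
        = 1 + \<tau> ^ 2 * R \<tau>" using expand[OF m, of 0 z] by auto
      show "\<exists>R. polyfun R \<and> R 0 = 1 \<and> (\<forall>\<tau>. (\<Sum>k\<le>N. a 0 k * segre_sum n s (affine_config P E m (\<lambda>l. \<tau> * z l)) k) = R \<tau>)"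
        by (rule exI[of _ "\<lambda>\<tau>. 1 + \<tau> ^ 2 * R \<tau>"])
          (auto simp: R(2) intro!: polyfun_add polyfun_mult polyfun_power R(1))
    next
      fix l and z :: "nat \<Rightarrow> 'k" assume l: "l < m"
      have "(\<Sum>l'<m. z l' * of_bool (Suc l = Suc l')) = (\<Sum>l'<m. if l' = l then z l' else 0)"
        by (intro sum.cong) auto
      also have "\<dots> = z l" using l by simp
      finally have "(\<Sum>l'<m. z l' * of_bool (Suc l = Suc l')) = z l" .
      then obtain R where R: "polyfun R" "\<And>\<tau>. (\<Sum>k\<le>N. a (Suc l) k * segre_sum n s (affine_config P E m (\<lambda>l. \<tau> * z l)) k)
        = \<tau> * z l + \<tau> ^ 2 * R \<tau>" using expand[OF m, of "Suc l" z] l m by auto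
      show "\<exists>R. polyfun R \<and> R 0 = z l \<and>
        (\<forall>\<tau>. (\<Sum>k\<le>N. a (Suc l) k * segre_sum n s (affine_config P E m (\<lambda>l. \<tau> * z l)) k) = \<tau> * R \<tau>)"
        by (rule exI[of _ "\<lambda>\<tau>. z l + \<tau> * R \<tau>"])
          (auto simp: R(2) power2_eq_square algebra_simps intro!: polyfun_add polyfun_mult R(1))
    qed
    then show ?thesis unfolding W_def secant_cone_def by (simp add: image_image)
  qed
  have "u 0 \<noteq> 0"
  proof
    assume "u 0 = 0"
    then have "(\<Sum>k\<le>N. a 0 k * u 0 k) = 0" by simp
    then show False using a[of 0 0] by simp
  qed
  moreover have "P = affine_config P E m (\<lambda>_. 0)" for m by (simp add: affine_config_def)
  ultimately have "u 0 \<in> W m" for m unfolding W_def secant_cone_def u_def by simp blast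
  then have irred: "irreducible_space (subtopology (zariski N) (Z m))" for m
    unfolding Z_def W_def N_def
    by (intro irreducible_closure) (auto simp: affine_config_line)
  have closed: "closedin (zariski N) (Z m)" for m unfolding Z_def by simp
  have "W m \<subseteq> W (Suc m)" for m
    unfolding W_def secant_cone_def using affine_config_Suc[of P E m] by blast
  then have mono: "Z m \<subseteq> Z (Suc m)" for m
    unfolding Z_def points_def by (intro closure_of_mono image_mono)
  have ZY: "Z m \<subseteq> Y" for m
    unfolding Z_def Y_def points_def W_def secant_cone_def by (intro closure_of_mono image_mono) auto
  have strict: "Z m \<noteq> Z (Suc m)" if m: "Suc m \<le> r" for m
  proof
    assume eq: "Z m = Z (Suc m)"
    have "points (W (Suc m)) \<subseteq> Z (Suc m)"
      unfolding Z_def using W vspan_in_proj_space by (intro closure_of_subset) (auto simp: points_def)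
    then have cone: "W (Suc m) \<subseteq> cone N (Z m)" using W unfolding eq cone_def points_def by blast
    \<comment> \<open>With \<open>D = c ^ m\<close> one has
      \<open>(c * (D + 1)) ^ m = D * (D + 1) ^ m\<close>, just below
      \<open>(D + 1) ^ Suc m\<close>.\<close>
    define c where "c = n * Suc m + 1"
    define D where "D = c ^ m"
    have "indep_forms N (cone N (Z m)) (Suc m * D) ((D + 1) ^ Suc m)"
      using indep_forms_mono[OF low[OF m] cone] .
    then have "indep_forms N (W m) (Suc m * D) ((D + 1) ^ Suc m)"
      by (rule indep_forms_closure[OF W, rotated]) (simp add: Z_def)
    then have "(D + 1) ^ Suc m \<le> (n * (Suc m * D) + 1) ^ m"
      unfolding W_def by (rule indep_forms_affine_config)
    also have "\<dots> \<le> (c * (D + 1)) ^ m"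
      by (intro power_mono) (auto simp: c_def algebra_simps)
    also have "\<dots> = D * (D + 1) ^ m" unfolding power_mult_distrib D_def ..
    also have "\<dots> < (D + 1) * (D + 1) ^ m" by simp
    finally show False by simp
  qed
  have sub: "subtopology (subtopology (zariski N) Y) (Z m) = subtopology (zariski N) (Z m)" for m
    using ZY[of m] by (simp add: subtopology_subtopology Int_absorb1)
  have "closedin (subtopology (zariski N) Y) (Z m)" for m
    using closed ZY by (meson closedin_subset_topspace closedin_closed_subtopology closedin_subtopology_Int_closed inf.absorb_iff2 inf_commute)
  then have "\<exists>Z. (\<forall>i\<le>r. closedin (subtopology (zariski N) Y) (Z i) \<and>
      irreducible_space (subtopology (subtopology (zariski N) Y) (Z i))) \<and> (\<forall>i<r. Z i \<subset> Z (Suc i))"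
    using irred mono strict by (intro exI[of _ Z]) (auto simp: sub psubset_eq)
  then show ?thesis
    unfolding proj_dim_def krull_dim_def Y_def[symmetric] by (intro Sup_upper) blast
qed

section \<open>Linear functionals and Terracini's lemma\<close>

lemma functional_extend:
  fixes f :: "(nat \<Rightarrow> 'k::field) \<Rightarrow> 'k"
  assumes "vec.independent B"
  obtains g where "Vector_Spaces.linear vscale (*) g" "\<And>b. b \<in> B \<Longrightarrow> g b = f b"
proof -
  interpret vector_space_pair vscale "(*) :: 'k \<Rightarrow> 'k \<Rightarrow> 'k"
    by unfold_locales (auto simp: algebra_simps)
  show ?thesis using linear_independent_extend[OF assms, of f] that by blast
qed

lemma functional_coords:
  fixes g :: "(nat \<Rightarrow> 'k::field) \<Rightarrow> 'k"
  assumes g: "Vector_Spaces.linear vscale (*) g" and v: "v \<in> coord_space N"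
  shows "g v = (\<Sum>k\<le>N. g (unit_vec k) * v k)"
proof -
  interpret Vector_Spaces.linear vscale "(*)" g by (rule g)
  have "v i = (\<Sum>k\<le>N. vscale (v k) (unit_vec k)) i" for i
  proof -
    have "(\<Sum>k\<le>N. vscale (v k) (unit_vec k)) i = (\<Sum>k\<le>N. if k = i then v k else 0)"
      unfolding sum_fun_apply by (intro sum.cong) (auto simp: vscale_def unit_vec_def)
    then show ?thesis using v by (auto simp: coord_space_def not_le)
  qed
  then have "v = (\<Sum>k\<le>N. vscale (v k) (unit_vec k))" by blast
  then have "g v = g (\<Sum>k\<le>N. vscale (v k) (unit_vec k))" by simp
  also have "\<dots> = (\<Sum>k\<le>N. g (unit_vec k) * v k)"
    unfolding sum by (intro sum.cong refl) (simp add: scale mult.commute)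
  finally show ?thesis .
qed

lemma separating_functional:
  fixes S :: "(nat \<Rightarrow> 'k::field) set"
  assumes "e \<notin> vspan S"
  obtains g where "Vector_Spaces.linear vscale (*) g" "g e = 1" "\<And>b. b \<in> vspan S \<Longrightarrow> g b = 0"
proof -
  obtain B where B: "B \<subseteq> S" "vec.independent B" "S \<subseteq> vspan B"
    using vec.maximal_independent_subset by blast
  have SB: "vspan S \<subseteq> vspan B" using vec.span_minimal[OF B(3) vec.subspace_span] .
  moreover have "vspan B \<subseteq> vspan S" using vec.span_mono[OF B(1)] .
  ultimately have e: "e \<notin> vspan B" using assms by blast
  obtain g where g: "Vector_Spaces.linear vscale (*) g" "\<And>b. b \<in> insert e B \<Longrightarrow> g b = of_bool (b = e)"
    using functional_extend[OF vec.independent_insertI[OF e B(2)], of "\<lambda>b. of_bool (b = e)"] by blast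
  interpret linear: Vector_Spaces.linear vscale "(*)" g by (rule g)
  have "g b = 0" if "b \<in> vspan B" for b
  proof (rule vec.span_induct[OF that])
    show "vec.subspace {x. g x = 0}"
      by (rule vec.subspaceI) (auto simp: linear.zero linear.add linear.scale)
  next
    fix x assume "x \<in> B"
    moreover then have "x \<noteq> e" using e vec.span_base by blast
    ultimately show "g x = 0" using g(2)[of x] by simp
  qed
  then show ?thesis using that[of g] g(1) g(2)[of e] SB by auto
qed

lemma independent_unit_vec: "vec.independent (unit_vec ` A :: (nat \<Rightarrow> 'k::field) set)"
proof
  assume "vec.dependent (unit_vec ` A :: (nat \<Rightarrow> 'k) set)"
  then obtain k where k: "k \<in> A" "(unit_vec k :: nat \<Rightarrow> 'k) \<in> vspan (unit_vec ` A - {unit_vec k})"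
    unfolding vec.dependent_def by blast
  have "(unit_vec k :: nat \<Rightarrow> 'k) k = 0"
  proof (rule vec.span_induct[OF k(2)])
    show "vec.subspace {v :: nat \<Rightarrow> 'k. v k = 0}" by (rule vec.subspaceI) (auto simp: vscale_def)
  next
    fix x :: "nat \<Rightarrow> 'k" assume "x \<in> unit_vec ` A - {unit_vec k}"
    then show "x k = 0" by (auto simp: unit_vec_def)
  qed
  then show False by simp
qed

lemma inj_unit_vec: "inj (unit_vec :: nat \<Rightarrow> nat \<Rightarrow> 'k::field)"
proof (rule injI)
  fix c d assume "(unit_vec c :: nat \<Rightarrow> 'k) = unit_vec d"
  then have "(unit_vec c :: nat \<Rightarrow> 'k) c = unit_vec d c" by simp
  then show "c = d" by (simp add: unit_vec_def split: if_splits)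
qed

text \<open>Identifies multilinear forms with functionals on the ambient space, so that the
  conditions in \<open>determines\<close> become statements about spans.\<close>

lemma tform_functional:
  fixes g :: "(nat \<Rightarrow> 'k::field) \<Rightarrow> 'k"
  assumes "Vector_Spaces.linear vscale (*) g"
  shows "tform n (\<lambda>k. g (unit_vec k)) a = g (segre_vector n a)"
proof -
  have "{..2 ^ n - 1} = {..<2 ^ n :: nat}"
    using lessThan_Suc_atMost[of "2 ^ n - 1"] by simp
  then show ?thesis
    using functional_coords[OF assms segre_vector_in_coord_space[of n a]]
    by (simp add: tform_def mult.commute)
qed

definition unit_config :: "nat \<Rightarrow> nat \<Rightarrow> nat \<Rightarrow> 'k::field config" where
  "unit_config j i c = (\<lambda>j' i' c'. of_bool (j' = j \<and> i' = i \<and> c' = c))"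

lemma segre_derivative_unit:
  fixes P :: "'k::field config"
  assumes "j < s" "i < n"
  shows "segre_derivative n s P (unit_config j i c) = segre_vector n ((P j)(i := unit_vec c))"
proof
  fix k
  have "segre_vector n ((P j')(i' := unit_config j i c j' i')) k =
    (if j' = j then if i' = i then segre_vector n ((P j)(i := unit_vec c)) k else 0 else 0)"
    if "i' < n" for j' i'
  proof (cases "j' = j \<and> i' = i")
    case True
    then have "unit_config j i c j' i' = (unit_vec c :: nat \<Rightarrow> 'k)" by (simp add: unit_config_def unit_vec_def)
    then show ?thesis using True by simp
  next
    case False
    then have "unit_config j i c j' i' = (\<lambda>_. 0 :: 'k)" by (auto simp: unit_config_def)
    then show ?thesis using False that by (auto simp: segre_vector_def)
  qed
  then have "segre_derivative n s P (unit_config j i c) k =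
    (\<Sum>j'<s. \<Sum>i'<n. if j' = j then if i' = i then segre_vector n ((P j)(i := unit_vec c)) k else 0 else 0)"
    unfolding segre_derivative_def by (intro sum.cong refl) simp
  also have "\<dots> = (\<Sum>j'<s. if j' = j then segre_vector n ((P j)(i := unit_vec c)) k else 0)"
    using assms(2) by (intro sum.cong refl) simp
  also have "\<dots> = segre_vector n ((P j)(i := unit_vec c)) k" using assms(1) by simp
  finally show "segre_derivative n s P (unit_config j i c) k = segre_vector n ((P j)(i := unit_vec c)) k" .
qed

lemma generic_segre_sum_nonzero:
  assumes "1 \<le> s"
  shows "generic (\<lambda>P :: nat \<Rightarrow> nat \<Rightarrow> nat \<Rightarrow> 'k::field_char_0. segre_sum n s P \<noteq> 0)"
  unfolding generic_def
proof (intro conjI allI impI)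
  have "segre_sum n s (\<lambda>_ _ _. 1 :: 'k) 0 = of_nat s" by (simp add: segre_sum_def segre_vector_def)
  then have "segre_sum n s (\<lambda>_ _ _. 1 :: 'k) \<noteq> 0" using assms by (metis of_nat_eq_0_iff not_one_le_zero zero_fun_apply)
  then show "\<exists>P :: nat \<Rightarrow> nat \<Rightarrow> nat \<Rightarrow> 'k. segre_sum n s P \<noteq> 0" by blast
next
  fix P Q :: "'k config" assume "segre_sum n s P \<noteq> 0"
  then obtain k where "segre_sum n s P k \<noteq> 0" by (auto simp: fun_eq_iff)
  then have "finite {\<tau>. segre_sum n s (line P Q \<tau>) k = 0}"
    using polyfun_finite_zeros[OF polyfun_segre_sum_line[of n s P Q k], of 0] by simp
  moreover have "{\<tau>. \<not> segre_sum n s (line P Q \<tau>) \<noteq> 0} \<subseteq> {\<tau>. segre_sum n s (line P Q \<tau>) k = 0}" by auto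
  ultimately show "finite {\<tau>. \<not> segre_sum n s (line P Q \<tau>) \<noteq> 0}" by (rule rev_finite_subset)
qed

text \<open>By duality: a functional that vanishes on the span but not at \<open>unit_vec k\<close>
  would be a nonzero form with all the prescribed zeros.\<close>

lemma tangent_span:
  fixes P :: "'k::field config"
  assumes n: "1 \<le> n" and det: "determines n P {..<s} {s..<s + t}"
    and B: "(\<lambda>(j, i, c). segre_vector n ((P j)(i := unit_vec c))) ` ({..<s} \<times> {..<n} \<times> {..<2}) \<subseteq> vspan B"
    and k: "k < 2 ^ n"
  shows "unit_vec k \<in> vspan (B \<union> (\<lambda>j. segre_vector n (P j)) ` {s..<s + t})" (is "_ \<in> vspan ?S")
proof (rule ccontr)
  assume "unit_vec k \<notin> vspan ?S"
  then obtain g where g: "Vector_Spaces.linear vscale (*) g" "g (unit_vec k) = 1"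
    "\<And>b. b \<in> vspan ?S \<Longrightarrow> g b = 0" using separating_functional by blast
  define f where "f i = g (unit_vec i)" for i
  have tf: "tform n f a = g (segre_vector n a)" for a
    unfolding f_def[abs_def] by (rule tform_functional[OF g(1)])
  have BS: "vspan B \<subseteq> vspan ?S" by (intro vec.span_mono) simp
  have tangent: "segre_vector n ((P j)(i := unit_vec c)) \<in> vspan ?S" if "j < s" "i < n" "c < 2" for j i c
  proof -
    have "(j, i, c) \<in> {..<s} \<times> {..<n} \<times> {..<2}" using that by simp
    from subsetD[OF B imageI[OF this]] show ?thesis using BS by auto
  qed
  have "segre_vector n (P j) \<in> vspan ?S" if j: "j < s" for j
  proof -
    \<comment> \<open>Euler's relation: the point itself is a combination of its tangent vectors in
      the factor 0.\<close>
    have "segre_vector n (P j) = segre_vector n ((P j)(0 := \<lambda>d. \<Sum>c<2. P j 0 c * unit_vec c d))"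
    proof (rule segre_vector_cong)
      fix i c :: nat assume "i < n" "c < 2"
      have "(\<Sum>c'<2. P j 0 c' * unit_vec c' c) = P j 0 c"
        using \<open>c < 2\<close> by (cases c) (simp_all add: unit_vec_def numeral_2_eq_2)
      then show "P j i c = ((P j)(0 := \<lambda>d. \<Sum>c<2. P j 0 c * unit_vec c d)) i c" by simp
    qed
    also have "\<dots> = (\<Sum>c<2. vscale (P j 0 c) (segre_vector n ((P j)(0 := unit_vec c))))"
      using n by (intro ext) (simp add: segre_vector_linear_slot sum_fun_apply vscale_def)
    also have "\<dots> \<in> vspan ?S"
      using n by (intro vec.span_sum vec.span_scale tangent j) auto
    finally show ?thesis .
  qed
  then have "double_zero n f (P j)" if "j < s" for j
    unfolding double_zero_def tangent_points_def tf using that tangent g(3) by auto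
  moreover have "tform n f (P j) = 0" if "j \<in> {s..<s + t}" for j
    unfolding tf using that by (intro g(3) vec.span_base) auto
  ultimately have "f k = 0" using det k unfolding determines_def by blast
  then show False using g(2) by (simp add: f_def)
qed

text \<open>The tangent vectors and \<open>t\<close> further vectors span \<open>2 ^ n\<close>
  dimensions, so at least \<open>2 ^ n - t\<close> tangent vectors are independent. A basis
  containing the point itself leaves \<open>r\<close> derivatives besides it.\<close>

lemma solvable_imp_dual:
  assumes solv: "solvable TYPE('k::field_char_0) n s t" and n: "1 \<le> n" and s: "1 \<le> s" and t: "t < 2 ^ n"
  defines "r \<equiv> 2 ^ n - t - 1"
  obtains P :: "'k::field_char_0 config" and E where
    "\<And>m. m \<le> r \<Longrightarrow> \<exists>a. \<forall>m'\<le>r. (\<Sum>k\<le>2 ^ n - 1. a k *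
      (case m' of 0 \<Rightarrow> segre_sum n s P | Suc l \<Rightarrow> segre_derivative n s P (E l)) k) = of_bool (m = m')"
proof -
  obtain P0 :: "'k config" where "determines n P0 {..<s} {s..<s + t}"
    using solv unfolding solvable_def by blast
  then have "generic (\<lambda>P :: nat \<Rightarrow> nat \<Rightarrow> nat \<Rightarrow> 'k. determines n P {..<s} {s..<s + t})"
    by (rule generic_determines)
  from generic_ex[OF generic_conj[OF this generic_segre_sum_nonzero[OF s, of n]]]
  obtain P :: "'k config" where P: "determines n P {..<s} {s..<s + t}" "segre_sum n s P \<noteq> 0"
    by blast
  define X :: "(nat \<times> nat \<times> nat) set" where "X = {..<s} \<times> {..<n} \<times> {..<2}"
  define w where "w = (\<lambda>(j, i, c). segre_vector n ((P j)(i := unit_vec c)))"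
  define v0 where "v0 = segre_sum n s P"
  have "vec.independent {v0}" using P(2) by (simp add: v0_def)
  \<comment> \<open>The basis is grown from \<open>v0\<close>, since the point itself has to play
    the role of index 0.\<close>
  then obtain B where B: "v0 \<in> B" "B \<subseteq> insert v0 (w ` X)" "vec.independent B" "insert v0 (w ` X) \<subseteq> vspan B"
    using vec.maximal_independent_subset_extend[of "{v0}" "insert v0 (w ` X)"] by auto
  have finB: "finite B" by (rule finite_subset[OF B(2)]) (simp add: X_def)
  define V2 where "V2 = (\<lambda>j. segre_vector n (P j)) ` {s..<s + t}"
  have "w ` X \<subseteq> vspan B" using B(4) by simp
  then have "unit_vec ` {..<2 ^ n} \<subseteq> vspan (B \<union> V2)"
    unfolding V2_def w_def X_def using tangent_span[OF n P(1)] by blast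
  moreover have "finite (B \<union> V2)" using finB by (simp add: V2_def)
  ultimately have "card (unit_vec ` {..<2 ^ n} :: (nat \<Rightarrow> 'k) set) \<le> card (B \<union> V2)"
    using vec.independent_span_bound independent_unit_vec by blast
  also have "\<dots> \<le> card B + card V2" by (rule card_Un_le)
  also have "card V2 \<le> t" unfolding V2_def using card_image_le[of "{s..<s + t}"] by fastforce
  finally have "2 ^ n \<le> card B + t" by (simp add: card_image inj_on_subset[OF inj_unit_vec])
  then have "r \<le> card (B - {v0})" using B(1) by (simp add: r_def)
  then obtain B' where B': "B' \<subseteq> B - {v0}" "card B' = r" using obtain_subset_with_card_n by metis
  then have "finite B'" using finB finite_subset by blast
  then obtain h where h: "bij_betw h {..<r} B'"
    using ex_bij_betw_nat_finite[of B'] B'(2) by (auto simp: atLeast0LessThan)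
  have hB: "h l \<in> B - {v0}" if "l < r" for l using h B'(1) that by (auto simp: bij_betw_def)
  have "\<exists>E. h l = segre_derivative n s P E" if "l < r" for l
  proof -
    have "h l \<in> w ` X" using hB[OF that] B(2) by blast
    then obtain j i c where "j < s" "i < n" "h l = segre_vector n ((P j)(i := unit_vec c))"
      unfolding w_def X_def by auto
    then show ?thesis using segre_derivative_unit by metis
  qed
  then obtain E where E: "\<And>l. l < r \<Longrightarrow> h l = segre_derivative n s P (E l)" by metis
  define u where "u m = (case m of 0 \<Rightarrow> segre_sum n s P | Suc l \<Rightarrow> segre_derivative n s P (E l))" for m
  have u: "u 0 = v0" "\<And>l. l < r \<Longrightarrow> u (Suc l) = h l" by (simp_all add: u_def v0_def E)
  have uB: "u m \<in> B" if "m \<le> r" for m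
    using that B(1) hB u by (cases m) auto
  have inj: "u m = u m' \<longleftrightarrow> m = m'" if "m \<le> r" "m' \<le> r" for m m'
  proof -
    have "h l = h l' \<longleftrightarrow> l = l'" if "l < r" "l' < r" for l l'
      using h that by (auto simp: bij_betw_def inj_on_def)
    moreover have "h l \<noteq> v0" "v0 \<noteq> h l" if "l < r" for l using hB[OF that] by auto
    ultimately show ?thesis using that by (cases m; cases m') (simp_all add: u)
  qed
  have u_coord: "u m \<in> coord_space (2 ^ n - 1)" if "m \<le> r" for m
  proof -
    have "segre_derivative n s P E \<in> coord_space (2 ^ n - 1)" for E
      by (auto simp: segre_derivative_def coord_space_def segre_vector_def intro!: sum.neutral)
    then show ?thesis using segre_sum_in_coord_space[of n s P] by (cases m) (simp_all add: u_def)
  qed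
  have "\<exists>a. \<forall>m'\<le>r. (\<Sum>k\<le>2 ^ n - 1. a k * u m' k) = of_bool (m = m')" if m: "m \<le> r" for m
  proof -
    obtain g where g: "Vector_Spaces.linear vscale (*) g" "\<And>b. b \<in> B \<Longrightarrow> g b = of_bool (b = u m)"
      using functional_extend[OF B(3), of "\<lambda>b. of_bool (b = u m)"] by blast
    have "(\<Sum>k\<le>2 ^ n - 1. g (unit_vec k) * u m' k) = of_bool (m = m')" if "m' \<le> r" for m'
    proof -
      have "(\<Sum>k\<le>2 ^ n - 1. g (unit_vec k) * u m' k) = g (u m')"
        by (rule functional_coords[OF g(1) u_coord[OF that], symmetric])
      also have "\<dots> = of_bool (u m' = u m)" by (rule g(2)[OF uB[OF that]])
      also have "\<dots> = of_bool (m = m')" unfolding inj[OF that m] by (simp only: eq_commute)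
      finally show ?thesis .
    qed
    then show ?thesis by (intro exI[of _ "\<lambda>k. g (unit_vec k)"]) blast
  qed
  then show ?thesis unfolding u_def by (rule that)
qed

section \<open>The third secant variety of the fourfold product\<close>

lemma segre_vector_4:
  "k < 16 \<Longrightarrow> segre_vector 4 a k = a 0 (of_bool (odd k)) * a 1 (of_bool (odd (k div 2))) *
    a 2 (of_bool (odd (k div 4))) * a 3 (of_bool (odd (k div 8)))"
proof -
  have "{..<4} = {0, 1, 2, 3 :: nat}" by auto
  then show "k < 16 \<Longrightarrow> segre_vector 4 a k = a 0 (of_bool (odd k)) * a 1 (of_bool (odd (k div 2))) *
    a 2 (of_bool (odd (k div 4))) * a 3 (of_bool (odd (k div 8)))"
    by (simp add: segre_vector_def bit_iff_odd)
qed

text \<open>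
  The rows and columns of the two \<open>4 \<times> 4\<close> flattenings; in the second one the columns are permuted,
  so that the leading monomial of its determinant is on the diagonal, too.
\<close>

definition flat1 :: "nat \<Rightarrow> nat \<Rightarrow> nat" where
  "flat1 r c = r + 4 * c"

definition flat2 :: "nat \<Rightarrow> nat \<Rightarrow> nat" where
  "flat2 r c = r mod 2 + 4 * (r div 2) + 2 * (1 - c mod 2) + 8 * (c div 2)"

lemma segre_vector_flat1:
  assumes "r < 4" "c < 4"
  shows "segre_vector 4 a (flat1 r c) = a 0 (r mod 2) * a 1 (r div 2) * (a 2 (c mod 2) * a 3 (c div 2))"
proof -
  have "r \<in> {0, 1, 2, 3}" "c \<in> {0, 1, 2, 3}" using assms by auto
  then show ?thesis by (elim insertE emptyE) (simp_all add: segre_vector_4 flat1_def)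
qed

lemma segre_vector_flat2:
  assumes "r < 4" "c < 4"
  shows "segre_vector 4 a (flat2 r c) = a 0 (r mod 2) * a 2 (r div 2) * (a 1 (1 - c mod 2) * a 3 (c div 2))"
proof -
  have "r \<in> {0, 1, 2, 3}" "c \<in> {0, 1, 2, 3}" using assms by auto
  then show ?thesis by (elim insertE emptyE) (simp_all add: segre_vector_4 flat2_def)
qed

text \<open>Composition with the transposition of the equal rows reverses the sign, so the sum is
  its own negative. Determinants are kept as Leibniz sums because their terms are the monomials of
  the later reduction.\<close>

lemma det_equal_rows:
  fixes q :: "nat \<Rightarrow> nat \<Rightarrow> 'k::field_char_0"
  assumes ab: "a < n" "b < n" "a \<noteq> b" and eq: "f a = f b"
  shows "(\<Sum>\<pi> | \<pi> permutes {..<n}. of_int (sign \<pi>) * (\<Prod>r<n. q (f r) (\<pi> r))) = 0"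
proof -
  let ?t = "Transposition.transpose a b"
  let ?F = "\<lambda>\<pi>. of_int (sign \<pi>) * (\<Prod>r<n. q (f r) (\<pi> r))"
  have t: "?t permutes {..<n}" using ab by (intro permutes_swap_id) auto
  have "(\<Sum>\<pi> | \<pi> permutes {..<n}. ?F \<pi>) = (\<Sum>\<pi> | \<pi> permutes {..<n}. ?F (\<pi> \<circ> ?t))"
    by (rule sum_permutations_compose_right[OF t])
  also have "\<dots> = (\<Sum>\<pi> | \<pi> permutes {..<n}. - ?F \<pi>)"
  proof (rule sum.cong[OF refl])
    fix \<pi> assume "\<pi> \<in> {\<pi>. \<pi> permutes {..<n}}"
    then have \<pi>: "\<pi> permutes {..<n}" by simp
    have "permutation \<pi>" "permutation ?t" using \<pi> t permutation_permutes by blast+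
    then have "sign (\<pi> \<circ> ?t) = - sign \<pi>" using ab by (simp add: sign_compose sign_swap_id)
    moreover have "(\<Prod>r<n. q (f r) ((\<pi> \<circ> ?t) r)) = (\<Prod>r<n. q (f (?t r)) (\<pi> (?t r)))"
      by (intro prod.cong refl) (use eq in \<open>auto simp: Transposition.transpose_def\<close>)
    moreover have "\<dots> = (\<Prod>r<n. q (f r) (\<pi> r))"
      by (rule prod.permute[OF t, symmetric, unfolded o_def])
    ultimately show "?F (\<pi> \<circ> ?t) = - ?F \<pi>" by simp
  qed
  finally show ?thesis by (simp add: sum_negf)
qed

text \<open>Expanding every row chooses one of \<open>m\<close> summands for each of
  \<open>n\<close> rows; two rows always choose the same one.\<close>

lemma det_low_rank:
  fixes p q :: "nat \<Rightarrow> nat \<Rightarrow> 'k::field_char_0"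
  assumes "m < n"
  shows "(\<Sum>\<pi> | \<pi> permutes {..<n}. of_int (sign \<pi>) * (\<Prod>r<n. \<Sum>j<m. p j r * q j (\<pi> r))) = 0"
proof -
  let ?\<Phi> = "PiE {..<n} (\<lambda>_. {..<m})"
  have "(\<Sum>\<pi> | \<pi> permutes {..<n}. of_int (sign \<pi>) * (\<Prod>r<n. \<Sum>j<m. p j r * q j (\<pi> r))) =
    (\<Sum>\<pi> | \<pi> permutes {..<n}. \<Sum>f\<in>?\<Phi>. of_int (sign \<pi>) * (\<Prod>r<n. p (f r) r * q (f r) (\<pi> r)))"
    by (simp add: prod_sum_PiE sum_distrib_left)
  also have "\<dots> = (\<Sum>f\<in>?\<Phi>. \<Sum>\<pi> | \<pi> permutes {..<n}. of_int (sign \<pi>) * (\<Prod>r<n. p (f r) r * q (f r) (\<pi> r)))"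
    by (rule sum.swap)
  also have "\<dots> = (\<Sum>f\<in>?\<Phi>. (\<Prod>r<n. p (f r) r) * (\<Sum>\<pi> | \<pi> permutes {..<n}. of_int (sign \<pi>) * (\<Prod>r<n. q (f r) (\<pi> r))))"
    by (simp add: prod.distrib sum_distrib_left mult.left_commute)
  also have "\<dots> = 0"
  proof (rule sum.neutral, rule ballI)
    fix f assume "f \<in> ?\<Phi>"
    then have "f ` {..<n} \<subseteq> {..<m}" by auto
    then have "\<not> inj_on f {..<n}" using assms card_inj_on_le[of f "{..<n}" "{..<m}"] by auto
    then obtain a b where "a < n" "b < n" "a \<noteq> b" "f a = f b" unfolding inj_on_def by auto
    from det_equal_rows[OF this, where q = q] show "(\<Prod>r<n. p (f r) r) *
      (\<Sum>\<pi> | \<pi> permutes {..<n}. of_int (sign \<pi>) * (\<Prod>r<n. q (f r) (\<pi> r))) = 0" by (simp only: mult_zero_right)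
  qed
  finally show ?thesis .
qed

text \<open>Each Segre vector flattens to a 4 by 4 matrix of rank at most 1, so a sum of three of
  them is singular.\<close>

lemma flattening_det:
  fixes P :: "'k::field_char_0 config" and flat :: "nat \<Rightarrow> nat \<Rightarrow> nat"
  assumes "\<And>a r c. r < 4 \<Longrightarrow> c < 4 \<Longrightarrow> segre_vector 4 a (flat r c) = p a r * (q a c :: 'k)"
  shows "(\<Sum>\<pi> | \<pi> permutes {..<4}. of_int (sign \<pi>) * (\<Prod>r<4. segre_sum 4 3 P (flat r (\<pi> r)))) = 0"
proof -
  have "segre_sum 4 3 P (flat r (\<pi> r)) = (\<Sum>j<3. p (P j) r * q (P j) (\<pi> r))"
    if "\<pi> permutes {..<4}" "r < 4" for \<pi> r
  proof -
    have "\<pi> r < 4" using permutes_in_image[OF that(1), of r] that(2) by simp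
    then show ?thesis unfolding segre_sum_def using assms that(2) by simp
  qed
  then have "(\<Sum>\<pi> | \<pi> permutes {..<4}. of_int (sign \<pi>) * (\<Prod>r<4. segre_sum 4 3 P (flat r (\<pi> r)))) =
    (\<Sum>\<pi> | \<pi> permutes {..<4}. of_int (sign \<pi>) * (\<Prod>r<4. \<Sum>j<3. p (P j) r * q (P j) (\<pi> r)))"
    by (intro sum.cong prod.cong arg_cong2[of _ _ _ _ "(*)"] refl) auto
  also have "\<dots> = 0" by (rule det_low_rank) simp
  finally show ?thesis .
qed

section \<open>Reduction of monomials modulo the two determinants\<close>

definition mon :: "nat \<Rightarrow> ('x \<Rightarrow> nat \<Rightarrow> 'k::field) \<Rightarrow> (nat \<Rightarrow> nat) \<Rightarrow> 'x \<Rightarrow> 'k" where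
  "mon N \<Phi> \<beta> = (\<lambda>x. \<Prod>k\<le>N. \<Phi> x k ^ \<beta> k)"

lemma prod_eq_mon:
  assumes "\<And>r. r < n \<Longrightarrow> ix r \<le> N"
  shows "(\<Prod>r<n. \<Phi> x (ix r)) = mon N \<Phi> (\<lambda>k. \<Sum>r<n. of_bool (k = ix r)) x"
proof -
  have "\<Phi> x (ix r) = (\<Prod>k\<le>N. \<Phi> x k ^ of_bool (k = ix r))" if "r < n" for r
  proof -
    have "(\<Prod>k\<le>N. \<Phi> x k ^ of_bool (k = ix r)) = (\<Prod>k\<le>N. if k = ix r then \<Phi> x k else 1)"
      by (intro prod.cong) auto
    then show ?thesis using assms[OF that] by simp
  qed
  then have "(\<Prod>r<n. \<Phi> x (ix r)) = (\<Prod>r<n. \<Prod>k\<le>N. \<Phi> x k ^ of_bool (k = ix r))" by simp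
  also have "\<dots> = (\<Prod>k\<le>N. \<Prod>r<n. \<Phi> x k ^ of_bool (k = ix r))" by (rule prod.swap)
  finally show ?thesis by (simp add: mon_def power_sum)
qed

text \<open>The relation is solved for its diagonal term, the only one with all variables in
  \<open>S\<close>; every other term has the same degree but fewer variables from
  \<open>S\<close>.\<close>

lemma det_reduction:
  fixes \<Phi> :: "'x \<Rightarrow> nat \<Rightarrow> 'k::field_char_0" and flat :: "nat \<Rightarrow> nat \<Rightarrow> nat"
  assumes det: "\<And>x. (\<Sum>\<pi> | \<pi> permutes {..<n}. of_int (sign \<pi>) * (\<Prod>r<n. \<Phi> x (flat r (\<pi> r)))) = 0"
    and ix: "\<And>r c. r < n \<Longrightarrow> c < n \<Longrightarrow> flat r c \<le> N" "inj_on (\<lambda>r. flat r r) {..<n}"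
    and S: "finite S" "\<And>r. r < n \<Longrightarrow> flat r r \<in> S"
    and lead: "\<And>\<pi>. \<pi> permutes {..<n} \<Longrightarrow> \<forall>r<n. flat r (\<pi> r) \<in> S \<Longrightarrow> \<pi> = id"
    and \<beta>: "\<And>r. r < n \<Longrightarrow> \<beta> (flat r r) \<noteq> 0"
  shows "mon N \<Phi> \<beta> \<in> funs.span {mon N \<Phi> \<gamma> |\<gamma>. (\<Sum>k\<le>N. \<gamma> k) = (\<Sum>k\<le>N. \<beta> k) \<and> (\<Sum>k\<in>S. \<gamma> k) < (\<Sum>k\<in>S. \<beta> k)}"
    (is "_ \<in> funs.span ?B")
proof -
  define e :: "(nat \<Rightarrow> nat) \<Rightarrow> nat \<Rightarrow> nat" where "e \<pi> k = (\<Sum>r<n. of_bool (k = flat r (\<pi> r)))" for \<pi> k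
  \<comment> \<open>The quotient by the diagonal monomial; it is exact because the diagonal
    variables are distinct and all occur in \<beta>.\<close>
  define \<alpha> where "\<alpha> k = \<beta> k - e id k" for k
  have "e id k \<le> \<beta> k" for k
  proof (cases "\<exists>r<n. k = flat r r")
    case True
    then obtain r where r: "r < n" "k = flat r r" by blast
    have "e id k = (\<Sum>r'<n. if r' = r then 1 else 0)"
      unfolding e_def r(2) using ix(2) r(1) by (intro sum.cong refl) (auto simp: inj_on_def)
    then show ?thesis using \<beta>[OF r(1)] r by simp
  qed (simp add: e_def)
  then have \<beta>\<alpha>: "\<beta> k = \<alpha> k + e id k" for k by (simp add: \<alpha>_def)
  have flat: "flat r (\<pi> r) \<le> N" if "\<pi> permutes {..<n}" "r < n" for \<pi> r
    using ix(1)[OF that(2)] permutes_in_image[OF that(1), of r] that(2) by simp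
  have mon_e: "(\<Prod>r<n. \<Phi> x (flat r (\<pi> r))) = mon N \<Phi> (e \<pi>) x" if "\<pi> permutes {..<n}" for \<pi> x
    unfolding e_def[abs_def] by (rule prod_eq_mon[of n "\<lambda>r. flat r (\<pi> r)"]) (rule flat[OF that])
  have sum_e: "(\<Sum>k\<in>A. e \<pi> k) = (\<Sum>r<n. of_bool (flat r (\<pi> r) \<in> A))" if "finite A" for A \<pi>
  proof -
    have "(\<Sum>k\<in>A. e \<pi> k) = (\<Sum>r<n. \<Sum>k\<in>A. of_bool (k = flat r (\<pi> r)))"
      unfolding e_def by (rule sum.swap)
    also have "\<dots> = (\<Sum>r<n. of_bool (flat r (\<pi> r) \<in> A))"
      using that by (intro sum.cong refl) (simp add: of_bool_def)
    finally show ?thesis .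
  qed
  have mon_add: "mon N \<Phi> (\<lambda>k. \<gamma> k + \<delta> k) x = mon N \<Phi> \<gamma> x * mon N \<Phi> \<delta> x" for \<gamma> \<delta> x
    by (simp add: mon_def power_add prod.distrib)
  let ?\<Pi> = "{\<pi>. \<pi> permutes {..<n}}"
  have fin: "finite ?\<Pi>" by (simp add: finite_permutations)
  have "mon N \<Phi> \<beta> x = (\<Sum>\<pi>\<in>?\<Pi> - {id}. - of_int (sign \<pi>) * mon N \<Phi> (\<lambda>k. \<alpha> k + e \<pi> k) x)" for x
  proof -
    have "(\<Sum>\<pi>\<in>?\<Pi>. of_int (sign \<pi>) * mon N \<Phi> (e \<pi>) x) = 0"
      using det[of x] by (simp add: mon_e)
    then have "mon N \<Phi> (e id) x = - (\<Sum>\<pi>\<in>?\<Pi> - {id}. of_int (sign \<pi>) * mon N \<Phi> (e \<pi>) x)"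
      using sum.remove[OF fin, of id "\<lambda>\<pi>. of_int (sign \<pi>) * mon N \<Phi> (e \<pi>) x"]
      by (simp add: permutes_id sign_id eq_neg_iff_add_eq_0)
    moreover have "mon N \<Phi> \<beta> x = mon N \<Phi> \<alpha> x * mon N \<Phi> (e id) x"
      using mon_add[of \<alpha> "e id" x] \<beta>\<alpha> by (simp add: mon_def)
    ultimately show ?thesis
      by (simp add: mon_add sum_distrib_left sum_negf algebra_simps)
  qed
  then have eq: "mon N \<Phi> \<beta> = (\<lambda>x. \<Sum>\<pi>\<in>?\<Pi> - {id}. - of_int (sign \<pi>) * mon N \<Phi> (\<lambda>k. \<alpha> k + e \<pi> k) x)"
    by blast
  have "mon N \<Phi> (\<lambda>k. \<alpha> k + e \<pi> k) \<in> ?B" if "\<pi> \<in> ?\<Pi> - {id}" for \<pi>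
  proof -
    have \<pi>: "\<pi> permutes {..<n}" "\<pi> \<noteq> id" using that by auto
    have "(\<Sum>k\<le>N. e \<rho> k) = n" if "\<rho> permutes {..<n}" for \<rho>
      using flat[OF that] by (simp add: sum_e)
    then have "(\<Sum>k\<le>N. \<alpha> k + e \<pi> k) = (\<Sum>k\<le>N. \<beta> k)"
      using \<pi>(1) permutes_id[of "{..<n}"] by (simp add: \<beta>\<alpha> sum.distrib del: permutes_id)
    moreover have "(\<Sum>k\<in>S. e \<pi> k) < (\<Sum>k\<in>S. e id k)"
    proof -
      obtain r where r: "r < n" "flat r (\<pi> r) \<notin> S" using lead[OF \<pi>(1)] \<pi>(2) by blast
      have "(\<Sum>r<n. of_bool (flat r (\<pi> r) \<in> S)) < (\<Sum>r<n. 1 :: nat)"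
        by (rule sum_strict_mono_ex1) (use r in auto)
      then show ?thesis using S by (simp add: sum_e)
    qed
    then have "(\<Sum>k\<in>S. \<alpha> k + e \<pi> k) < (\<Sum>k\<in>S. \<beta> k)" by (simp add: \<beta>\<alpha> sum.distrib)
    ultimately show ?thesis by blast
  qed
  then show ?thesis
    unfolding eq by (intro funs_span_sum funs_span_cmult funs.span_base) blast
qed

text \<open>
  The variables of the two diagonals.  Counting the variables in this set orders the monomials so that
  each of the two determinants has the product of its diagonal as the unique leading monomial.
\<close>

definition leading_vars :: "nat set" where
  "leading_vars = {0, 1, 2, 5, 10, 13, 14, 15}"

lemma less_4_cases: "r < 4 \<longleftrightarrow> r = 0 \<or> r = 1 \<or> r = 2 \<or> r = (3 :: nat)"
  by auto

lemma permutes_4_eq_id: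
  assumes "\<pi> permutes {..<4 :: nat}" "\<pi> 0 = 0" "\<pi> 1 = 1" "\<pi> 2 = 2" "\<pi> 3 = 3"
  shows "\<pi> = id"
proof
  fix r
  show "\<pi> r = id r"
  proof (cases "r < 4")
    case True
    then show ?thesis unfolding less_4_cases using assms(2-5) by (elim disjE) simp_all
  next
    case False
    then show ?thesis using permutes_not_in[OF assms(1), of r] by simp
  qed
qed

text \<open>Rows 0 and 3 meet the leading variables only on the diagonal, and the entries (1, 2) and
  (2, 1) are not leading, so the middle rows cannot be exchanged.\<close>

lemma flat1_lead:
  assumes \<pi>: "\<pi> permutes {..<4}" and S: "\<forall>r<4. flat1 r (\<pi> r) \<in> leading_vars"
  shows "\<pi> = id"
proof -
  have \<pi>4: "\<pi> r < 4" if "r < 4" for r using permutes_in_image[OF \<pi>, of r] that by simp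
  have inj: "\<pi> r = \<pi> r' \<longleftrightarrow> r = r'" for r r' using permutes_inj[OF \<pi>] by (auto simp: inj_def)
  have row: "flat1 0 c \<in> leading_vars \<longleftrightarrow> c = 0" "flat1 1 c \<in> leading_vars \<longleftrightarrow> c \<noteq> 2"
    "flat1 2 c \<in> leading_vars \<longleftrightarrow> c \<noteq> 1" "flat1 3 c \<in> leading_vars \<longleftrightarrow> c = 3" if "c < 4" for c
    using that unfolding less_4_cases by (elim disjE; simp add: flat1_def leading_vars_def)+
  have 0: "\<pi> 0 = 0" and 3: "\<pi> 3 = 3" using row(1)[OF \<pi>4[of 0]] row(4)[OF \<pi>4[of 3]] S by simp_all
  have "\<pi> 1 \<noteq> 0" "\<pi> 1 \<noteq> 3" "\<pi> 2 \<noteq> 0" "\<pi> 2 \<noteq> 3"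
    using inj[of 1 0] inj[of 1 3] inj[of 2 0] inj[of 2 3] 0 3 by simp_all
  moreover have "\<pi> 1 \<noteq> 2" "\<pi> 2 \<noteq> 1" using row(2)[OF \<pi>4[of 1]] row(3)[OF \<pi>4[of 2]] S by auto
  ultimately have "\<pi> 1 = 1" "\<pi> 2 = 2" using \<pi>4[of 1] \<pi>4[of 2] unfolding less_4_cases by simp_all
  then show ?thesis using permutes_4_eq_id[OF \<pi> 0 _ _ 3] by blast
qed

lemma flat2_lead:
  assumes \<pi>: "\<pi> permutes {..<4}" and S: "\<forall>r<4. flat2 r (\<pi> r) \<in> leading_vars"
  shows "\<pi> = id"
proof -
  have \<pi>4: "\<pi> r < 4" if "r < 4" for r using permutes_in_image[OF \<pi>, of r] that by simp
  have inj: "\<pi> r = \<pi> r' \<longleftrightarrow> r = r'" for r r' using permutes_inj[OF \<pi>] by (auto simp: inj_def)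
  have row: "flat2 0 c \<in> leading_vars \<longleftrightarrow> c \<noteq> 3" "flat2 1 c \<in> leading_vars \<longleftrightarrow> c = 1"
    "flat2 2 c \<in> leading_vars \<longleftrightarrow> c = 2" "flat2 3 c \<in> leading_vars \<longleftrightarrow> c \<noteq> 0" if "c < 4" for c
    using that unfolding less_4_cases by (elim disjE; simp add: flat2_def leading_vars_def)+
  have 1: "\<pi> 1 = 1" and 2: "\<pi> 2 = 2" using row(2)[OF \<pi>4[of 1]] row(3)[OF \<pi>4[of 2]] S by simp_all
  have "\<pi> 0 \<noteq> 1" "\<pi> 0 \<noteq> 2" "\<pi> 3 \<noteq> 1" "\<pi> 3 \<noteq> 2"
    using inj[of 0 1] inj[of 0 2] inj[of 3 1] inj[of 3 2] 1 2 by simp_all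
  moreover have "\<pi> 0 \<noteq> 3" "\<pi> 3 \<noteq> 0" using row(1)[OF \<pi>4[of 0]] row(4)[OF \<pi>4[of 3]] S by auto
  ultimately have "\<pi> 0 = 0" "\<pi> 3 = 3" using \<pi>4[of 0] \<pi>4[of 3] unfolding less_4_cases by simp_all
  then show ?thesis using permutes_4_eq_id[OF \<pi> _ 1 2] by blast
qed

lemma flat1_le: "r < 4 \<Longrightarrow> c < 4 \<Longrightarrow> flat1 r c \<le> 15"
  by (simp add: flat1_def)

lemma flat2_le: "r < 4 \<Longrightarrow> c < 4 \<Longrightarrow> flat2 r c \<le> 15"
  unfolding less_4_cases by (elim disjE) (simp_all add: flat2_def)

lemma flat1_diagonal: "r < 4 \<Longrightarrow> flat1 r r \<in> leading_vars"
  unfolding less_4_cases by (elim disjE) (simp_all add: flat1_def leading_vars_def)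

lemma flat2_diagonal: "r < 4 \<Longrightarrow> flat2 r r \<in> leading_vars"
  unfolding less_4_cases by (elim disjE) (simp_all add: flat2_def leading_vars_def)

lemma inj_flat1: "inj_on (\<lambda>r. flat1 r r) {..<4}"
  by (auto simp: inj_on_def flat1_def)

lemma inj_flat2: "inj_on (\<lambda>r. flat2 r r) {..<4}"
proof -
  have "{..<4} = {0, 1, 2, 3 :: nat}" by auto
  then show ?thesis by (simp add: flat2_def)
qed

text \<open>The monomials divisible by neither leading monomial. These use the disjoint sets of
  variables \<open>{0, 5, 10, 15}\<close> and \<open>{1, 2, 13, 14}\<close>.\<close>

definition standard_exponents :: "nat \<Rightarrow> (nat \<Rightarrow> nat) set" where
  "standard_exponents d = {\<beta>. (\<Sum>k\<le>15. \<beta> k) = d \<and> (\<exists>r<4. \<beta> (flat1 r r) = 0) \<and> (\<exists>r<4. \<beta> (flat2 r r) = 0)}"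

text \<open>The rewriting terminates since the number of leading variables, counted with
  multiplicity, drops in each step.\<close>

lemma monomial_reduction:
  fixes \<Phi> :: "'k::field_char_0 config \<Rightarrow> nat \<Rightarrow> 'k"
  defines "\<Phi> \<equiv> segre_sum 4 3"
  assumes "(\<Sum>k\<le>15. \<beta> k) = d"
  shows "mon 15 \<Phi> \<beta> \<in> funs.span (mon 15 \<Phi> ` standard_exponents d)"
  using assms(2)
proof (induction "\<Sum>k\<in>leading_vars. \<beta> k" arbitrary: \<beta> rule: less_induct)
  case less
  have red: "mon 15 \<Phi> \<beta> \<in> funs.span (mon 15 \<Phi> ` standard_exponents d)"
    if "mon 15 \<Phi> \<beta> \<in> funs.span {mon 15 \<Phi> \<gamma> |\<gamma>. (\<Sum>k\<le>15. \<gamma> k) = (\<Sum>k\<le>15. \<beta> k) \<and>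
      (\<Sum>k\<in>leading_vars. \<gamma> k) < (\<Sum>k\<in>leading_vars. \<beta> k)}" (is "_ \<in> funs.span ?B")
  proof -
    have "?B \<subseteq> funs.span (mon 15 \<Phi> ` standard_exponents d)"
    proof
      fix g assume "g \<in> ?B"
      then obtain \<gamma> where \<gamma>: "g = mon 15 \<Phi> \<gamma>" "(\<Sum>k\<le>15. \<gamma> k) = (\<Sum>k\<le>15. \<beta> k)"
        "(\<Sum>k\<in>leading_vars. \<gamma> k) < (\<Sum>k\<in>leading_vars. \<beta> k)" by blast
      then show "g \<in> funs.span (mon 15 \<Phi> ` standard_exponents d)"
        unfolding \<gamma>(1) using less.prems by (intro less.hyps) simp_all
    qed
    then have "funs.span ?B \<subseteq> funs.span (mon 15 \<Phi> ` standard_exponents d)"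
      by (rule funs.span_minimal) (rule funs.subspace_span)
    from subsetD[OF this that] show ?thesis .
  qed
  have fin: "finite leading_vars" by (simp add: leading_vars_def)
  consider "\<beta> \<in> standard_exponents d" | "\<forall>r<4. \<beta> (flat1 r r) \<noteq> 0" | "\<forall>r<4. \<beta> (flat2 r r) \<noteq> 0"
    using less.prems unfolding standard_exponents_def mem_Collect_eq by metis
  then show ?case
  proof cases
    case 1
    then show ?thesis by (intro funs.span_base imageI)
  next
    case 2
    show ?thesis
    proof (rule red, rule det_reduction[where flat = flat1 and n = 4])
      show "(\<Sum>\<pi> | \<pi> permutes {..<4}. of_int (sign \<pi>) * (\<Prod>r<4. \<Phi> P (flat1 r (\<pi> r)))) = 0" for P
        unfolding \<Phi>_def by (rule flattening_det[OF segre_vector_flat1])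
      show "inj_on (\<lambda>r. flat1 r r) {..<4}" by (rule inj_flat1)
      show "\<beta> (flat1 r r) \<noteq> 0" if "r < 4" for r using 2 that by blast
      show "\<pi> = id" if "\<pi> permutes {..<4}" "\<forall>r<4. flat1 r (\<pi> r) \<in> leading_vars" for \<pi>
        using that by (rule flat1_lead)
      show "flat1 r c \<le> 15" if "r < 4" "c < 4" for r c using that by (rule flat1_le)
      show "flat1 r r \<in> leading_vars" if "r < 4" for r using that by (rule flat1_diagonal)
    qed (rule fin)
  next
    case 3
    show ?thesis
    proof (rule red, rule det_reduction[where flat = flat2 and n = 4])
      show "(\<Sum>\<pi> | \<pi> permutes {..<4}. of_int (sign \<pi>) * (\<Prod>r<4. \<Phi> P (flat2 r (\<pi> r)))) = 0" for P
        unfolding \<Phi>_def by (rule flattening_det[OF segre_vector_flat2])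
      show "inj_on (\<lambda>r. flat2 r r) {..<4}" by (rule inj_flat2)
      show "\<beta> (flat2 r r) \<noteq> 0" if "r < 4" for r using 3 that by blast
      show "\<pi> = id" if "\<pi> permutes {..<4}" "\<forall>r<4. flat2 r (\<pi> r) \<in> leading_vars" for \<pi>
        using that by (rule flat2_lead)
      show "flat2 r c \<le> 15" if "r < 4" "c < 4" for r c using that by (rule flat2_le)
      show "flat2 r r \<in> leading_vars" if "r < 4" for r using that by (rule flat2_diagonal)
    qed (rule fin)
  qed
qed

text \<open>A standard monomial misses one variable of each diagonal, which allows 16 choices. Of
  the other 14 exponents 13 are free, as the degree fixes one.\<close>

lemma card_standard_monomials:
  fixes \<Phi> :: "'x \<Rightarrow> nat \<Rightarrow> 'k::field"
  shows "finite (mon 15 \<Phi> ` standard_exponents d) \<and> card (mon 15 \<Phi> ` standard_exponents d) \<le> 16 * (d + 1) ^ 13"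
proof -
  let ?J = "{..<4} \<times> {..<4} :: (nat \<times> nat) set"
  \<comment> \<open>The index 3 lies on neither diagonal, so its exponent can always absorb the rest
    of the degree.\<close>
  define I where "I = (\<lambda>(r, r'). {..15} - {flat1 r r, flat2 r' r', 3})"
  define f where "f z \<beta> x = (\<Prod>k\<in>I z. \<Phi> x k ^ \<beta> k) * \<Phi> x 3 ^ (d - (\<Sum>k\<in>I z. \<beta> k))"
    for z and \<beta> :: "nat \<Rightarrow> nat" and x
  define F where "F z = f z ` PiE (I z) (\<lambda>_. {..d})" for z
  have finI: "finite (I z)" for z by (auto simp: I_def split: prod.splits)
  have cardI: "card (I z) = 13" if z: "z \<in> ?J" for z
  proof -
    obtain r r' where r: "z = (r, r')" "r < 4" "r' < 4" using z by auto
    have sub: "{flat1 r r, flat2 r' r', 3} \<subseteq> {..15}"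
      using r by (auto simp: flat1_def flat2_def less_4_cases)
    have "card {flat1 r r, flat2 r' r', 3} = 3"
      using r(2,3) unfolding less_4_cases by (elim disjE) (simp_all add: flat1_def flat2_def)
    then show ?thesis using card_Diff_subset[OF _ sub] by (simp add: I_def r(1))
  qed
  have F: "finite (F z) \<and> card (F z) \<le> (d + 1) ^ 13" if "z \<in> ?J" for z
    using card_image_PiE_le[OF finI, of "F z" "f z" z d] cardI[OF that] by (simp add: F_def)
  have "mon 15 \<Phi> \<beta> \<in> (\<Union>z\<in>?J. F z)" if \<beta>: "\<beta> \<in> standard_exponents d" for \<beta>
  proof -
    obtain r r' where r: "r < 4" "r' < 4" "\<beta> (flat1 r r) = 0" "\<beta> (flat2 r' r') = 0"
      and d: "(\<Sum>k\<le>15. \<beta> k) = d"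
      using \<beta> unfolding standard_exponents_def by blast
    let ?z = "(r, r')"
    have 3: "3 \<notin> I ?z" "insert 3 (I ?z) \<subseteq> {..15}" by (auto simp: I_def)
    have out: "\<beta> k = 0" if "k \<in> {..15} - insert 3 (I ?z)" for k using that r by (auto simp: I_def)
    have "(\<Sum>k\<le>15. \<beta> k) = (\<Sum>k\<in>insert 3 (I ?z). \<beta> k)"
      by (rule sum.mono_neutral_right) (use out 3 in auto)
    then have sum: "\<beta> 3 + (\<Sum>k\<in>I ?z. \<beta> k) = d" using d 3(1) finI by simp
    have "mon 15 \<Phi> \<beta> x = f ?z (restrict \<beta> (I ?z)) x" for x
    proof -
      have "mon 15 \<Phi> \<beta> x = (\<Prod>k\<in>insert 3 (I ?z). \<Phi> x k ^ \<beta> k)"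
        unfolding mon_def by (rule prod.mono_neutral_right) (use out 3 in auto)
      then show ?thesis using 3(1) finI sum[symmetric] by (simp add: f_def mult.commute)
    qed
    then have "mon 15 \<Phi> \<beta> = f ?z (restrict \<beta> (I ?z))" by blast
    moreover have "restrict \<beta> (I ?z) \<in> PiE (I ?z) (\<lambda>_. {..d})"
    proof -
      have "\<beta> k \<le> d" if "k \<in> I ?z" for k using member_le_sum[OF that, of \<beta>] finI sum by simp
      then show ?thesis by auto
    qed
    ultimately have "mon 15 \<Phi> \<beta> \<in> F ?z" unfolding F_def by blast
    then show ?thesis using r(1,2) by auto
  qed
  then have sub: "mon 15 \<Phi> ` standard_exponents d \<subseteq> (\<Union>z\<in>?J. F z)" by blast
  have fin: "finite (\<Union>z\<in>?J. F z)" using F by blast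
  have "card (mon 15 \<Phi> ` standard_exponents d) \<le> card (\<Union>z\<in>?J. F z)" by (rule card_mono[OF fin sub])
  also have "\<dots> \<le> (\<Sum>z\<in>?J. card (F z))" by (rule card_UN_le) simp
  also have "\<dots> \<le> (\<Sum>z\<in>?J. (d + 1) ^ 13)" by (rule sum_mono) (use F in blast)
  also have "\<dots> = 16 * (d + 1) ^ 13" by simp
  finally show ?thesis using finite_subset[OF sub fin] by blast
qed

lemma indep_forms_4_3:
  fixes W :: "(nat \<Rightarrow> 'k::field_char_0) set"
  assumes "W \<subseteq> range (segre_sum 4 3)" "indep_forms 15 W d M"
  shows "M \<le> 16 * (d + 1) ^ 13"
proof -
  let ?\<Phi> = "segre_sum 4 3 :: 'k config \<Rightarrow> nat \<Rightarrow> 'k"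
  have "(\<lambda>P. poly_eval F (?\<Phi> P)) \<in> funs.span (mon 15 ?\<Phi> ` standard_exponents d)"
    if F: "is_form 15 d F" for F :: "'k mpoly"
    unfolding poly_eval_def
  proof (intro funs_span_sum funs_span_cmult)
    fix m assume m: "m \<in> Poly_Mapping.keys F"
    then have keys: "Poly_Mapping.keys m \<subseteq> {..15}" and deg: "mono_degree m = d"
      using F unfolding is_form_def by blast+
    have "(\<lambda>P. mono_eval m (?\<Phi> P)) = mon 15 ?\<Phi> (Poly_Mapping.lookup m)"
      unfolding mon_def mono_eval_superset[OF finite_atMost keys] ..
    moreover have "(\<Sum>k\<le>15. Poly_Mapping.lookup m k) = d"
      using deg mono_degree_superset[OF finite_atMost keys] by simp
    ultimately show "(\<lambda>P. mono_eval m (?\<Phi> P)) \<in> funs.span (mon 15 ?\<Phi> ` standard_exponents d)"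
      using monomial_reduction by metis
  qed
  then have "M \<le> card (mon 15 ?\<Phi> ` standard_exponents d)"
    using card_standard_monomials by (intro indep_forms_le_card[OF _ _ assms]) blast+
  then show ?thesis using card_standard_monomials[of ?\<Phi> d] by linarith
qed

section \<open>The dimension of the secant varieties\<close>

lemma secant_dim_ge:
  assumes "solvable TYPE('k::field_char_0) n s t" "1 \<le> n" "1 \<le> s" "t < 2 ^ n"
  shows "enat (2 ^ n - t - 1) \<le> proj_dim (2 ^ n - 1) (secant_variety (2 ^ n - 1) s (segre_variety n :: 'k point set))"
proof -
  obtain P :: "'k config" and E where
    "\<And>m. m \<le> 2 ^ n - t - 1 \<Longrightarrow> \<exists>a. \<forall>m'\<le>2 ^ n - t - 1. (\<Sum>k\<le>2 ^ n - 1. a k *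
      (case m' of 0 \<Rightarrow> segre_sum n s P | Suc l \<Rightarrow> segre_derivative n s P (E l)) k) = of_bool (m = m')"
    using solvable_imp_dual[OF assms] by blast
  then show ?thesis unfolding secant_variety_eq[OF assms(2)] by (rule proj_dim_ge)
qed

lemma secant_dim_le:
  fixes K :: nat
  assumes "1 \<le> n"
    and "\<And>(W :: (nat \<Rightarrow> 'k::field_char_0) set) d M.
      W \<subseteq> range (segre_sum n s) \<Longrightarrow> indep_forms (2 ^ n - 1) W d M \<Longrightarrow> M \<le> K * (d + 1) ^ q"
  shows "proj_dim (2 ^ n - 1) (secant_variety (2 ^ n - 1) s (segre_variety n :: 'k point set)) \<le> enat q"
  unfolding secant_variety_eq[OF assms(1)]
proof (rule proj_dim_le[OF secant_cone_subset])
  fix d M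
  assume "indep_forms (2 ^ n - 1) (secant_cone n s (UNIV :: 'k config set)) d M"
  then show "M \<le> K * (d + 1) ^ q" by (rule assms(2)[rotated]) (auto simp: secant_cone_def)
qed

lemma secant_dim_expected:
  assumes "3 \<le> n" "1 \<le> s" "(n, s) \<noteq> (4, 3)"
  shows "proj_dim (2 ^ n - 1) (secant_variety (2 ^ n - 1) s (segre_variety n :: 'k::field_char_0 point set)) =
    enat (min (2 ^ n - 1) (s * (n + 1) - 1))"
proof (rule antisym)
  have n: "1 \<le> n" using assms(1) by simp
  let ?dim = "proj_dim (2 ^ n - 1) (secant_variety (2 ^ n - 1) s (segre_variety n :: 'k point set))"
  have "?dim \<le> enat (2 ^ n - 1)"
    using indep_forms_ambient by (rule secant_dim_le[OF n])
  moreover have "?dim \<le> enat (s * (n + 1) - 1)"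
    using indep_forms_segre_sum[OF assms(2)] by (rule secant_dim_le[OF n])
  ultimately show "?dim \<le> enat (min (2 ^ n - 1) (s * (n + 1) - 1))"
    unfolding min_def by (simp only: split: if_split) blast
  \<comment> \<open>The number of missing conditions, truncated to 0 once the double zeros alone
    suffice; the two cases give the two entries of the minimum.\<close>
  define t where "t = 2 ^ n - s * (n + 1)"
  have pos: "0 < s * (n + 1)" using assms(2) by simp
  have "2 ^ n \<le> (n + 1) * s + t" by (simp add: t_def mult.commute)
  moreover have "2 \<le> t" if "n = 4" "s = 3" using assms(3) that by simp
  ultimately have "solvable TYPE('k) n s t" using solvable_expected by blast
  then have "enat (2 ^ n - t - 1) \<le> proj_dim (2 ^ n - 1) (secant_variety (2 ^ n - 1) s (segre_variety n :: 'k point set))"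
    by (rule secant_dim_ge[OF _ n assms(2)]) (use pos in \<open>simp add: t_def\<close>)
  moreover have "a - (a - b) - 1 = min (a - 1) (b - 1)" if "0 < b" for a b :: nat
    using that by arith
  from this[OF pos] have "2 ^ n - t - 1 = min (2 ^ n - 1) (s * (n + 1) - 1)" unfolding t_def .
  ultimately show "enat (min (2 ^ n - 1) (s * (n + 1) - 1)) \<le>
    proj_dim (2 ^ n - 1) (secant_variety (2 ^ n - 1) s (segre_variety n :: 'k point set))" by simp
qed

lemma secant_dim_4_3:
  "proj_dim (2 ^ 4 - 1) (secant_variety (2 ^ 4 - 1) 3 (segre_variety 4 :: 'k::field_char_0 point set)) = enat 13"
proof (rule antisym)
  have "M \<le> 16 * (d + 1) ^ 13"
    if "W \<subseteq> range (segre_sum 4 3)" "indep_forms (2 ^ 4 - 1) W d M" for W :: "(nat \<Rightarrow> 'k) set" and d M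
    using indep_forms_4_3[OF that(1)] that(2) by simp
  then show "proj_dim (2 ^ 4 - 1) (secant_variety (2 ^ 4 - 1) 3 (segre_variety 4 :: 'k point set)) \<le> enat 13"
    by (rule secant_dim_le[rotated]) simp_all
  \<comment> \<open>The two simple zeros demanded by the exception lower the dimension to 16 - 2 - 1
    = 13.\<close>
  have "solvable TYPE('k) 4 3 2" by (rule solvable_expected) simp_all
  from secant_dim_ge[OF this]
  show "enat 13 \<le> proj_dim (2 ^ 4 - 1) (secant_variety (2 ^ 4 - 1) 3 (segre_variety 4 :: 'k point set))"
    by simp
qed

theorem theorem4p1:
  shows "(\<forall>n s :: nat. n \<ge> 3 \<and> s \<ge> 1 \<and> (n, s) \<noteq> (4, 3) \<longrightarrow>
            proj_dim (2 ^ n - 1)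
                (secant_variety (2 ^ n - 1) s
                  (segre_variety n :: 'k::{alg_closed_field, field_char_0} point set)) =
              enat (min (2 ^ n - 1) (s * (n + 1) - 1)))
       \<and> proj_dim (2 ^ 4 - 1)
            (secant_variety (2 ^ 4 - 1) 3 (segre_variety 4 :: 'k point set)) = enat 13"
  using secant_dim_expected secant_dim_4_3 by blast

end
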